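(* Let $V$ be a separable Banach space, $\alpha,\beta\in(0,1)$ with $\alpha(1+\beta)>1$, and $A\in C^\alpha_tC^{1+\beta}_V$. Then the YDE associated to $A$ admits a flow of diffeomorphisms $\Phi$. Moreover, for any $x\in V$ and $s\in[0,T]$, $D_x\Phi_{s\to t}(x)=J^x_{s\to t}$ for $t\in[s,T]$, where $J^x_{s\to\cdot}\in C^\alpha([s,T];\mathcal L(V;V))$ is the unique solution to the variational equation \[ J^x_{s\to t}=I+\int_s^tDA(\mathrm{d} r,\Phi_{s\to r}(x))\circ J^x_{s\to r}\qquad\forall t\in[s,T], \] $\circ$ denoting composition of linear operators.
   Context: Fix $T>0$, $\Delta_2=\{(s,t):0\le s\le t\le T\}$, $\Delta_3=\{(s,u,t):0\le s\le u\le t\le T\}$. For $g:V\to W$, $\|g\|_\beta=\sup_{x\ne y}\|g(x)-g(y)\|_W/\|x-y\|_V^\beta+\sup\|g\|_W$. Fields $A:[0,T]\times V\to V$ satisfy $A(0,\cdot)=0$, $A_{s,t}(x)=A(t,x)-A(s,x)$; $\|A\|_{\alpha,\beta}=\sup_{s<t}\|A_{s,t}\|_\beta/|t-s|^\alpha$; $A\in C^\alpha_tC^{1+\beta}_V$ means $\|A\|_{\alpha,\beta}<\infty$, $A(t,\cdot)$ Fréchet differentiable and $\|DA\|_{\alpha,\beta}<\infty$. For a path $y\in C^\gamma([s,t];V)$ with $\alpha+\beta\gamma>1$, $\int_s^tA(\mathrm{d} r,y_r)=\lim_{|\Pi|\to0}\sum_iA_{t_i,t_{i+1}}(y_{t_i})$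 over partitions of $[s,t]$, and $\int_s^tDA(\mathrm{d} r,y_r)\circ J_r=\lim\sum_iDA_{t_i,t_{i+1}}(y_{t_i})\circ J_{t_i}$ for $J\in C^\alpha([s,t];\mathcal L(V;V))$. A flow of homeomorphisms for the YDE associated to $A$ is a map $\Phi:\Delta_2\times V\to V$, $\Phi_{s\to t}(x):=\Phi(s,t,x)$, such that: $\Phi(t,t,x)=x$; $\Phi(s,\cdot,x)\in C^\alpha([s,T];V)$; $\Phi(s,t,x)=x+\int_s^tA(\mathrm{d} r,\Phi(s,r,x))$ for all $(s,t,x)$; $\Phi(u,t,\Phi(s,u,x))=\Phi(s,t,x)$ for all $(s,u,t)\in\Delta_3$, $x\in V$; and each $\Phi_{s\to t}$ is a homeomorphism of $V$, with inverse denoted $\Phi_{s\leftarrow t}$. It is a flow of diffeomorphisms if moreover $\Phi_{s\to t}$ and $\Phi_{s\leftarrow t}$ are continuously Fréchet differentiable on $V$ for all $(s,t)\in\Delta_2$. *)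

theory Defs
  imports "HOL-Analysis.Analysis"
begin

definition hoelder_ratios :: "real \<Rightarrow> ('v::real_normed_vector \<Rightarrow> 'w::real_normed_vector) \<Rightarrow> real set" where
  "hoelder_ratios \<beta> g = {norm (g x - g y) / norm (x - y) powr \<beta> | x y. x \<noteq> y}"

definition hoelder_norm :: "real \<Rightarrow> ('v::real_normed_vector \<Rightarrow> 'w::real_normed_vector) \<Rightarrow> real" where
  "hoelder_norm \<beta> g = Sup (hoelder_ratios \<beta> g) + Sup (range (\<lambda>x. norm (g x)))"

definition hoelder_finite :: "real \<Rightarrow> ('v::real_normed_vector \<Rightarrow> 'w::real_normed_vector) \<Rightarrow> bool" where
  "hoelder_finite \<beta> g \<longleftrightarrow> bdd_above (hoelder_ratios \<beta> g) \<and> bdd_above (range (\<lambda>x. norm (g x)))"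

definition incr :: "(real \<Rightarrow> 'v \<Rightarrow> 'w::real_normed_vector) \<Rightarrow> real \<Rightarrow> real \<Rightarrow> 'v \<Rightarrow> 'w" where
  "incr A s t = (\<lambda>x. A t x - A s x)"

definition field_finite :: "real \<Rightarrow> real \<Rightarrow> real \<Rightarrow> (real \<Rightarrow> 'v::real_normed_vector \<Rightarrow> 'w::real_normed_vector) \<Rightarrow> bool" where
  "field_finite T \<alpha> \<beta> A \<longleftrightarrow>
     (\<forall>s t. 0 \<le> s \<and> s < t \<and> t \<le> T \<longrightarrow> hoelder_finite \<beta> (incr A s t)) \<and>
     bdd_above {hoelder_norm \<beta> (incr A s t) / \<bar>t - s\<bar> powr \<alpha> | s t. 0 \<le> s \<and> s < t \<and> t \<le> T}"

definition field_C1beta :: "real \<Rightarrow> real \<Rightarrow> real \<Rightarrow> (real \<Rightarrow> 'v::real_normed_vector \<Rightarrow> 'v)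
     \<Rightarrow> (real \<Rightarrow> 'v \<Rightarrow> ('v \<Rightarrow>\<^sub>L 'v)) \<Rightarrow> bool" where
  "field_C1beta T \<alpha> \<beta> A DA \<longleftrightarrow>
     field_finite T \<alpha> \<beta> A \<and>
     (\<forall>t\<in>{0..T}. \<forall>x. (A t has_derivative blinfun_apply (DA t x)) (at x)) \<and>
     field_finite T \<alpha> \<beta> DA"

definition hoelder_path :: "real \<Rightarrow> real \<Rightarrow> real \<Rightarrow> (real \<Rightarrow> 'w::real_normed_vector) \<Rightarrow> bool" where
  "hoelder_path \<alpha> a b y \<longleftrightarrow>
     bdd_above {norm (y v - y u) / \<bar>v - u\<bar> powr \<alpha> | u v. a \<le> u \<and> u < v \<and> v \<le> b}"

definition is_partition :: "real \<Rightarrow> real \<Rightarrow> nat \<Rightarrow> (nat \<Rightarrow> real) \<Rightarrow> bool" where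
  "is_partition s t n p \<longleftrightarrow> p 0 = s \<and> p n = t \<and> (\<forall>i<n. p i < p (Suc i))"

definition riemann_lim :: "(real \<Rightarrow> real \<Rightarrow> 'w::real_normed_vector) \<Rightarrow> real \<Rightarrow> real \<Rightarrow> 'w \<Rightarrow> bool" where
  "riemann_lim \<Xi> s t I \<longleftrightarrow>
     (\<forall>\<epsilon>>0. \<exists>\<delta>>0. \<forall>n p. is_partition s t n p \<and> (\<forall>i<n. p (Suc i) - p i < \<delta>) \<longrightarrow>
        norm ((\<Sum>i<n. \<Xi> (p i) (p (Suc i))) - I) < \<epsilon>)"

definition nl_young_integral :: "(real \<Rightarrow> 'v \<Rightarrow> 'w::real_normed_vector) \<Rightarrow> (real \<Rightarrow> 'v) \<Rightarrow> real \<Rightarrow> real \<Rightarrow> 'w \<Rightarrow> bool" where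
  "nl_young_integral A y s t I \<longleftrightarrow> riemann_lim (\<lambda>u v. A v (y u) - A u (y u)) s t I"

definition var_young_integral :: "(real \<Rightarrow> 'v::real_normed_vector \<Rightarrow> ('v \<Rightarrow>\<^sub>L 'v)) \<Rightarrow> (real \<Rightarrow> 'v)
     \<Rightarrow> (real \<Rightarrow> ('v \<Rightarrow>\<^sub>L 'v)) \<Rightarrow> real \<Rightarrow> real \<Rightarrow> ('v \<Rightarrow>\<^sub>L 'v) \<Rightarrow> bool" where
  "var_young_integral DA y J s t I \<longleftrightarrow> riemann_lim (\<lambda>u v. (DA v (y u) - DA u (y u)) o\<^sub>L J u) s t I"

definition flow_homeo :: "real \<Rightarrow> real \<Rightarrow> (real \<Rightarrow> 'v::real_normed_vector \<Rightarrow> 'v) \<Rightarrow> (real \<Rightarrow> real \<Rightarrow> 'v \<Rightarrow> 'v) \<Rightarrow> bool" where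
  "flow_homeo T \<alpha> A \<Phi> \<longleftrightarrow>
     (\<forall>t\<in>{0..T}. \<forall>x. \<Phi> t t x = x) \<and>
     (\<forall>s\<in>{0..T}. \<forall>x. hoelder_path \<alpha> s T (\<lambda>t. \<Phi> s t x)) \<and>
     (\<forall>s t x. 0 \<le> s \<and> s \<le> t \<and> t \<le> T \<longrightarrow> nl_young_integral A (\<lambda>r. \<Phi> s r x) s t (\<Phi> s t x - x)) \<and>
     (\<forall>s u t x. 0 \<le> s \<and> s \<le> u \<and> u \<le> t \<and> t \<le> T \<longrightarrow> \<Phi> u t (\<Phi> s u x) = \<Phi> s t x) \<and>
     (\<forall>s t. 0 \<le> s \<and> s \<le> t \<and> t \<le> T \<longrightarrow> (\<exists>g. homeomorphism UNIV UNIV (\<Phi> s t) g))"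

definition C1_map :: "('v::real_normed_vector \<Rightarrow> 'w::real_normed_vector) \<Rightarrow> bool" where
  "C1_map f \<longleftrightarrow> (\<exists>D :: 'v \<Rightarrow> ('v \<Rightarrow>\<^sub>L 'w). (\<forall>x. (f has_derivative blinfun_apply (D x)) (at x)) \<and> continuous_on UNIV D)"

definition flow_diffeo :: "real \<Rightarrow> real \<Rightarrow> (real \<Rightarrow> 'v::real_normed_vector \<Rightarrow> 'v) \<Rightarrow> (real \<Rightarrow> real \<Rightarrow> 'v \<Rightarrow> 'v) \<Rightarrow> bool" where
  "flow_diffeo T \<alpha> A \<Phi> \<longleftrightarrow> flow_homeo T \<alpha> A \<Phi> \<and>
     (\<forall>s t. 0 \<le> s \<and> s \<le> t \<and> t \<le> T \<longrightarrow> C1_map (\<Phi> s t) \<and> C1_map (inv (\<Phi> s t)))"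

definition var_solution :: "real \<Rightarrow> real \<Rightarrow> (real \<Rightarrow> 'v::real_normed_vector \<Rightarrow> ('v \<Rightarrow>\<^sub>L 'v))
     \<Rightarrow> (real \<Rightarrow> real \<Rightarrow> 'v \<Rightarrow> 'v) \<Rightarrow> real \<Rightarrow> 'v \<Rightarrow> (real \<Rightarrow> ('v \<Rightarrow>\<^sub>L 'v)) \<Rightarrow> bool" where
  "var_solution T \<alpha> DA \<Phi> s x J \<longleftrightarrow> hoelder_path \<alpha> s T J \<and>
     (\<forall>t\<in>{s..T}. var_young_integral DA (\<lambda>r. \<Phi> s r x) J s t (J t - id_blinfun))"

end

theory Submission
  imports Defs
begin

text \<open>
  Solutions are characterised by the local expansion
  \<open>\<parallel>y t - y s - A_{s,t}(y s)\<parallel> \<le> M (t - s)\<^sup>\<theta>\<close> with \<open>\<theta> = \<alpha>(1 + \<beta>) > 1\<close> (Davie solutions).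
  A remainder of this kind that is merely finite is automatically controlled by its three-point defect
  \<open>R s t - R s u - R u t\<close>, and this yields one Gronwall lemma for germs, which is the only
  stability estimate needed.  Applied to a solution it gives uniform Hoelder bounds; applied to the difference of two
  solutions, Lipschitz dependence on the initial point and uniqueness; applied to a linear combination
  \<open>\<Sum>c_i (y_i - y)\<close>, an estimate in terms of \<open>\<Sum>c_i k_i\<close> and \<open>\<Sum>|c_i| \<parallel>k_i\<parallel>\<^sup>1\<^sup>+\<^sup>\<eta>\<close>, where
  \<open>k_i\<close> are the initial displacements.  The last estimate makes the difference quotients of the flow Cauchy with limits
  linear in the direction, so the flow is continuously differentiable without solving the variational equation first;
  that equation then follows because
  \<open>x \<mapsto> \<Phi>_{s,t}(x) - \<Phi>_{s,u}(x) - A_{u,t}(\<Phi>_{s,u}(x))\<close> is Lipschitz with constant \<open>O((t - u)\<^sup>\<theta>)\<close>.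
  Existence is Picard iteration on short intervals, and on short intervals the flow is a contraction perturbation
  of the identity, hence a diffeomorphism.
\<close>

section \<open>Sewing\<close>

text \<open>Self-improvement of a remainder rests on inequalities x \<le> q x + d, which say
  something only when x is known to be finite. Hence the existential constants in
  \<open>young_germ\<close> and \<open>davie\<close>: they are used qualitatively and disappear from
  the final bounds, so those bounds are uniform in the solution, the initial point and the interval.
  The obstacle to differentiability is that the Taylor error of the field along two solutions at
  initial distance k has order k^(1+\<beta>) only with time exponent \<alpha>, while the time
  exponent \<theta> > 1 comes only with order k. Because \<alpha> + \<alpha>\<beta> > 1 is strict, a
  slightly smaller time exponent still exceeds 1, and the spare part buys k^(1+\<eta>) for some
  \<eta> > 0. A solution of the variational equation is given only as a Hoelder path whose Riemann
  sums converge, not through a local expansion. Sewing produces a primitive with the expansion, and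
  uniqueness of Riemann limits identifies it with the solution; only then does the Gronwall lemma
  give uniqueness.\<close>

text \<open>The absorption principle: \<open>step\<close> is applied to the supremum itself, which
  \<open>B\<close> makes finite. \<open>B\<close> has no other role and does not appear in the bound
  obtained.\<close>

lemma sup_absorb:
  fixes f :: "'a \<Rightarrow> real"
  assumes bdd: "\<And>x. x \<in> S \<Longrightarrow> f x \<le> B" and q: "0 \<le> q" "q < 1" and d: "0 \<le> d"
    and step: "\<And>M x. 0 \<le> M \<Longrightarrow> (\<And>y. y \<in> S \<Longrightarrow> f y \<le> M) \<Longrightarrow> x \<in> S \<Longrightarrow> f x \<le> q * M + d"
    and x: "x \<in> S"
  shows "f x \<le> d / (1 - q)"
proof -
  have bd: "bdd_above (f ` S)" using bdd by (auto simp: bdd_above_def)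
  \<comment> \<open>The maximum with 0 only serves the premise \<open>0 \<le> M\<close> of
    \<open>step\<close>; if it is attained by 0, the resulting inequality is
    \<open>0 \<le> d\<close>.\<close>
  define M where "M = max 0 (Sup (f ` S))"
  have M: "f y \<le> M" if "y \<in> S" for y
    using cSUP_upper[OF that bd] by (auto simp: M_def)
  have "Sup (f ` S) \<le> q * M + d"
    using step[of M] M x by (intro cSUP_least) (auto simp: M_def)
  then have "M \<le> q * M + d" using q d by (auto simp: M_def max_def)
  then have "M \<le> d / (1 - q)" using q by (simp add: field_simps)
  with M[OF x] show ?thesis by simp
qed

lemma ex_small_powr:
  fixes \<alpha> E :: real
  assumes "0 < \<alpha>" "0 \<le> E"
  shows "\<exists>h. 0 < h \<and> h \<le> 1 \<and> E * h powr \<alpha> \<le> 1/2"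
proof -
  \<comment> \<open>Up to the cap at 1, this solves (E + 1) h^\<alpha> = 1/2; using E + 1 avoids a
    division by zero.\<close>
  define h where "h = min 1 ((1/(2*(E+1))) powr (1/\<alpha>))"
  have "h powr \<alpha> \<le> ((1/(2*(E+1))) powr (1/\<alpha>)) powr \<alpha>"
    using assms by (intro powr_mono2) (auto simp: h_def)
  also have "\<dots> = 1/(2*(E+1))" using assms by (simp add: powr_powr)
  finally have "E * h powr \<alpha> \<le> E * (1/(2*(E+1)))" using assms by (intro mult_left_mono) auto
  also have "\<dots> \<le> 1/2" using assms by (simp add: field_simps)
  finally show ?thesis using assms by (intro exI[of _ h]) (auto simp: h_def)
qed

lemma powr_le_powr_exp_le_1:
  fixes x :: real
  assumes "0 \<le> x" "x \<le> 1" "a \<le> b"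
  shows "x powr b \<le> x powr a"
  using assms powr_mono'[of a b x] by (cases "x = 0") auto

lemma powr_le_scaled:
  fixes x T :: real
  assumes "0 \<le> x" "x \<le> T" "a \<le> b"
  shows "x powr b \<le> T powr (b - a) * x powr a"
proof -
  have "x powr b = x powr (b - a) * x powr a" by (simp flip: powr_add)
  also have "\<dots> \<le> T powr (b - a) * x powr a" using assms by (intro mult_right_mono powr_mono2) auto
  finally show ?thesis .
qed

text \<open>The reason why errors of order above 1 vanish in Riemann sums: \<theta> - 1 of the
  powers go to the mesh, and what remains telescopes.\<close>

lemma sum_powr_mesh_le:
  fixes p :: "nat \<Rightarrow> real"
  assumes "\<And>i. i < n \<Longrightarrow> p i \<le> p (Suc i)" "\<And>i. i < n \<Longrightarrow> p (Suc i) - p i \<le> \<delta>" "1 \<le> \<theta>"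
  shows "(\<Sum>i<n. (p (Suc i) - p i) powr \<theta>) \<le> \<delta> powr (\<theta> - 1) * (p n - p 0)"
proof -
  have "(\<Sum>i<n. (p (Suc i) - p i) powr \<theta>) \<le> (\<Sum>i<n. \<delta> powr (\<theta> - 1) * (p (Suc i) - p i))"
  proof (rule sum_mono)
    fix i assume "i \<in> {..<n}"
    then show "(p (Suc i) - p i) powr \<theta> \<le> \<delta> powr (\<theta> - 1) * (p (Suc i) - p i)"
      using powr_le_scaled[of "p (Suc i) - p i" \<delta> 1 \<theta>] assms by auto
  qed
  also have "\<dots> = \<delta> powr (\<theta> - 1) * (p n - p 0)"
    by (simp flip: sum_distrib_left add: sum_lessThan_telescope)
  finally show ?thesis .
qed

lemma convergent_if_geometric_increments:
  fixes X :: "nat \<Rightarrow> 'a::banach"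
  assumes "\<And>n. norm (X (Suc n) - X n) \<le> c * q ^ n" "0 \<le> q" "q < 1"
  shows "convergent X"
proof -
  have "summable (\<lambda>n. c * q ^ n)" using assms(2,3) by (intro summable_mult summable_geometric) auto
  then have "summable (\<lambda>n. X (Suc n) - X n)"
    by (rule summable_comparison_test'[where N = 0]) (rule assms(1))
  then have "convergent (\<lambda>n. \<Sum>i<n. X (Suc i) - X i)" by (simp add: summable_iff_convergent)
  then have "convergent (\<lambda>n. (X n - X 0) + X 0)"
    by (intro convergent_add) (auto simp: sum_lessThan_telescope convergent_const)
  then show ?thesis by simp
qed

section \<open>Bisection estimates and the sewing lemma\<close>

text \<open>The geometric series of 2^(n(1-\<theta>)): at level n of a bisection there are 2^n
  pieces, each costing (2^-n)^\<theta>.\<close>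

definition sew_const :: "real \<Rightarrow> real" where
  "sew_const \<theta> = 1 / (1 - 2 powr (1 - \<theta>))"

lemma sew_const_pos: "1 < \<theta> \<Longrightarrow> 0 < sew_const \<theta>"
  unfolding sew_const_def using powr_less_mono[of "1-\<theta>" 0 2] by simp

lemma half_powr: "0 \<le> x \<Longrightarrow> 2 * (x / 2) powr \<theta> = 2 powr (1 - \<theta>) * x powr \<theta>" for x :: real
  by (simp add: powr_divide powr_diff)

text \<open>An a priori bound with an arbitrary constant \<open>M\<close> self-improves, by bisecting the interval.\<close>
lemma sewing_bound:
  fixes R :: "real \<Rightarrow> real \<Rightarrow> 'w::real_normed_vector"
  assumes \<theta>: "1 < \<theta>" and D: "0 \<le> D"
    and M: "\<And>s t. a \<le> s \<Longrightarrow> s \<le> t \<Longrightarrow> t \<le> b \<Longrightarrow> norm (R s t) \<le> M * (t - s) powr \<theta>"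
    and \<delta>: "\<And>s u t. a \<le> s \<Longrightarrow> s \<le> u \<Longrightarrow> u \<le> t \<Longrightarrow> t \<le> b \<Longrightarrow>
          norm (R s t - R s u - R u t) \<le> D * (t - s) powr \<theta>"
    and st: "a \<le> s" "s \<le> t" "t \<le> b"
  shows "norm (R s t) \<le> sew_const \<theta> * D * (t - s) powr \<theta>"
proof (cases "s = t")
  case True
  then show ?thesis using M[of s t] st by simp
next
  case False
  define S where "S = {(s, t). a \<le> s \<and> s < t \<and> t \<le> b}"
  define f where "f = (\<lambda>(s, t). norm (R s t) / (t - s) powr \<theta>)"
  have q: "2 powr (1 - \<theta>) < (1::real)" using \<theta> powr_less_mono[of "1-\<theta>" 0 "2::real"] by simp
  have "f (s, t) \<le> D / (1 - 2 powr (1 - \<theta>))"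
  proof (rule sup_absorb[where S = S and B = M])
    fix x assume "x \<in> S"
    then show "f x \<le> M" using M by (auto simp: S_def f_def field_simps)
  next
    fix K x assume K: "0 \<le> K" "\<And>y. y \<in> S \<Longrightarrow> f y \<le> K" and "x \<in> S"
    obtain s t where x: "x = (s, t)" by (cases x)
    with \<open>x \<in> S\<close> have st: "a \<le> s" "s < t" "t \<le> b" by (auto simp: S_def)
    define u where "u = (s + t) / 2"
    have u: "s < u" "u < t" "u - s = (t - s) / 2" "t - u = (t - s) / 2"
      using st by (auto simp: u_def field_simps)
    have KK: "norm (R s' t') \<le> K * (t' - s') powr \<theta>" if "a \<le> s'" "s' < t'" "t' \<le> b" for s' t'
      using K(2)[of "(s', t')"] that by (auto simp: S_def f_def field_simps)
    have "norm (R s t) \<le> norm (R s u) + norm (R u t) + norm (R s t - R s u - R u t)"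
      using norm_triangle_ineq[of "R s u + R u t" "R s t - R s u - R u t"] norm_triangle_ineq[of "R s u" "R u t"]
      by (simp add: algebra_simps)
    also have "\<dots> \<le> K * ((t - s) / 2) powr \<theta> + K * ((t - s) / 2) powr \<theta> + D * (t - s) powr \<theta>"
      using KK[of s u] KK[of u t] \<delta>[of s u t] u st by (intro add_mono) auto
    also have "\<dots> = K * (2 * ((t - s) / 2) powr \<theta>) + D * (t - s) powr \<theta>" by simp
    also have "\<dots> = (2 powr (1 - \<theta>) * K + D) * (t - s) powr \<theta>"
      using half_powr[of "t - s" \<theta>] st by (simp add: algebra_simps)
    finally show "f x \<le> 2 powr (1 - \<theta>) * K + D" using st by (simp add: f_def x field_simps)
  qed (use D q st False in \<open>auto simp: S_def\<close>)
  then show ?thesis using st False by (simp add: f_def sew_const_def field_simps)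
qed

lemma norm_add_add_diff_diff_le:
  fixes x y z w :: "'a::real_normed_vector"
  assumes "norm x \<le> a" "norm y \<le> b" "norm z \<le> c" "norm w \<le> d"
  shows "norm (x + y - z - w) \<le> a + b + c + d"
  using assms norm_triangle_ineq4[of "x + y - z" w] norm_triangle_ineq4[of "x + y" z] norm_triangle_ineq[of x y]
  by linarith

lemma partition_sum_bound:
  fixes \<Xi> :: "real \<Rightarrow> real \<Rightarrow> 'w::real_normed_vector"
  assumes \<theta>: "1 < \<theta>" and C: "0 \<le> C"
    and \<delta>: "\<And>s u t. a \<le> s \<Longrightarrow> s \<le> u \<Longrightarrow> u \<le> t \<Longrightarrow> t \<le> b \<Longrightarrow>
          norm (\<Xi> s t - \<Xi> s u - \<Xi> u t) \<le> C * (t - s) powr \<theta>"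
    and "a \<le> p 0" "p n \<le> b" "\<And>i. i < n \<Longrightarrow> p i \<le> p (Suc i)"
  shows "norm ((\<Sum>i<n. \<Xi> (p i) (p (Suc i))) - \<Xi> (p 0) (p n)) \<le> 2 * C * sew_const \<theta> * (p n - p 0) powr \<theta>"
  using assms(4-)
proof (induction n arbitrary: p rule: less_induct)
  case (less n)
  have mono: "p i \<le> p j" if "i \<le> j" "j \<le> n" for i j
    using that less.prems(3) by (induction j rule: dec_induct) (auto intro: order_trans)
  show ?case
  proof (cases "n = 0")
    case True
    then show ?thesis using \<delta>[of "p 0" "p 0" "p 0"] less.prems by simp
  next
    case False
    define m where "m = (p 0 + p n) / 2"
    \<comment> \<open>The last left endpoint not beyond the midpoint, so that
      \<open>p i \<le> m \<le> p (Suc i)\<close>; the bound \<open>i < n\<close> keeps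
      \<open>Suc i\<close> a valid index.\<close>
    define i where "i = Max {i. i < n \<and> p i \<le> m}"
    have m0: "p 0 \<le> m" "m \<le> p n" using mono[of 0 n] by (auto simp: m_def)
    have "i \<in> {i. i < n \<and> p i \<le> m}"
      unfolding i_def by (rule Max_in) (use m0 False in \<open>auto intro: exI[of _ 0]\<close>)
    then have i: "i < n" "p i \<le> m" by auto
    have i1: "m \<le> p (Suc i)"
    proof (rule ccontr)
      assume *: "\<not> ?thesis"
      then have "Suc i \<noteq> n" using m0 by auto
      then have "Suc i \<in> {i. i < n \<and> p i \<le> m}" using * i by auto
      then have "Suc i \<le> i" unfolding i_def by (intro Max_ge) auto
      then show False by simp
    qed
    define k where "k = n - Suc i"
    have n: "n = Suc i + k" using i by (simp add: k_def)
    define L where "L = p n - p 0"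
    have L: "0 \<le> L" using mono[of 0 n] by (simp add: L_def)
    \<comment> \<open>The fixed point of the recursion K = 2^(1-\<theta>) K + 2 C: two halves from
      the induction hypothesis and two defects.\<close>
    define K where "K = 2 * C * sew_const \<theta>"
    have K: "0 \<le> K" using C sew_const_pos[OF \<theta>] by (simp add: K_def)
    have half: "K * x powr \<theta> \<le> K * (L/2) powr \<theta>" if "0 \<le> x" "x \<le> L/2" for x
      using that K \<theta> by (intro mult_left_mono powr_mono2) auto
    have ord: "p 0 \<le> p i" "p i \<le> p (Suc i)" "p (Suc i) \<le> p n"
      using mono i by auto
    have 1: "norm ((\<Sum>j<i. \<Xi> (p j) (p (Suc j))) - \<Xi> (p 0) (p i)) \<le> K * (L/2) powr \<theta>"
      using i less.prems half[of "p i - p 0"] ord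
      by (intro order_trans[OF less.IH[of i p, folded K_def]]) (auto simp: L_def m_def field_simps)
    have "norm ((\<Sum>j<k. \<Xi> (p (Suc i + j)) (p (Suc i + Suc j))) - \<Xi> (p (Suc i + 0)) (p (Suc i + k)))
        \<le> K * (p (Suc i + k) - p (Suc i + 0)) powr \<theta>"
      unfolding K_def using less.prems n order_trans[OF less.prems(1) order_trans[OF ord(1,2)]] by (intro less.IH[of k "\<lambda>j. p (Suc i + j)"]) auto
    then have 2: "norm ((\<Sum>j<k. \<Xi> (p (Suc i + j)) (p (Suc (Suc i + j)))) - \<Xi> (p (Suc i)) (p n)) \<le> K * (L/2) powr \<theta>"
      using half[of "p n - p (Suc i)"] ord i1 by (simp add: L_def m_def n field_simps)
    have \<delta>1: "norm (\<Xi> (p 0) (p n) - \<Xi> (p 0) (p i) - \<Xi> (p i) (p n)) \<le> C * L powr \<theta>"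
      using \<delta>[of "p 0" "p i" "p n"] ord less.prems by (auto simp: L_def)
    have "norm (\<Xi> (p i) (p n) - \<Xi> (p i) (p (Suc i)) - \<Xi> (p (Suc i)) (p n)) \<le> C * (p n - p i) powr \<theta>"
      using \<delta>[of "p i" "p (Suc i)" "p n"] ord less.prems by auto
    also have "\<dots> \<le> C * L powr \<theta>" using C \<theta> ord by (intro mult_left_mono powr_mono2) (auto simp: L_def)
    finally have \<delta>2: "norm (\<Xi> (p i) (p n) - \<Xi> (p i) (p (Suc i)) - \<Xi> (p (Suc i)) (p n)) \<le> C * L powr \<theta>" .
    have split: "(\<Sum>j<n. \<Xi> (p j) (p (Suc j))) = (\<Sum>j<i. \<Xi> (p j) (p (Suc j))) + \<Xi> (p i) (p (Suc i))
        + (\<Sum>j<k. \<Xi> (p (Suc i + j)) (p (Suc (Suc i + j))))"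
      unfolding n sum.lessThan_Suc[symmetric] by (induction k) (auto simp: add.assoc)
    let ?s1 = "(\<Sum>j<i. \<Xi> (p j) (p (Suc j)))" and ?s2 = "(\<Sum>j<k. \<Xi> (p (Suc i + j)) (p (Suc (Suc i + j))))"
    have eq: "(\<Sum>j<n. \<Xi> (p j) (p (Suc j))) - \<Xi> (p 0) (p n) =
       (?s1 - \<Xi> (p 0) (p i)) + (?s2 - \<Xi> (p (Suc i)) (p n))
       - (\<Xi> (p 0) (p n) - \<Xi> (p 0) (p i) - \<Xi> (p i) (p n))
       - (\<Xi> (p i) (p n) - \<Xi> (p i) (p (Suc i)) - \<Xi> (p (Suc i)) (p n))"
      unfolding split by (simp add: algebra_simps)
    have "norm ((\<Sum>j<n. \<Xi> (p j) (p (Suc j))) - \<Xi> (p 0) (p n)) \<le>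
      K * (L/2) powr \<theta> + K * (L/2) powr \<theta> + C * L powr \<theta> + C * L powr \<theta>"
      unfolding eq using 1 2 \<delta>1 \<delta>2
      by (intro norm_add_add_diff_diff_le)
    also have "\<dots> = K * (2 * (L/2) powr \<theta>) + 2 * C * L powr \<theta>" by simp
    also have "\<dots> = (K * 2 powr (1 - \<theta>) + 2 * C) * L powr \<theta>"
      unfolding half_powr[OF L] by (simp add: algebra_simps)
    also have "K * 2 powr (1 - \<theta>) + 2 * C = K"
    proof -
      have "1 - 2 powr (1 - \<theta>) \<noteq> 0" using sew_const_pos[OF \<theta>] by (auto simp: sew_const_def)
      then show ?thesis unfolding K_def sew_const_def by (simp add: divide_simps) (simp add: algebra_simps)
    qed
    finally show ?thesis by (simp add: K_def L_def)
  qed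
qed

lemma sum_lessThan_double:
  fixes f :: "nat \<Rightarrow> 'a::ab_group_add"
  shows "(\<Sum>i<2 * m. f i) = (\<Sum>i<m. f (2 * i) + f (Suc (2 * i)))"
  by (induction m) (auto simp: add.assoc)

text \<open>One dyadic grid of [a, b] is clipped to each [s, t], in place of a separate dyadic
  partition for each interval. The sums over [s, u], [u, t] and [s, t] then share all cells except
  the one that contains u, so additivity of the limit costs a single defect per level.\<close>

lemma sewing:
  fixes \<Xi> :: "real \<Rightarrow> real \<Rightarrow> 'w::banach"
  assumes \<theta>: "1 < \<theta>" and C: "0 \<le> C" and ab: "a \<le> b"
    and \<delta>: "\<And>s u t. a \<le> s \<Longrightarrow> s \<le> u \<Longrightarrow> u \<le> t \<Longrightarrow> t \<le> b \<Longrightarrow>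
          norm (\<Xi> s t - \<Xi> s u - \<Xi> u t) \<le> C * (t - s) powr \<theta>"
  shows "\<exists>I. \<forall>s t. a \<le> s \<and> s \<le> t \<and> t \<le> b \<longrightarrow>
     norm (I t - I s - \<Xi> s t) \<le> 2 * C * sew_const \<theta> * (t - s) powr \<theta>"
proof -
  define g where "g = (\<lambda>n i. a + (b - a) * real i / 2 ^ n)"
  define p where "p = (\<lambda>s t n i. max s (min t (g n i)))"
  define D where "D = (\<lambda>n s t. \<Sum>i<2^n. \<Xi> (p s t n i) (p s t n (Suc i)))"
  \<comment> \<open>The decay rate of mesh^(\<theta>-1) from one dyadic level to the next.\<close>
  define r where "r = (1/2::real) powr (\<theta> - 1)"
  have r: "0 \<le> r" "r < 1" using \<theta> powr_less_mono'[of "1/2::real" 0 "\<theta>-1"] by (auto simp: r_def)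
  have mesh: "((b - a) / 2^n) powr (\<theta> - 1) = (b - a) powr (\<theta> - 1) * r ^ n" for n :: nat
  proof -
    have "((b - a) / 2^n) = (b - a) * (1/2) ^ n" by (simp add: field_simps power_divide)
    moreover have "((1/2) ^ n) powr (\<theta> - 1) = r ^ n"
      unfolding r_def by (induction n) (simp_all only: power_Suc powr_mult power_0 powr_one_eq_one)
    ultimately show ?thesis using ab by (simp add: powr_mult)
  qed
  have gstep: "g n i \<le> g n (Suc i)" "g n (Suc i) - g n i = (b - a) / 2^n" for n i
    using ab by (auto simp: g_def field_simps)
  have pmono: "p s t n i \<le> p s t n (Suc i)" for s t n i
    using gstep(1)[of n i] by (auto simp: p_def)
  have pmesh: "p s t n (Suc i) - p s t n i \<le> (b - a) / 2^n" for s t n i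
    using gstep[of n i] by (auto simp: p_def)
  have p0: "p s t n 0 = s" if "a \<le> s" "s \<le> t" for s t n using that by (auto simp: p_def g_def)
  have pn: "p s t n (2^n) = t" if "s \<le> t" "t \<le> b" for s t n using that by (auto simp: p_def g_def)
  have pin: "s \<le> p s t n i" "p s t n i \<le> t" if "s \<le> t" for s t n i using that by (auto simp: p_def)
  have pdouble: "p s t (Suc n) (2 * i) = p s t n i" for s t n i
    unfolding p_def g_def by (simp add: mult.assoc)
  have pdouble': "p s t (Suc n) (Suc (Suc (2 * i))) = p s t n (Suc i)" for s t n i
    using pdouble[of s t n "Suc i"] by simp
  have sum_small: "(\<Sum>i<2^n. C * (p s t n (Suc i) - p s t n i) powr \<theta>) \<le> C * (b - a) powr (\<theta> - 1) * (b - a) * r ^ n"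
    if st: "a \<le> s" "s \<le> t" "t \<le> b" for s t and n :: nat
  proof -
    have "(\<Sum>i<2^n. (p s t n (Suc i) - p s t n i) powr \<theta>) \<le> ((b - a) / 2^n) powr (\<theta> - 1) * (p s t n (2^n) - p s t n 0)"
      using pmono pmesh \<theta> by (intro sum_powr_mesh_le) auto
    also have "\<dots> \<le> (b - a) powr (\<theta> - 1) * r ^ n * (b - a)"
      unfolding mesh using st r by (intro mult_left_mono) (auto simp: p0 pn)
    finally show ?thesis using C by (simp flip: sum_distrib_left add: mult_left_mono ac_simps)
  qed
  have \<Xi>0: "\<Xi> s s = 0" if "a \<le> s" "s \<le> b" for s using \<delta>[of s s s] that by simp
  have flip: "x + y - z = - (z - x - y)" for x y z :: 'w by simp
  have refine: "norm (D (Suc n) s t - D n s t) \<le> C * (b - a) powr (\<theta> - 1) * (b - a) * r ^ n"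
    if st: "a \<le> s" "s \<le> t" "t \<le> b" for s t n
  proof -
    have eq: "D (Suc n) s t - D n s t = (\<Sum>i<2^n. \<Xi> (p s t n i) (p s t (Suc n) (Suc (2*i))) +
            \<Xi> (p s t (Suc n) (Suc (2*i))) (p s t n (Suc i)) - \<Xi> (p s t n i) (p s t n (Suc i)))"
      unfolding D_def power_Suc sum_lessThan_double sum_subtractf[symmetric]
      by (simp add: pdouble pdouble')
    have "norm (D (Suc n) s t - D n s t) \<le> (\<Sum>i<2^n. C * (p s t n (Suc i) - p s t n i) powr \<theta>)"
      unfolding eq
    proof (rule sum_norm_le)
      fix i
      have "p s t n i \<le> p s t (Suc n) (Suc (2*i))" "p s t (Suc n) (Suc (2*i)) \<le> p s t n (Suc i)"
        using pmono[of s t "Suc n" "2*i"] pmono[of s t "Suc n" "Suc (2*i)"] pdouble[of s t n i] pdouble'[of s t n i]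
        by auto
      then show "norm (\<Xi> (p s t n i) (p s t (Suc n) (Suc (2*i))) +
            \<Xi> (p s t (Suc n) (Suc (2*i))) (p s t n (Suc i)) - \<Xi> (p s t n i) (p s t n (Suc i)))
          \<le> C * (p s t n (Suc i) - p s t n i) powr \<theta>"
        unfolding flip
        by (subst norm_minus_cancel, intro \<delta>)
          (use pin(1)[of s t n i] pin(2)[of s t n "Suc i"] st in linarith)+
    qed
    also have "\<dots> \<le> C * (b - a) powr (\<theta> - 1) * (b - a) * r ^ n" using sum_small[OF st] .
    finally show ?thesis .
  qed
  define I2 where "I2 = (\<lambda>s t. lim (\<lambda>n. D n s t))"
  have lim: "(\<lambda>n. D n s t) \<longlonglongrightarrow> I2 s t" if st: "a \<le> s" "s \<le> t" "t \<le> b" for s t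
    unfolding I2_def using convergent_if_geometric_increments[OF refine[OF st] r] by (simp add: convergent_LIMSEQ_iff)
  have add: "I2 s t = I2 s u + I2 u t" if st: "a \<le> s" "s \<le> u" "u \<le> t" "t \<le> b" for s u t
  proof -
    have bound: "norm (D n s t - D n s u - D n u t) \<le> C * (b - a) powr (\<theta> - 1) * (b - a) * r ^ n" for n
    proof -
      have "norm (D n s t - D n s u - D n u t) \<le> (\<Sum>i<2^n. C * (p s t n (Suc i) - p s t n i) powr \<theta>)"
        unfolding D_def sum_subtractf[symmetric]
      proof (rule sum_norm_le)
        fix i
        define v v' where "v = p s t n i" and "v' = p s t n (Suc i)"
        have v: "s \<le> v" "v \<le> v'" "v' \<le> t"
          using pmono[of s t n i] pin[of s t] st by (auto simp: v_def v'_def)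
        have eq: "p s u n j = min u (p s t n j)" "p u t n j = max u (p s t n j)" for j
          using st by (auto simp: p_def)
        \<comment> \<open>A cell to one side of u occurs unchanged in one of the two clipped sums
          and collapses to \<open>\<Xi> u u = 0\<close> in the other. Only the cell around u leaves
          a defect.\<close>
        consider "v' \<le> u" | "u \<le> v" | "v \<le> u" "u \<le> v'" by linarith
        then show "norm (\<Xi> (p s t n i) (p s t n (Suc i)) - \<Xi> (p s u n i) (p s u n (Suc i))
           - \<Xi> (p u t n i) (p u t n (Suc i))) \<le> C * (p s t n (Suc i) - p s t n i) powr \<theta>"
          unfolding eq v_def[symmetric] v'_def[symmetric]
        proof cases
          case 1
          then show "norm (\<Xi> v v' - \<Xi> (min u v) (min u v') - \<Xi> (max u v) (max u v')) \<le> C * (v' - v) powr \<theta>"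
            using v C \<Xi>0[of u] st by (simp add: min_absorb2 max_absorb1)
        next
          case 2
          then show "norm (\<Xi> v v' - \<Xi> (min u v) (min u v') - \<Xi> (max u v) (max u v')) \<le> C * (v' - v) powr \<theta>"
            using v C \<Xi>0[of u] st by (simp add: min_absorb1 max_absorb2)
        next
          case 3
          then show "norm (\<Xi> v v' - \<Xi> (min u v) (min u v') - \<Xi> (max u v) (max u v')) \<le> C * (v' - v) powr \<theta>"
            using v \<delta>[of v u v'] st by (simp add: min_absorb1 max_absorb2 min_absorb2 max_absorb1)
        qed
      qed
      also have "\<dots> \<le> C * (b - a) powr (\<theta> - 1) * (b - a) * r ^ n" using sum_small st by auto
      finally show ?thesis .
    qed
    have "(\<lambda>n. C * (b - a) powr (\<theta> - 1) * (b - a) * r ^ n) \<longlonglongrightarrow> 0"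
      by (rule tendsto_mult_right_zero, rule LIMSEQ_power_zero) (use r in simp)
    then have "(\<lambda>n. D n s t - D n s u - D n u t) \<longlonglongrightarrow> 0"
      by (rule Lim_null_comparison[rotated]) (use bound in simp)
    moreover have "(\<lambda>n. D n s t - D n s u - D n u t) \<longlonglongrightarrow> I2 s t - I2 s u - I2 u t"
      using st by (intro tendsto_diff lim) auto
    ultimately show ?thesis using LIMSEQ_unique by (fastforce simp: algebra_simps)
  qed
  have "norm (I2 a t - I2 a s - \<Xi> s t) \<le> 2 * C * sew_const \<theta> * (t - s) powr \<theta>"
    if st: "a \<le> s" "s \<le> t" "t \<le> b" for s t
  proof -
    have "norm (I2 s t - \<Xi> s t) \<le> 2 * C * sew_const \<theta> * (t - s) powr \<theta>"
    proof (rule LIMSEQ_le_const2)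
      show "(\<lambda>n. norm (D n s t - \<Xi> s t)) \<longlonglongrightarrow> norm (I2 s t - \<Xi> s t)"
        using lim[OF st] by (intro tendsto_intros)
      show "\<exists>N. \<forall>n\<ge>N. norm (D n s t - \<Xi> s t) \<le> 2 * C * sew_const \<theta> * (t - s) powr \<theta>"
        using partition_sum_bound[OF \<theta> C \<delta>, where p = "p s t n" and n = "2^n" for n] st pmono p0 pn
        by (auto simp: D_def)
    qed
    then show ?thesis using add[of a s t] st by simp
  qed
  then show ?thesis by (intro exI[of _ "I2 a"]) auto
qed

section \<open>A Gronwall lemma for Young germs\<close>

text \<open>\<open>\<epsilon>\<close> is the inhomogeneity of the equation. The germ
  \<open>\<Xi>\<close> is tied to \<open>w\<close> only through inequalities and need not be a
  function of it, so one lemma covers solutions, their differences, linear combinations and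
  operator-valued paths. The constant \<open>M\<close> expresses finiteness only.\<close>

definition young_germ :: "real \<Rightarrow> real \<Rightarrow> real \<Rightarrow> real \<Rightarrow> real \<Rightarrow> (real \<Rightarrow> 'w::real_normed_vector)
    \<Rightarrow> (real \<Rightarrow> real \<Rightarrow> 'w) \<Rightarrow> real \<Rightarrow> bool" where
  "young_germ \<alpha> \<theta> C a b w \<Xi> \<epsilon> \<longleftrightarrow>
     (\<exists>M. \<forall>s t. a \<le> s \<and> s \<le> t \<and> t \<le> b \<longrightarrow> norm (w t - w s - \<Xi> s t) \<le> M * (t - s) powr \<theta>) \<and>
     (\<forall>s t. a \<le> s \<and> s \<le> t \<and> t \<le> b \<longrightarrow> norm (\<Xi> s t) \<le> C * (t - s) powr \<alpha> * (norm (w s) + \<epsilon>)) \<and>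
     (\<forall>s u t. a \<le> s \<and> s \<le> u \<and> u \<le> t \<and> t \<le> b \<longrightarrow> norm (\<Xi> s t - \<Xi> s u - \<Xi> u t)
        \<le> C * (t - s) powr \<alpha> * norm (w u - w s) + C * (t - s) powr \<theta> * (norm (w s) + \<epsilon>))"

lemma young_germ_subinterval:
  assumes "young_germ \<alpha> \<theta> C a b w \<Xi> \<epsilon>" "a \<le> a'" "b' \<le> b"
  shows "young_germ \<alpha> \<theta> C a' b' w \<Xi> \<epsilon>"
proof -
  have I: "a \<le> s \<and> s \<le> t \<and> t \<le> b" if "a' \<le> s \<and> s \<le> t \<and> t \<le> b'" for s t using that assms by auto
  have J: "a \<le> s \<and> s \<le> u \<and> u \<le> t \<and> t \<le> b" if "a' \<le> s \<and> s \<le> u \<and> u \<le> t \<and> t \<le> b'" for s u t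
    using that assms by auto
  show ?thesis using assms(1) I J unfolding young_germ_def by meson
qed

text \<open>Two successive absorptions. In the defect, \<open>w u - w s\<close> is the germ plus the
  remainder, and the remainder returns with the small factor h^\<alpha>; afterwards the supremum of
  \<open>w\<close> is absorbed in the same way. The condition \<theta> \<le> 2\<alpha> makes the
  product of two increments of order \<alpha> an admissible defect. Both \<open>h\<close> and
  \<open>D\<close> are chosen before the germ.\<close>

lemma young_gronwall_short:
  fixes C \<alpha> \<theta> :: real
  assumes \<alpha>: "0 < \<alpha>" and \<theta>: "1 < \<theta>" "\<theta> \<le> 2 * \<alpha>" "\<alpha> \<le> \<theta>" and C: "0 \<le> C"
  shows "\<exists>h D. 0 < h \<and> h \<le> 1 \<and> 0 \<le> D \<and> (\<forall>a b (w :: real \<Rightarrow> 'w::real_normed_vector) \<Xi> \<epsilon>.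
     0 \<le> \<epsilon> \<and> a \<le> b \<and> b - a \<le> h \<and> young_germ \<alpha> \<theta> C a b w \<Xi> \<epsilon> \<longrightarrow>
     norm (w b) + \<epsilon> \<le> 2 * (norm (w a) + \<epsilon>) \<and>
     (\<forall>N\<ge>0. (\<forall>t\<in>{a..b}. norm (w t) \<le> N) \<longrightarrow> norm (w b - w a - \<Xi> a b) \<le> D * (N + \<epsilon>) * (b - a) powr \<theta>))"
proof -
  define \<sigma> where "\<sigma> = sew_const \<theta>"
  have \<sigma>: "0 < \<sigma>" using sew_const_pos[OF \<theta>(1)] by (simp add: \<sigma>_def)
  \<comment> \<open>\<open>\<sigma>\<close> comes from sewing, 2 = 1 / (1 - 1/2) from the
    absorption, and C (C + 1) from the two terms of the defect bound, the first with its increment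
    estimated by the germ.\<close>
  define D where "D = 2 * \<sigma> * C * (C + 1)"
  have D: "0 \<le> D" using \<sigma> C by (simp add: D_def)
  \<comment> \<open>One smallness condition for both absorptions: \<open>C * \<sigma>\<close>
    belongs to the remainder, \<open>C + D\<close> to the supremum of \<open>w\<close>.\<close>
  obtain h where h: "0 < h" "h \<le> 1" and hE: "(C * \<sigma> + C + D) * h powr \<alpha> \<le> 1/2"
    using ex_small_powr[OF \<alpha>, of "C * \<sigma> + C + D"] C \<sigma> D by auto
  have h1: "C * \<sigma> * h powr \<alpha> \<le> 1/2" and h2: "(C + D) * h powr \<alpha> \<le> 1/2"
  proof -
    have "0 \<le> (C + D) * h powr \<alpha>" "0 \<le> C * \<sigma> * h powr \<alpha>" using C D \<sigma> by auto
    with hE show "C * \<sigma> * h powr \<alpha> \<le> 1/2" "(C + D) * h powr \<alpha> \<le> 1/2" by (auto simp: distrib_right)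
  qed
  have *: "norm (w b) + \<epsilon> \<le> 2 * (norm (w a) + \<epsilon>) \<and>
     (\<forall>N\<ge>0. (\<forall>t\<in>{a..b}. norm (w t) \<le> N) \<longrightarrow> norm (w b - w a - \<Xi> a b) \<le> D * (N + \<epsilon>) * (b - a) powr \<theta>)"
    if \<epsilon>: "0 \<le> \<epsilon>" and ab: "a \<le> b" "b - a \<le> h" and germ: "young_germ \<alpha> \<theta> C a b w \<Xi> \<epsilon>"
    for a b \<epsilon> and w :: "real \<Rightarrow> 'w" and \<Xi>
  proof -
    define R where "R = (\<lambda>s t. w t - w s - \<Xi> s t)"
    obtain M where M: "\<And>s t. a \<le> s \<Longrightarrow> s \<le> t \<Longrightarrow> t \<le> b \<Longrightarrow> norm (R s t) \<le> M * (t - s) powr \<theta>"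
      using germ unfolding young_germ_def R_def by auto
    have \<Xi>: "norm (\<Xi> s t) \<le> C * (t - s) powr \<alpha> * (norm (w s) + \<epsilon>)" if "a \<le> s" "s \<le> t" "t \<le> b" for s t
      using germ that unfolding young_germ_def by auto
    have \<delta>: "norm (\<Xi> s t - \<Xi> s u - \<Xi> u t)
        \<le> C * (t - s) powr \<alpha> * norm (w u - w s) + C * (t - s) powr \<theta> * (norm (w s) + \<epsilon>)"
      if "a \<le> s" "s \<le> u" "u \<le> t" "t \<le> b" for s u t
      using germ that unfolding young_germ_def by auto
    have R: "norm (R s t) \<le> D * (N + \<epsilon>) * (t - s) powr \<theta>"
      if N: "0 \<le> N" "\<And>t. a \<le> t \<Longrightarrow> t \<le> b \<Longrightarrow> norm (w t) \<le> N" and st: "a \<le> s" "s \<le> t" "t \<le> b" for N s t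
    proof (cases "s = t")
      case True
      then show ?thesis using M[of s t] st by simp
    next
      case False
      define S where "S = {(s, t). a \<le> s \<and> s < t \<and> t \<le> b}"
      define f where "f = (\<lambda>(s, t). norm (R s t) / (t - s) powr \<theta>)"
      have "f (s, t) \<le> (D / 2 * (N + \<epsilon>)) / (1 - 1/2)"
      proof (rule sup_absorb[where S = S and B = M])
        fix x assume "x \<in> S"
        then show "f x \<le> M" using M by (auto simp: S_def f_def field_simps)
      next
        fix K x assume K: "0 \<le> K" "\<And>y. y \<in> S \<Longrightarrow> f y \<le> K" and "x \<in> S"
        have KK: "norm (R s' t') \<le> K * (t' - s') powr \<theta>" if "a \<le> s'" "s' \<le> t'" "t' \<le> b" for s' t'
          using K(2)[of "(s', t')"] that M[of s' t'] by (cases "s' = t'") (auto simp: S_def f_def field_simps)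
        \<comment> \<open>The first summand is the forcing by the germ; the second feeds the current
          bound \<open>K\<close> of the remainder back with a small factor.\<close>
        define E where "E = C * (C + 1) * (N + \<epsilon>) + C * h powr \<alpha> * K"
        have \<delta>R: "norm (R s t - R s u - R u t) \<le> E * (t - s) powr \<theta>"
          if o: "a \<le> s" "s \<le> u" "u \<le> t" "t \<le> b" for s u t
        proof -
          define L where "L = t - s"
          have L: "0 \<le> L" "L \<le> h" "L \<le> 1" using o ab h by (auto simp: L_def)
          have La: "L powr \<alpha> \<le> h powr \<alpha>" using L \<alpha> by (intro powr_mono2) auto
          have L2: "L powr \<alpha> * L powr \<alpha> \<le> L powr \<theta>"
            unfolding powr_add[symmetric] using L \<theta> by (intro powr_le_powr_exp_le_1) auto
          have Ns: "norm (w s) + \<epsilon> \<le> N + \<epsilon>" "0 \<le> N + \<epsilon>" using N o \<epsilon> by auto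
          have "norm (w u - w s) \<le> norm (\<Xi> s u) + norm (R s u)"
            using norm_triangle_ineq[of "\<Xi> s u" "R s u"] by (simp add: R_def)
          also have "\<dots> \<le> C * (u - s) powr \<alpha> * (norm (w s) + \<epsilon>) + K * (u - s) powr \<theta>"
            using \<Xi>[of s u] KK[of s u] o by auto
          also have "\<dots> \<le> C * L powr \<alpha> * (N + \<epsilon>) + K * L powr \<theta>"
            using o \<alpha> \<theta> C K Ns \<epsilon> unfolding L_def
            by (intro add_mono mult_mono powr_mono2) auto
          finally have w: "norm (w u - w s) \<le> C * L powr \<alpha> * (N + \<epsilon>) + K * L powr \<theta>" .
          have "norm (R s t - R s u - R u t) = norm (\<Xi> s t - \<Xi> s u - \<Xi> u t)"
            by (subst norm_minus_cancel[symmetric]) (simp add: R_def algebra_simps)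
          also have "\<dots> \<le> C * L powr \<alpha> * (C * L powr \<alpha> * (N + \<epsilon>) + K * L powr \<theta>) + C * L powr \<theta> * (N + \<epsilon>)"
            unfolding L_def using C Ns w[unfolded L_def]
            by (intro order_trans[OF \<delta>[OF o]] add_mono mult_left_mono) auto
          also have "\<dots> = C * C * (N + \<epsilon>) * (L powr \<alpha> * L powr \<alpha>) + C * (N + \<epsilon>) * L powr \<theta> + C * K * L powr \<theta> * L powr \<alpha>"
            by (simp add: algebra_simps)
          also have "\<dots> \<le> C * C * (N + \<epsilon>) * L powr \<theta> + C * (N + \<epsilon>) * L powr \<theta> + C * K * L powr \<theta> * h powr \<alpha>"
            using L2 La C K(1) Ns by (intro add_mono mult_left_mono) auto
          also have "\<dots> = E * L powr \<theta>" by (simp add: E_def algebra_simps)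
          finally show ?thesis by (simp add: L_def)
        qed
        obtain s t where x: "x = (s, t)" by (cases x)
        with \<open>x \<in> S\<close> have st: "a \<le> s" "s < t" "t \<le> b" by (auto simp: S_def)
        have "0 \<le> E" using C N \<epsilon> K by (simp add: E_def)
        then have "norm (R s t) \<le> \<sigma> * E * (t - s) powr \<theta>"
          unfolding \<sigma>_def using sewing_bound[OF \<theta>(1) _ KK \<delta>R] st by simp
        then have "f x \<le> \<sigma> * E" using st by (simp add: x f_def field_simps)
        also have "\<dots> = C * \<sigma> * h powr \<alpha> * K + D / 2 * (N + \<epsilon>)"
          by (simp add: E_def D_def algebra_simps)
        also have "\<dots> \<le> 1/2 * K + D / 2 * (N + \<epsilon>)"
          using h1 K(1) by (intro add_right_mono mult_right_mono) auto
        finally show "f x \<le> 1/2 * K + D / 2 * (N + \<epsilon>)" .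
      qed (use D N \<epsilon> st False in \<open>auto simp: S_def\<close>)
      then show ?thesis using st False by (simp add: f_def field_simps)
    qed
    \<comment> \<open>The right-hand side is 2 |w a| + \<epsilon>, so adding \<epsilon> gives
      exactly the doubling that iterates well. The crude bound \<open>B\<close> uses the qualitative
      constant \<open>M\<close>.\<close>
    have "norm (w b) \<le> (norm (w a) + \<epsilon> / 2) / (1 - 1/2)"
    proof (rule sup_absorb[where S = "{a..b}" and f = "\<lambda>t. norm (w t)"
          and B = "norm (w a) + C * 1 * (norm (w a) + \<epsilon>) + \<bar>M\<bar> * 1"])
      fix t assume "t \<in> {a..b}"
      then have t: "a \<le> t" "t \<le> b" by auto
      have L: "0 \<le> t - a" "t - a \<le> 1" using t ab h by auto
      have "norm (w t) \<le> norm (w a) + norm (\<Xi> a t) + norm (R a t)"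
        using norm_triangle_ineq[of "w a + \<Xi> a t" "R a t"] norm_triangle_ineq[of "w a" "\<Xi> a t"]
        by (simp add: R_def)
      also have "\<dots> \<le> norm (w a) + C * (t - a) powr \<alpha> * (norm (w a) + \<epsilon>) + \<bar>M\<bar> * (t - a) powr \<theta>"
        using \<Xi>[of a t] M[of a t] t mult_right_mono[OF abs_ge_self[of M], of "(t-a) powr \<theta>"] by auto
      also have "\<dots> \<le> norm (w a) + C * 1 * (norm (w a) + \<epsilon>) + \<bar>M\<bar> * 1"
        using L C \<epsilon> \<alpha> \<theta> by (intro add_mono mult_left_mono mult_right_mono powr_le1) auto
      finally show "norm (w t) \<le> norm (w a) + C * 1 * (norm (w a) + \<epsilon>) + \<bar>M\<bar> * 1" .
    next
      fix N t assume N: "0 \<le> N" "\<And>y. y \<in> {a..b} \<Longrightarrow> norm (w y) \<le> N" and "t \<in> {a..b}"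
      then have t: "a \<le> t" "t \<le> b" by auto
      have L: "0 \<le> t - a" "t - a \<le> h" "t - a \<le> 1" using t ab h by auto
      have La: "(t - a) powr \<alpha> \<le> h powr \<alpha>" using L \<alpha> by (intro powr_mono2) auto
      have Lt: "(t - a) powr \<theta> \<le> h powr \<alpha>"
        using powr_le_powr_exp_le_1[of "t-a" \<alpha> \<theta>] L \<theta> La by auto
      have "norm (w t) \<le> norm (w a) + norm (\<Xi> a t) + norm (R a t)"
        using norm_triangle_ineq[of "w a + \<Xi> a t" "R a t"] norm_triangle_ineq[of "w a" "\<Xi> a t"]
        by (simp add: R_def)
      also have "\<dots> \<le> norm (w a) + C * (t - a) powr \<alpha> * (norm (w a) + \<epsilon>) + D * (N + \<epsilon>) * (t - a) powr \<theta>"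
        using \<Xi>[of a t] R[of N a t] N t by auto
      also have "\<dots> \<le> norm (w a) + C * h powr \<alpha> * (N + \<epsilon>) + D * (N + \<epsilon>) * h powr \<alpha>"
        using La Lt C D N(1) N(2)[of a] \<epsilon> ab by (intro add_mono mult_mono) auto
      also have "\<dots> = norm (w a) + (C + D) * h powr \<alpha> * (N + \<epsilon>)" by (simp add: algebra_simps)
      also have "\<dots> \<le> norm (w a) + 1/2 * (N + \<epsilon>)"
        using h2 N(1) \<epsilon> by (intro add_left_mono mult_right_mono) auto
      finally show "norm (w t) \<le> 1/2 * N + (norm (w a) + \<epsilon> / 2)" by (simp add: field_simps)
    qed (use \<epsilon> ab in auto)
    then show ?thesis using R[of _ a b] ab by (auto simp: R_def field_simps)
  qed
  show ?thesis
    by (rule exI[of _ h], rule exI[of _ D]) (use h D * in blast)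
qed

text \<open>The doubling estimate is chained over at most n steps of length h. A remainder over an
  interval longer than h needs no cancellation, since (t - s)^\<theta> is then bounded below by
  h^\<theta>. The constant precedes the quantifiers over interval, path and germ, and all later
  uniformity comes from this order.\<close>

lemma young_gronwall:
  fixes C T \<alpha> \<theta> :: real
  assumes \<alpha>: "0 < \<alpha>" and \<theta>: "1 < \<theta>" "\<theta> \<le> 2 * \<alpha>" "\<alpha> \<le> \<theta>" and C: "0 \<le> C" and T: "0 \<le> T"
  shows "\<exists>K\<ge>0. \<forall>a b (w :: real \<Rightarrow> 'w::real_normed_vector) \<Xi> \<epsilon>.
     0 \<le> \<epsilon> \<and> a \<le> b \<and> b - a \<le> T \<and> young_germ \<alpha> \<theta> C a b w \<Xi> \<epsilon> \<longrightarrow>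
     (\<forall>s t. a \<le> s \<and> s \<le> t \<and> t \<le> b \<longrightarrow>
        norm (w t) \<le> K * (norm (w a) + \<epsilon>) \<and>
        norm (w t - w s - \<Xi> s t) \<le> K * (norm (w a) + \<epsilon>) * (t - s) powr \<theta> \<and>
        norm (w t - w s) \<le> K * (norm (w a) + \<epsilon>) * (t - s) powr \<alpha>)"
proof -
  obtain h D where h: "0 < h" "h \<le> 1" and D: "0 \<le> D" and
    loc: "\<And>a b (w :: real \<Rightarrow> 'w) \<Xi> \<epsilon>. 0 \<le> \<epsilon> \<Longrightarrow> a \<le> b \<Longrightarrow> b - a \<le> h \<Longrightarrow> young_germ \<alpha> \<theta> C a b w \<Xi> \<epsilon> \<Longrightarrow>
     norm (w b) + \<epsilon> \<le> 2 * (norm (w a) + \<epsilon>) \<and>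
     (\<forall>N\<ge>0. (\<forall>t\<in>{a..b}. norm (w t) \<le> N) \<longrightarrow> norm (w b - w a - \<Xi> a b) \<le> D * (N + \<epsilon>) * (b - a) powr \<theta>)"
    using young_gronwall_short[OF \<alpha> \<theta> C] by metis
  define n where "n = nat \<lceil>T / h\<rceil>"
  have n: "T \<le> real n * h"
  proof -
    have "T / h \<le> real n" unfolding n_def by linarith
    then show ?thesis using h by (simp add: field_simps)
  qed
  define P :: real where "P = 2 ^ n"
  have P: "1 \<le> P" by (simp add: P_def)
  \<comment> \<open>\<open>D\<close> serves intervals of length at most h; the fraction serves
    longer ones, where the three terms of the remainder are bounded separately.\<close>
  define K1 where "K1 = (D + (2 + C * T powr \<alpha>) / h powr \<theta>) * P"
  define K2 where "K2 = C * P + K1 * T powr (\<theta> - \<alpha>)"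
  have K: "0 \<le> K1" "0 \<le> K2" using C D T P h by (auto simp: K1_def K2_def)
  show ?thesis
  proof (intro exI[of _ "P + K1 + K2"] conjI allI impI; (elim conjE)?)
    show "0 \<le> P + K1 + K2" using K P by simp
    fix a b \<epsilon> and w :: "real \<Rightarrow> 'w" and \<Xi> s t
    assume \<epsilon>: "0 \<le> \<epsilon>" and ab: "a \<le> b" "b - a \<le> T" and germ: "young_germ \<alpha> \<theta> C a b w \<Xi> \<epsilon>"
      and st: "a \<le> s" "s \<le> t" "t \<le> b"
    define B where "B = norm (w a) + \<epsilon>"
    have B: "0 \<le> B" using \<epsilon> by (simp add: B_def)
    have step: "norm (w t) + \<epsilon> \<le> 2 ^ k * B" if "a \<le> t" "t \<le> b" "t - a \<le> real k * h" for t k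
      using that
    proof (induction k arbitrary: t)
      case 0
      then have "t = a" by simp
      then show ?case by (simp add: B_def)
    next
      case (Suc k)
      \<comment> \<open>A step back from the right end, cut off at \<open>a\<close>, so that the
        last piece has length at most h and the induction hypothesis covers the rest.\<close>
      define u where "u = max a (t - h)"
      have u: "a \<le> u" "u \<le> t" "t - u \<le> h" "u - a \<le> real k * h"
        using Suc.prems h by (auto simp: u_def algebra_simps max_def)
      have "norm (w t) + \<epsilon> \<le> 2 * (norm (w u) + \<epsilon>)"
        using loc[OF \<epsilon> u(2,3) young_germ_subinterval[OF germ u(1) Suc.prems(2)]] by blast
      also have "\<dots> \<le> 2 * (2 ^ k * B)" using Suc.IH[of u] u Suc.prems by simp
      finally show ?case by simp
    qed
    have N: "norm (w t) + \<epsilon> \<le> P * B" if "a \<le> t" "t \<le> b" for t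
      unfolding P_def using that ab n by (intro step) auto
    have N': "norm (w t) \<le> P * B - \<epsilon>" if "a \<le> t" "t \<le> b" for t using N[OF that] by simp
    have PB: "0 \<le> P * B - \<epsilon>" using N'[of a] norm_ge_zero[of "w a"] ab by linarith
    have \<Xi>: "norm (\<Xi> s t) \<le> C * (t - s) powr \<alpha> * (P * B)"
    proof -
      have "norm (\<Xi> s t) \<le> C * (t - s) powr \<alpha> * (norm (w s) + \<epsilon>)"
        using germ st unfolding young_germ_def by auto
      also have "\<dots> \<le> C * (t - s) powr \<alpha> * (P * B)"
        using N[of s] st C by (intro mult_left_mono) auto
      finally show ?thesis .
    qed
    have R: "norm (w t - w s - \<Xi> s t) \<le> K1 * B * (t - s) powr \<theta>"
    proof (cases "t - s \<le> h")
      case True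
      have "norm (w t - w s - \<Xi> s t) \<le> D * (P * B - \<epsilon> + \<epsilon>) * (t - s) powr \<theta>"
        using conjunct2[OF loc[OF \<epsilon> st(2) True young_germ_subinterval[OF germ st(1,3)]], rule_format, OF PB] N' st
        by auto
      also have "\<dots> \<le> K1 * B * (t - s) powr \<theta>"
      proof -
        have "D * P \<le> K1" using C T P h unfolding K1_def by (intro mult_right_mono) auto
        then show ?thesis using B by (simp add: mult_right_mono flip: mult.assoc)
      qed
      finally show ?thesis .
    next
      case False
      have "norm (w t - w s - \<Xi> s t) \<le> norm (w t) + norm (w s) + norm (\<Xi> s t)"
        using norm_triangle_ineq4[of "w t - w s" "\<Xi> s t"] norm_triangle_ineq4[of "w t" "w s"] by linarith
      also have "\<dots> \<le> P * B + P * B + C * T powr \<alpha> * (P * B)"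
      proof (intro add_mono)
        have "C * (t - s) powr \<alpha> * (P * B) \<le> C * T powr \<alpha> * (P * B)"
          using st ab C \<alpha> B P by (intro mult_right_mono mult_left_mono powr_mono2) auto
        then show "norm (\<Xi> s t) \<le> C * T powr \<alpha> * (P * B)" using \<Xi> by simp
      qed (use N'[of t] N'[of s] st \<epsilon> in auto)
      also have "\<dots> = (2 + C * T powr \<alpha>) * (P * B) * 1" by (simp add: algebra_simps)
      also have "\<dots> \<le> (2 + C * T powr \<alpha>) * (P * B) * ((t - s) powr \<theta> / h powr \<theta>)"
        using False h \<theta> C T B P by (intro mult_left_mono) (auto simp: field_simps intro!: powr_mono2)
      also have "\<dots> \<le> K1 * B * (t - s) powr \<theta>"
      proof -
        have "(2 + C * T powr \<alpha>) * (P * B) * ((t - s) powr \<theta> / h powr \<theta>)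
          = ((2 + C * T powr \<alpha>) / h powr \<theta>) * P * B * (t - s) powr \<theta>" by simp
        also have "\<dots> \<le> K1 * B * (t - s) powr \<theta>"
          unfolding K1_def using D P B by (intro mult_right_mono) auto
        finally show ?thesis .
      qed
      finally show ?thesis .
    qed
    have H: "norm (w t - w s) \<le> K2 * B * (t - s) powr \<alpha>"
    proof -
      have "norm (w t - w s) \<le> norm (\<Xi> s t) + norm (w t - w s - \<Xi> s t)"
        using norm_triangle_ineq[of "\<Xi> s t" "w t - w s - \<Xi> s t"] by simp
      also have "\<dots> \<le> C * (t - s) powr \<alpha> * (P * B) + K1 * B * (T powr (\<theta> - \<alpha>) * (t - s) powr \<alpha>)"
        using \<Xi> R powr_le_scaled[of "t - s" T \<alpha> \<theta>] st ab \<theta> B K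
        by (intro add_mono order_trans[OF R] mult_left_mono) auto
      also have "\<dots> = K2 * B * (t - s) powr \<alpha>" by (simp add: K2_def algebra_simps)
      finally show ?thesis .
    qed
    have mono: "X * B * x \<le> (P + K1 + K2) * B * x" if "X \<le> P + K1 + K2" "0 \<le> x" for X x
      using that B by (intro mult_right_mono) auto
    show "norm (w t) \<le> (P + K1 + K2) * (norm (w a) + \<epsilon>)"
      using N'[of t] st \<epsilon> mono[of P 1] K unfolding B_def by simp
    show "norm (w t - w s - \<Xi> s t) \<le> (P + K1 + K2) * (norm (w a) + \<epsilon>) * (t - s) powr \<theta>"
      using R mono[of K1 "(t - s) powr \<theta>"] K P unfolding B_def by simp
    show "norm (w t - w s) \<le> (P + K1 + K2) * (norm (w a) + \<epsilon>) * (t - s) powr \<alpha>"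
      using H mono[of K2 "(t - s) powr \<alpha>"] K P unfolding B_def by simp
  qed
qed

section \<open>Differentiability criteria, perturbations of the identity and Riemann limits\<close>

text \<open>The derivative is tested on small multiples of a direction. Only increments from the
  single point \<open>x\<close> are compared, so a bound on differences of two flow lines passes
  directly to the derivative of the flow.\<close>

lemma norm_derivative_le_lipschitz:
  assumes f: "(f has_derivative blinfun_apply D) (at x)" and K: "0 \<le> K"
    and lip: "\<And>y. norm (f y - f x) \<le> K * norm (y - x)"
  shows "norm D \<le> K"
proof (rule norm_blinfun_bound[OF K])
  fix k
  have "norm (D k) \<le> K * norm k + e" if e: "0 < e" for e
  proof -
    define e' where "e' = e / (norm k + 1)"
    have e': "0 < e'" using e by (simp add: e'_def add_nonneg_pos)
    obtain d where d: "0 < d" "\<And>y. norm (y - x) < d \<Longrightarrow> norm (f y - f x - D (y - x)) \<le> e' * norm (y - x)"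
      using f e' unfolding has_derivative_at_alt by blast
    have cancel: "d / (2 * y) * y = d / 2" if "0 < y" for y :: real using that by simp
    define c where "c = d / (2 * (norm k + 1))"
    have c: "0 < c" using d(1) by (simp add: c_def add_nonneg_pos)
    have "c * norm k < d"
    proof -
      have "c * norm k \<le> c * (norm k + 1)" using c by simp
      also have "\<dots> = d / 2"
        unfolding c_def by (rule cancel, rule add_nonneg_pos) auto
      finally show ?thesis using d(1) by simp
    qed
    then have 1: "norm (f (x + c *\<^sub>R k) - f x - D (c *\<^sub>R k)) \<le> e' * (c * norm k)"
      using d(2)[of "x + c *\<^sub>R k"] c by simp
    have "c * norm (D k) = norm (D (c *\<^sub>R k))" using c by (simp add: blinfun.scaleR_right)
    also have "\<dots> \<le> norm (f (x + c *\<^sub>R k) - f x) + norm (f (x + c *\<^sub>R k) - f x - D (c *\<^sub>R k))"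
      by (metis norm_triangle_sub norm_minus_commute)
    also have "\<dots> \<le> K * (c * norm k) + e' * (c * norm k)"
      using 1 lip[of "x + c *\<^sub>R k"] c by auto
    also have "\<dots> = c * (K * norm k + e' * norm k)" by (simp add: algebra_simps)
    finally have "norm (D k) \<le> K * norm k + e' * norm k" using c by simp
    also have "e' * norm k \<le> e"
    proof -
      have "e' * norm k \<le> e' * (norm k + 1)" using e' by simp
      also have "\<dots> = e" using add_nonneg_pos[OF norm_ge_zero[of k] zero_less_one] by (simp add: e'_def)
      finally show ?thesis .
    qed
    finally show ?thesis by simp
  qed
  then show "norm (D k) \<le> K * norm k" by (rule field_le_epsilon)
qed

text \<open>Choosing coefficients that cancel the linear part leaves only the superlinear errors.
  Two terms show that the difference quotients are Cauchy and that the limit is homogeneous, three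
  that it is additive; so three terms suffice. Cauchy sequences replace any candidate for the
  derivative.\<close>

lemma derivative_from_combinations:
  fixes f :: "'v::real_normed_vector \<Rightarrow> 'w::banach"
  assumes K: "0 \<le> K" and \<eta>: "0 < \<eta>"
    and comb: "\<And>c1 c2 c3 k1 k2 k3. norm k1 \<le> 1 \<Longrightarrow> norm k2 \<le> 1 \<Longrightarrow> norm k3 \<le> 1 \<Longrightarrow>
      norm (c1 *\<^sub>R (f (x + k1) - f x) + c2 *\<^sub>R (f (x + k2) - f x) + c3 *\<^sub>R (f (x + k3) - f x))
      \<le> K * (norm (c1 *\<^sub>R k1 + c2 *\<^sub>R k2 + c3 *\<^sub>R k3) +
            (\<bar>c1\<bar> * norm k1 powr (1 + \<eta>) + \<bar>c2\<bar> * norm k2 powr (1 + \<eta>) + \<bar>c3\<bar> * norm k3 powr (1 + \<eta>)))"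
  shows "\<exists>D. \<forall>k. norm k \<le> 1 \<longrightarrow> norm (f (x + k) - f x - blinfun_apply D k) \<le> K * norm k powr (1 + \<eta>)"
proof -
  define S where "S = (\<lambda>n. real (Suc n))"
  have S: "1 \<le> S n" for n by (simp add: S_def)
  have S0: "0 < S n" for n by (simp add: S_def)
  define q where "q = (\<lambda>n k. S n *\<^sub>R (f (x + k /\<^sub>R S n) - f x))"
  \<comment> \<open>After multiplication by \<open>S n\<close> the superlinear error still decays
    like S n^(-\<eta>); this is where \<eta> > 0 enters.\<close>
  have scal: "S n * norm (k /\<^sub>R S n) powr (1 + \<eta>) = norm k powr (1 + \<eta>) * S n powr (-\<eta>)" for n and k :: 'v
  proof -
    have "norm (k /\<^sub>R S n) = norm k / S n" using S0[of n] by (simp add: field_simps)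
    then show ?thesis using S0[of n] by (simp add: powr_divide powr_add powr_minus field_simps)
  qed
  have Slim: "(\<lambda>n. S n powr (-\<eta>)) \<longlonglongrightarrow> 0"
    unfolding S_def using \<eta>
    by (intro tendsto_neg_powr filterlim_compose[OF filterlim_real_sequentially filterlim_Suc]) auto
  have Slim': "(\<lambda>n. c * S n powr (-\<eta>)) \<longlonglongrightarrow> 0" for c using tendsto_mult_right_zero[OF Slim] .
  have small: "\<forall>\<^sub>F n in sequentially. norm (k /\<^sub>R S n) \<le> 1" for k :: 'v
  proof -
    obtain m where m: "norm k \<le> real m" using real_arch_simple by blast
    have "norm (k /\<^sub>R S n) \<le> 1" if "n \<ge> m" for n
      using m that S0[of n] by (simp add: field_simps S_def)
    then show ?thesis by (auto simp: eventually_sequentially)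
  qed
  have S1: "S n powr (-\<eta>) \<le> 1" for n using powr_mono[of "-\<eta>" 0 "S n"] S[of n] \<eta> by simp
  have "Cauchy (\<lambda>n. q n k)" for k
  proof (rule metric_CauchyI)
    fix e :: real assume e: "0 < e"
    define B where "B = K * norm k powr (1 + \<eta>)"
    have "\<forall>\<^sub>F n in sequentially. norm (k /\<^sub>R S n) \<le> 1 \<and> dist (B * S n powr (-\<eta>)) 0 < e / 2"
      using small tendstoD[OF Slim', of "e/2"] e by (intro eventually_conj) auto
    then obtain N where N: "\<And>n. n \<ge> N \<Longrightarrow> norm (k /\<^sub>R S n) \<le> 1 \<and> dist (B * S n powr (-\<eta>)) 0 < e / 2"
      by (auto simp: eventually_sequentially)
    have "dist (q m k) (q n k) < e" if "m \<ge> N" "n \<ge> N" for m n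
    proof -
      have "norm (q m k - q n k) \<le> K * (norm (S m *\<^sub>R (k /\<^sub>R S m) + (- S n) *\<^sub>R (k /\<^sub>R S n)) +
         (S m * norm (k /\<^sub>R S m) powr (1 + \<eta>) + S n * norm (k /\<^sub>R S n) powr (1 + \<eta>)))"
        using comb[of "k /\<^sub>R S m" "k /\<^sub>R S n" 0 "S m" "- S n" 0] N[OF that(1)] N[OF that(2)] S0[of n] S0[of m]
        by (simp add: q_def)
      also have "\<dots> = B * S m powr (-\<eta>) + B * S n powr (-\<eta>)"
        unfolding scal using S0[of n] S0[of m] by (simp add: B_def algebra_simps)
      also have "\<dots> < e / 2 + e / 2"
        using N[OF that(1)] N[OF that(2)] by (intro add_strict_mono) (auto simp: dist_real_def abs_less_iff)
      finally show ?thesis by (simp add: dist_norm)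
    qed
    then show "\<exists>M. \<forall>m\<ge>M. \<forall>n\<ge>M. dist (q m k) (q n k) < e" by blast
  qed
  then have "\<exists>z. (\<lambda>n. q n k) \<longlonglongrightarrow> z" for k
    using Cauchy_convergent_iff convergent_def by blast
  then obtain Z where Z: "\<And>k. (\<lambda>n. q n k) \<longlonglongrightarrow> Z k" by metis
  have lim_le: "norm z \<le> C"
    if "X \<longlonglongrightarrow> z" "\<forall>\<^sub>F n in sequentially. norm (X n) \<le> C + c * S n powr (-\<eta>)" for X :: "nat \<Rightarrow> 'w" and z C c
  proof (rule tendsto_le[OF trivial_limit_sequentially])
    show "(\<lambda>n. C + c * S n powr (-\<eta>)) \<longlonglongrightarrow> C" using tendsto_add[OF tendsto_const Slim'[of c], of C] by simp
    show "(\<lambda>n. norm (X n)) \<longlonglongrightarrow> norm z" using that(1) by (rule tendsto_norm)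
  qed (use that(2) in simp)
  have add: "Z (k + l) = Z k + Z l" for k l
  proof -
    have "norm (Z (k + l) - Z k - Z l) \<le> 0"
    proof (rule lim_le)
      show "(\<lambda>n. q n (k + l) - q n k - q n l) \<longlonglongrightarrow> Z (k + l) - Z k - Z l"
        by (intro tendsto_diff Z)
      show "\<forall>\<^sub>F n in sequentially. norm (q n (k + l) - q n k - q n l) \<le> 0 +
         K * (norm (k + l) powr (1 + \<eta>) + norm k powr (1 + \<eta>) + norm l powr (1 + \<eta>)) * S n powr (-\<eta>)"
        using small[of "k + l"] small[of k] small[of l]
      proof eventually_elim
        case (elim n)
        have "norm (q n (k + l) - q n k - q n l) \<le> K * (norm (S n *\<^sub>R ((k + l) /\<^sub>R S n) + (- S n) *\<^sub>R (k /\<^sub>R S n) + (- S n) *\<^sub>R (l /\<^sub>R S n))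
            + (S n * norm ((k + l) /\<^sub>R S n) powr (1 + \<eta>) + S n * norm (k /\<^sub>R S n) powr (1 + \<eta>) + S n * norm (l /\<^sub>R S n) powr (1 + \<eta>)))"
          using comb[OF elim, of "S n" "- S n" "- S n"] S0[of n] by (simp add: q_def del: scaleR_scaleR)
        then show ?case unfolding scal using S0[of n] by (simp add: algebra_simps)
      qed
    qed
    then show ?thesis by (simp add: algebra_simps)
  qed
  have scale: "Z (r *\<^sub>R k) = r *\<^sub>R Z k" for r k
  proof -
    have "norm (Z (r *\<^sub>R k) - r *\<^sub>R Z k) \<le> 0"
    proof (rule lim_le)
      show "(\<lambda>n. q n (r *\<^sub>R k) - r *\<^sub>R q n k) \<longlonglongrightarrow> Z (r *\<^sub>R k) - r *\<^sub>R Z k"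
        by (intro tendsto_diff tendsto_scaleR tendsto_const Z)
      show "\<forall>\<^sub>F n in sequentially. norm (q n (r *\<^sub>R k) - r *\<^sub>R q n k) \<le> 0 +
         K * (norm (r *\<^sub>R k) powr (1 + \<eta>) + \<bar>r\<bar> * norm k powr (1 + \<eta>)) * S n powr (-\<eta>)"
        using small[of "r *\<^sub>R k"] small[of k]
      proof eventually_elim
        case (elim n)
        have "norm (q n (r *\<^sub>R k) - r *\<^sub>R q n k) \<le> K * (norm (S n *\<^sub>R ((r *\<^sub>R k) /\<^sub>R S n) + (- r * S n) *\<^sub>R (k /\<^sub>R S n))
            + (S n * norm ((r *\<^sub>R k) /\<^sub>R S n) powr (1 + \<eta>) + \<bar>r\<bar> * (S n * norm (k /\<^sub>R S n) powr (1 + \<eta>))))"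
          using comb[OF elim, of 0 "S n" "- r * S n" 0] S0[of n] by (simp add: q_def abs_mult mult.assoc)
        then show ?case unfolding scal using S0[of n] by (simp add: algebra_simps)
      qed
    qed
    then show ?thesis by simp
  qed
  have bound: "norm (Z k) \<le> norm k * K" for k
  proof (rule lim_le[OF Z])
    show "\<forall>\<^sub>F n in sequentially. norm (q n k) \<le> norm k * K + K * norm k powr (1 + \<eta>) * S n powr (-\<eta>)"
      using small[of k]
    proof eventually_elim
      case (elim n)
      have "norm (q n k) \<le> K * (norm (S n *\<^sub>R (k /\<^sub>R S n)) + S n * norm (k /\<^sub>R S n) powr (1 + \<eta>))"
        using comb[OF elim, of 0 0 "S n" 0 0] S0[of n] by (simp add: q_def)
      then show ?case unfolding scal using S0[of n] by (simp add: algebra_simps)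
    qed
  qed
  have lin: "bounded_linear Z" by (rule bounded_linear_intro[OF add scale bound])
  have "norm (f (x + k) - f x - Z k) \<le> K * norm k powr (1 + \<eta>)" if k: "norm k \<le> 1" for k
  proof (rule lim_le)
    show "(\<lambda>n. f (x + k) - f x - q n k) \<longlonglongrightarrow> f (x + k) - f x - Z k"
      by (intro tendsto_diff tendsto_const Z)
    show "\<forall>\<^sub>F n in sequentially. norm (f (x + k) - f x - q n k) \<le> K * norm k powr (1 + \<eta>) + K * norm k powr (1 + \<eta>) * S n powr (-\<eta>)"
      using small[of k]
    proof eventually_elim
      case (elim n)
      \<comment> \<open>Coefficients 1 and \<open>- S n\<close> cancel the linear part, and in the
        limit only the error of the first term survives.\<close>
      have "norm (f (x + k) - f x - q n k) \<le> K * (norm (1 *\<^sub>R k + (- S n) *\<^sub>R (k /\<^sub>R S n)) + (norm k powr (1 + \<eta>) + S n * norm (k /\<^sub>R S n) powr (1 + \<eta>)))"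
        using comb[OF k elim, of 0 1 "- S n" 0] S0[of n] by (simp add: q_def)
      then show ?case unfolding scal using S0[of n] by (simp add: algebra_simps)
    qed
  qed
  then show ?thesis
    by (intro exI[of _ "Blinfun Z"]) (auto simp: bounded_linear_Blinfun_apply[OF lin])
qed

text \<open>A first-order expansion whose remainder is uniform in the base point forces the derivative to be
  Hoelder: expand at \<open>x + k\<close> and twice at \<open>x\<close>.\<close>
lemma C1_from_uniform_taylor:
  fixes f :: "'v::real_normed_vector \<Rightarrow> 'w::real_normed_vector"
  assumes K: "0 \<le> K" and \<eta>: "0 < \<eta>"
    and tay: "\<And>x k. norm k \<le> 1 \<Longrightarrow> norm (f (x + k) - f x - blinfun_apply (D x) k) \<le> K * norm k powr (1 + \<eta>)"
  shows "(f has_derivative blinfun_apply (D x)) (at x)" "continuous_on UNIV D"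
proof -
  have split: "a powr (1 + \<eta>) = a * a powr \<eta>" if "0 \<le> a" for a :: real
    using that by (simp add: powr_add)
  \<comment> \<open>The bound 1/2 on displacements keeps the sum of two of them of equal length in
    the unit ball, where the expansion is assumed.\<close>
  have ex: "\<exists>d>0. d \<le> 1/2 \<and> B * d powr \<eta> \<le> e" if "0 < e" "0 \<le> B" for e B :: real
  proof -
    have "0 \<le> B / e" using that by simp
    from ex_small_powr[OF \<eta> this] obtain h where h: "0 < h" "h \<le> 1" "(B / e) * h powr \<eta> \<le> 1/2"
      by blast
    have "B * (h/2) powr \<eta> \<le> B * h powr \<eta>" using h that \<eta> by (intro mult_left_mono powr_mono2) auto
    also have "\<dots> \<le> e / 2" using h(3) that by (simp add: field_simps)
    finally show ?thesis using h(1,2) that by (intro exI[of _ "h/2"]) auto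
  qed
  show "(f has_derivative blinfun_apply (D x)) (at x)"
    unfolding has_derivative_at_alt
  proof (intro conjI allI impI)
    fix e :: real assume "0 < e"
    from ex[OF this K] obtain d where d: "0 < d" "d \<le> 1/2" "K * d powr \<eta> \<le> e" by blast
    show "\<exists>d>0. \<forall>y. norm (y - x) < d \<longrightarrow> norm (f y - f x - blinfun_apply (D x) (y - x)) \<le> e * norm (y - x)"
    proof (intro exI[of _ d] conjI allI impI d(1))
      fix y assume y: "norm (y - x) < d"
      then have "norm (f y - f x - blinfun_apply (D x) (y - x)) \<le> K * norm (y - x) powr \<eta> * norm (y - x)"
        using tay[of "y - x" x] d by (simp add: split ac_simps)
      also have "K * norm (y - x) powr \<eta> \<le> K * d powr \<eta>"
        using y K \<eta> by (intro mult_left_mono powr_mono2) auto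
      finally show "norm (f y - f x - blinfun_apply (D x) (y - x)) \<le> e * norm (y - x)"
        using d(3) by (smt (verit) mult_right_mono norm_ge_zero)
    qed
  qed (rule blinfun.bounded_linear_right)
  \<comment> \<open>Two remainders at distance |k| and one at distance at most 2 |k|.\<close>
  define K' where "K' = K * (2 + 2 powr (1 + \<eta>))"
  have K': "0 \<le> K'" using K by (simp add: K'_def)
  have hoelder: "norm (D (x + k) - D x) \<le> K' * norm k powr \<eta>" if k: "norm k \<le> 1/2" "k \<noteq> 0" for x k
  proof (rule norm_blinfun_bound)
    fix v :: 'v
    \<comment> \<open>The test vector is rescaled to the length of \<open>k\<close>, which gives all
      three remainders the same order.\<close>
    define c where "c = norm k / norm v"
    show "norm (blinfun_apply (D (x + k) - D x) v) \<le> K' * norm k powr \<eta> * norm v"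
    proof (cases "v = 0")
      case False
      then have c: "0 < c" using k by (simp add: c_def)
      define u where "u = c *\<^sub>R v"
      have u: "norm u = norm k" using False by (simp add: u_def c_def)
      have kp: "norm (k + u) \<le> 2 * norm k" using norm_triangle_ineq[of k u] u by simp
      have 1: "norm (f ((x + k) + u) - f (x + k) - D (x + k) u) \<le> K * norm k powr (1 + \<eta>)"
        using tay[of u "x + k"] u k by simp
      have "norm (f (x + (k + u)) - f x - D x (k + u)) \<le> K * norm (k + u) powr (1 + \<eta>)"
        using tay[of "k + u" x] kp k by simp
      also have "\<dots> \<le> K * (2 * norm k) powr (1 + \<eta>)"
        using kp K \<eta> by (intro mult_left_mono powr_mono2) auto
      finally have 2: "norm (f (x + (k + u)) - f x - D x (k + u)) \<le> K * (2 powr (1 + \<eta>) * norm k powr (1 + \<eta>))"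
        by (simp add: powr_mult)
      have 3: "norm (f (x + k) - f x - D x k) \<le> K * norm k powr (1 + \<eta>)"
        using tay[of k x] k by simp
      have eq: "(D (x + k) - D x) u = (f (x + (k + u)) - f x - D x (k + u)) - (f (x + k) - f x - D x k)
           - (f ((x + k) + u) - f (x + k) - D (x + k) u)"
        by (simp add: blinfun.diff_left blinfun.add_right algebra_simps)
      have "norm ((D (x + k) - D x) u) \<le> K * (2 powr (1 + \<eta>) * norm k powr (1 + \<eta>)) + K * norm k powr (1 + \<eta>) + K * norm k powr (1 + \<eta>)"
        unfolding eq using norm_add_add_diff_diff_le[OF 2 order_refl[of "norm 0"] 3 1] by simp
      also have "\<dots> = K' * norm k powr \<eta> * (c * norm v)"
        using c False by (simp add: K'_def split algebra_simps c_def)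
      also have "norm ((D (x + k) - D x) u) = c * norm ((D (x + k) - D x) v)"
        using c by (simp add: u_def blinfun.scaleR_right)
      finally show ?thesis using c by (simp add: mult.left_commute)
    qed (simp add: blinfun.zero_right)
  qed (use K' in simp)
  show "continuous_on UNIV D"
  proof (rule continuous_onI)
    fix x :: 'v and e :: real assume "0 < e"
    from ex[OF this K'] obtain d where d: "0 < d" "d \<le> 1/2" "K' * d powr \<eta> \<le> e" by blast
    show "\<exists>d>0. \<forall>x'\<in>UNIV. dist x' x < d \<longrightarrow> dist (D x') (D x) \<le> e"
    proof (intro exI[of _ d] conjI ballI impI d(1))
      fix x' assume x': "dist x' x < d"
      show "dist (D x') (D x) \<le> e"
      proof (cases "x' = x")
        case False
        then have "norm (D x' - D x) \<le> K' * norm (x' - x) powr \<eta>"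
          using hoelder[of "x' - x" x] x' d by (simp add: dist_norm)
        also have "\<dots> \<le> K' * d powr \<eta>"
          using x' K' \<eta> by (intro mult_left_mono powr_mono2) (auto simp: dist_norm)
        finally show ?thesis using d(3) by (simp add: dist_norm)
      qed (use \<open>0 < e\<close> in simp)
    qed
  qed
qed

section \<open>Lipschitz perturbations of the identity\<close>

text \<open>Solving f x = y is a fixed point problem for the half-contraction x \<mapsto> y - (f x -
  x). The expansion bound |x - y| \<le> 2 |f x - f y| then gives both injectivity and the Lipschitz
  constant of the inverse.\<close>

lemma near_identity_inverse:
  fixes f :: "'v::banach \<Rightarrow> 'v"
  assumes lip: "\<And>x y. norm ((f x - x) - (f y - y)) \<le> 1/2 * norm (x - y)"
  shows "\<exists>g. (\<forall>x. g (f x) = x) \<and> (\<forall>y. f (g y) = y) \<and> (\<forall>y z. norm (g y - g z) \<le> 2 * norm (y - z))"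
proof -
  have "\<exists>!x. y - (f x - x) = x" for y
  proof (rule banach_fix_type[of "1/2"])
    show "\<forall>x z. dist (y - (f x - x)) (y - (f z - z)) \<le> 1/2 * dist x z"
    proof (intro allI)
      fix x z
      have "dist (y - (f x - x)) (y - (f z - z)) = norm (- ((f x - x) - (f z - z)))"
        unfolding dist_norm by (rule arg_cong[of _ _ norm]) simp
      then show "dist (y - (f x - x)) (y - (f z - z)) \<le> 1/2 * dist x z"
        using lip[of x z] by (simp only: norm_minus_cancel dist_norm)
    qed
  qed auto
  then have "\<exists>x. f x = y" for y
    by (metis add_diff_cancel_left' diff_add_cancel diff_diff_eq2 eq_iff_diff_eq_0 diff_eq_eq)
  then obtain g where g: "\<And>y. f (g y) = y" by metis
  have below: "norm (x - y) \<le> 2 * norm (f x - f y)" for x y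
  proof -
    have "norm (x - y) \<le> norm (f x - f y) + norm ((f x - x) - (f y - y))"
      using norm_triangle_ineq4[of "f x - f y" "(f x - x) - (f y - y)"] by (simp add: algebra_simps)
    then show ?thesis using lip[of x y] by simp
  qed
  then have "g (f x) = x" for x using below[of "g (f x)" x] by (simp add: g)
  then show ?thesis using g below[of "g _" "g _"] by (intro exI[of _ g]) (auto simp: g)
qed

text \<open>The inversion lemma is used twice: for f, and for each derivative \<open>D x\<close>,
  which differs from the identity by at most 1/2 in operator norm. This yields inverse operators
  with norm at most 2, as the derivative of the inverse map requires.\<close>

lemma near_identity_diffeo:
  fixes f :: "'v::banach \<Rightarrow> 'v"
  assumes lip: "\<And>x y. norm ((f x - x) - (f y - y)) \<le> 1/2 * norm (x - y)" and C1: "C1_map f"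
  shows "homeomorphism UNIV UNIV f (inv f)" "C1_map (inv f)"
proof -
  obtain g where g: "\<And>x. g (f x) = x" "\<And>y. f (g y) = y" "\<And>y z. norm (g y - g z) \<le> 2 * norm (y - z)"
    using near_identity_inverse[OF lip] by blast
  have inv: "inv f = g" by (rule inv_equality) (simp_all add: g)
  have cg: "continuous_on UNIV g"
    by (rule lipschitz_on_continuous_on[of 2]) (auto simp: lipschitz_on_def dist_norm g)
  obtain D where D: "\<And>x. (f has_derivative blinfun_apply (D x)) (at x)" and cD: "continuous_on UNIV D"
    using C1 unfolding C1_map_def by blast
  have cf: "continuous_on UNIV f"
    using has_derivative_continuous[OF D] by (simp add: continuous_on_eq_continuous_at)
  show "homeomorphism UNIV UNIV f (inv f)"
    unfolding inv homeomorphism_def using g cf cg by (auto simp: image_iff) metis+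
  have Did: "norm (D x - id_blinfun) \<le> 1/2" for x
  proof (rule norm_derivative_le_lipschitz)
    show "((\<lambda>x. f x - x) has_derivative blinfun_apply (D x - id_blinfun)) (at x)"
      using D[of x] by (auto intro!: derivative_eq_intros simp: blinfun.diff_left)
  qed (use lip in auto)
  have "\<exists>E. E o\<^sub>L D x = id_blinfun \<and> D x o\<^sub>L E = id_blinfun \<and> norm E \<le> 2" for x
  proof -
    have "norm ((D x k - k) - (D x l - l)) \<le> 1/2 * norm (k - l)" for k l
    proof -
      have "(D x k - k) - (D x l - l) = (D x - id_blinfun) (k - l)"
        by (simp add: blinfun.diff_left blinfun.diff_right)
      then show ?thesis using order_trans[OF norm_blinfun mult_right_mono[OF Did norm_ge_zero]] by simp
    qed
    then obtain e where e: "\<And>k. e (D x k) = k" "\<And>k. D x (e k) = k" "\<And>k l. norm (e k - e l) \<le> 2 * norm (k - l)"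
      using near_identity_inverse[of "D x"] by blast
    have e0: "e 0 = 0" using e(1)[of 0] by (simp add: blinfun.zero_right)
    have lin: "bounded_linear e"
    proof (rule bounded_linear_intro[where K = 2])
      show "e (k + l) = e k + e l" for k l using e(1)[of "e k + e l"] by (simp add: blinfun.add_right e(2))
      show "e (r *\<^sub>R k) = r *\<^sub>R e k" for r k using e(1)[of "r *\<^sub>R e k"] by (simp add: blinfun.scaleR_right e(2))
      show "norm (e k) \<le> norm k * 2" for k using e(3)[of k 0] by (simp add: e0)
    qed
    show ?thesis
      using e(3)[of _ 0] by (intro exI[of _ "Blinfun e"] conjI)
       (auto intro!: blinfun_eqI norm_blinfun_bound simp: bounded_linear_Blinfun_apply[OF lin] e e0)
  qed
  then obtain E where E: "\<And>x. E x o\<^sub>L D x = id_blinfun" "\<And>x. D x o\<^sub>L E x = id_blinfun" "\<And>x. norm (E x) \<le> 2" by metis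
  have ED: "E x (D x k) = k" "D x (E x k) = k" for x k
    using E(1)[of x] E(2)[of x] by (metis blinfun_apply_blinfun_compose blinfun_apply_id_blinfun id_apply)+
  have "norm (E x - E y) \<le> 4 * norm (D x - D y)" for x y
  proof (rule norm_blinfun_bound)
    fix k
    \<comment> \<open>The resolvent identity, which turns continuity of \<open>D\<close> into
      continuity of \<open>E\<close>.\<close>
    have "(E x - E y) k = E x ((D y - D x) (E y k))"
      by (simp add: blinfun.diff_left blinfun.diff_right ED)
    then have "norm ((E x - E y) k) \<le> norm (E x) * (norm (D y - D x) * (norm (E y) * norm k))"
      by (auto intro!: order_trans[OF norm_blinfun] mult_left_mono)
    also have "\<dots> \<le> 2 * (norm (D y - D x) * (2 * norm k))"
      using E(3) by (intro mult_mono) auto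
    finally show "norm ((E x - E y) k) \<le> 4 * norm (D x - D y) * norm k" by (simp add: norm_minus_commute)
  qed simp
  then have lipE: "dist (E x) (E y) \<le> 4 * dist (D x) (D y)" for x y by (simp add: dist_norm)
  have cE: "continuous_on UNIV E"
  proof (rule continuous_onI)
    fix x :: 'v and e :: real assume "0 < e"
    then obtain d where d: "0 < d" "\<And>y. dist y x < d \<Longrightarrow> dist (D y) (D x) < e / 4"
      using cD[unfolded continuous_on_iff, rule_format, of x "e/4"] by auto
    have "dist (E y) (E x) \<le> e" if "dist y x < d" for y
      using lipE[of y x] d(2)[OF that] by simp
    with d(1) show "\<exists>d>0. \<forall>y\<in>UNIV. dist y x < d \<longrightarrow> dist (E y) (E x) \<le> e" by blast
  qed
  have "(g has_derivative blinfun_apply (E (g y))) (at y)" for y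
    by (rule has_derivative_inverse_basic[OF D, where T = UNIV])
      (use cg g ED in \<open>auto simp: blinfun.bounded_linear_right continuous_on_eq_continuous_at\<close>)
  moreover have "continuous_on UNIV (\<lambda>y. E (g y))"
    using continuous_on_compose2[OF cE cg] by simp
  ultimately show "C1_map (inv f)" unfolding inv C1_map_def by (intro exI[of _ "\<lambda>y. E (g y)"]) simp
qed

lemma C1_map_compose:
  assumes "C1_map f" "C1_map g"
  shows "C1_map (g \<circ> f)"
proof -
  obtain D E where D: "\<And>x. (f has_derivative blinfun_apply (D x)) (at x)" "continuous_on UNIV D"
    and E: "\<And>x. (g has_derivative blinfun_apply (E x)) (at x)" "continuous_on UNIV E"
    using assms unfolding C1_map_def by blast
  have "continuous_on UNIV f"
    using has_derivative_continuous[OF D(1)] by (simp add: continuous_on_eq_continuous_at)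
  then have "continuous_on UNIV (\<lambda>x. E (f x) o\<^sub>L D x)"
    using continuous_on_compose2[OF E(2)] D(2)
    by (intro bounded_bilinear.continuous_on[OF bounded_bilinear_blinfun_compose]) auto
  moreover have "(g \<circ> f has_derivative blinfun_apply (E (f x) o\<^sub>L D x)) (at x)" for x
    using diff_chain_at[OF D(1) E(1), of x] by (simp add: comp_def o_def blinfun_compose.rep_eq)
  ultimately show ?thesis unfolding C1_map_def by (intro exI[of _ "\<lambda>x. E (f x) o\<^sub>L D x"]) simp
qed

section \<open>Riemann limits\<close>

text \<open>The increments of \<open>g\<close> telescope, so the error of a Riemann sum is the sum
  of the local errors, each of order above 1. This converts a local expansion into the integral
  equation.\<close>

lemma riemann_limI:
  assumes \<theta>: "1 < \<theta>" and st: "s \<le> t"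
    and M: "\<And>u v. s \<le> u \<Longrightarrow> u \<le> v \<Longrightarrow> v \<le> t \<Longrightarrow> norm (g v - g u - \<Xi> u v) \<le> M * (v - u) powr \<theta>"
  shows "riemann_lim \<Xi> s t (g t - g s)"
  unfolding riemann_lim_def
proof (intro allI impI)
  fix \<epsilon> :: real assume \<epsilon>: "0 < \<epsilon>"
  obtain \<delta> where \<delta>: "0 < \<delta>" "(\<bar>M\<bar> * (t - s) / \<epsilon>) * \<delta> powr (\<theta> - 1) \<le> 1/2"
    using ex_small_powr[of "\<theta> - 1" "\<bar>M\<bar> * (t - s) / \<epsilon>"] \<theta> \<epsilon> st by auto
  show "\<exists>\<delta>>0. \<forall>n p. is_partition s t n p \<and> (\<forall>i<n. p (Suc i) - p i < \<delta>) \<longrightarrow>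
    norm ((\<Sum>i<n. \<Xi> (p i) (p (Suc i))) - (g t - g s)) < \<epsilon>"
  proof (intro exI[of _ \<delta>] conjI allI impI \<delta>(1); elim conjE)
    fix n p assume p: "is_partition s t n p" and mesh: "\<forall>i<n. p (Suc i) - p i < \<delta>"
    have p0: "p 0 = s" "p n = t" and inc: "\<And>i. i < n \<Longrightarrow> p i \<le> p (Suc i)"
      using p by (auto simp: is_partition_def less_imp_le)
    have mono: "p i \<le> p j" if "i \<le> j" "j \<le> n" for i j
      using that inc by (induction j rule: dec_induct) (auto intro: order_trans)
    have tele: "g t - g s = (\<Sum>i<n. g (p (Suc i)) - g (p i))"
      using p0 by (simp add: sum_lessThan_telescope[of "\<lambda>i. g (p i)"])
    have "norm ((\<Sum>i<n. \<Xi> (p i) (p (Suc i))) - (g t - g s)) = norm (\<Sum>i<n. g (p (Suc i)) - g (p i) - \<Xi> (p i) (p (Suc i)))"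
      unfolding tele by (subst norm_minus_commute) (simp add: sum_subtractf)
    also have "\<dots> \<le> (\<Sum>i<n. \<bar>M\<bar> * (p (Suc i) - p i) powr \<theta>)"
    proof (rule sum_norm_le)
      fix i assume "i \<in> {..<n}"
      then have "s \<le> p i" "p i \<le> p (Suc i)" "p (Suc i) \<le> t"
        using mono[of 0 i] mono[of "Suc i" n] mono[of i "Suc i"] p0 by auto
      then show "norm (g (p (Suc i)) - g (p i) - \<Xi> (p i) (p (Suc i))) \<le> \<bar>M\<bar> * (p (Suc i) - p i) powr \<theta>"
        using M[of "p i" "p (Suc i)"] mult_right_mono[OF abs_ge_self[of M], of "(p (Suc i) - p i) powr \<theta>"] by auto
    qed
    also have "\<dots> = \<bar>M\<bar> * (\<Sum>i<n. (p (Suc i) - p i) powr \<theta>)" by (simp add: sum_distrib_left)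
    also have "\<dots> \<le> \<bar>M\<bar> * (\<delta> powr (\<theta> - 1) * (p n - p 0))"
      using mesh inc \<theta> by (intro mult_left_mono sum_powr_mesh_le) (auto simp: less_imp_le)
    also have "\<dots> \<le> \<epsilon> / 2" using \<delta>(2) \<epsilon> by (simp add: p0 field_simps)
    finally show "norm ((\<Sum>i<n. \<Xi> (p i) (p (Suc i))) - (g t - g s)) < \<epsilon>" using \<epsilon> by simp
  qed
qed

text \<open>Keeps the definition of \<open>riemann_lim\<close> from being vacuous, which is what its
  uniqueness rests on. Partitions are strictly increasing, so for s = t only the one without cells
  is available.\<close>

lemma ex_fine_partition:
  assumes "s \<le> t" "0 < \<delta>"
  shows "\<exists>n p. is_partition s t n p \<and> (\<forall>i<n. p (Suc i) - p i < \<delta>)"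
proof (cases "s = t")
  case True
  then show ?thesis by (intro exI[of _ 0] exI[of _ "\<lambda>_. s"]) (auto simp: is_partition_def)
next
  case False
  obtain n where n: "(t - s) / \<delta> < real n" using reals_Archimedean2 by blast
  have "0 \<le> (t - s) / \<delta>" using assms by simp
  then have n0: "0 < real n" using n by linarith
  have "(t - s) / n < \<delta>" using n n0 assms by (simp add: field_simps)
  moreover define p where "p = (\<lambda>i. s + real i * ((t - s) / real n))"
  moreover have "p (Suc i) = p i + (t - s) / real n" for i by (simp only: p_def of_nat_Suc distrib_right)
  moreover have "0 < (t - s) / real n" using False assms n0 by simp
  moreover have "p 0 = s" "p n = t" using n0 by (simp_all add: p_def)
  ultimately have "is_partition s t n p \<and> (\<forall>i<n. p (Suc i) - p i < \<delta>)" by (simp add: is_partition_def)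
  then show ?thesis by blast
qed

lemma riemann_lim_unique:
  assumes "riemann_lim \<Xi> s t I" "riemann_lim \<Xi> s t J" "s \<le> t"
  shows "I = J"
proof (rule ccontr)
  assume "I \<noteq> J"
  then have e: "0 < norm (I - J) / 2" by simp
  from assms(1)[unfolded riemann_lim_def, rule_format, OF e]
  obtain d1 where d1: "0 < d1" "\<forall>n p. is_partition s t n p \<and> (\<forall>i<n. p (Suc i) - p i < d1) \<longrightarrow>
        norm ((\<Sum>i<n. \<Xi> (p i) (p (Suc i))) - I) < norm (I - J) / 2"
    by (elim exE conjE)
  from assms(2)[unfolded riemann_lim_def, rule_format, OF e]
  obtain d2 where d2: "0 < d2" "\<forall>n p. is_partition s t n p \<and> (\<forall>i<n. p (Suc i) - p i < d2) \<longrightarrow>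
        norm ((\<Sum>i<n. \<Xi> (p i) (p (Suc i))) - J) < norm (I - J) / 2"
    by (elim exE conjE)
  obtain n p where p: "is_partition s t n p" "\<forall>i<n. p (Suc i) - p i < min d1 d2"
    using ex_fine_partition[OF assms(3), of "min d1 d2"] d1 d2 by auto
  have "norm (I - J) \<le> norm ((\<Sum>i<n. \<Xi> (p i) (p (Suc i))) - J) + norm ((\<Sum>i<n. \<Xi> (p i) (p (Suc i))) - I)"
    using norm_triangle_ineq4[of "(\<Sum>i<n. \<Xi> (p i) (p (Suc i))) - J" "(\<Sum>i<n. \<Xi> (p i) (p (Suc i))) - I"] by simp
  also have "\<dots> < norm (I - J)" 
    using d1(2)[rule_format, of n p] d2(2)[rule_format, of n p] p by simp
  finally show False by simp
qed

section \<open>Davie solutions\<close>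

lemma interpolate_bound:
  fixes x :: real
  assumes "0 \<le> x" "x \<le> G * p" "x \<le> G * q" "0 \<le> p" "0 \<le> q" "0 \<le> G" "0 \<le> \<mu>" "\<mu> \<le> 1"
  shows "x \<le> G * (p powr (1 - \<mu>) * q powr \<mu>)"
proof -
  have "x = x powr (1 - \<mu>) * x powr \<mu>" using assms(1) by (simp flip: powr_add)
  also have "\<dots> \<le> (G * p) powr (1 - \<mu>) * (G * q) powr \<mu>"
    using assms by (intro mult_mono powr_mono2) auto
  also have "\<dots> = (G powr (1 - \<mu>) * G powr \<mu>) * (p powr (1 - \<mu>) * q powr \<mu>)"
    using assms by (simp add: powr_mult)
  also have "G powr (1 - \<mu>) * G powr \<mu> = G" using assms by (simp flip: powr_add)
  finally show ?thesis .
qed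

section \<open>Regularity of the field and of its increments\<close>

locale young_field =
  fixes T \<alpha> \<beta> C :: real
    and A :: "real \<Rightarrow> 'v::banach \<Rightarrow> 'v"
    and DA :: "real \<Rightarrow> 'v \<Rightarrow> ('v \<Rightarrow>\<^sub>L 'v)"
  assumes T: "0 < T" and \<alpha>: "0 < \<alpha>" "\<alpha> < 1" and \<beta>: "0 < \<beta>" "\<beta> < 1" and \<alpha>\<beta>: "1 < \<alpha> * (1 + \<beta>)"
    and C: "0 \<le> C"
    and A_bound: "\<And>s t x. 0 \<le> s \<Longrightarrow> s \<le> t \<Longrightarrow> t \<le> T \<Longrightarrow> norm (incr A s t x) \<le> C * (t - s) powr \<alpha>"
    and A_deriv: "\<And>t x. 0 \<le> t \<Longrightarrow> t \<le> T \<Longrightarrow> (A t has_derivative blinfun_apply (DA t x)) (at x)"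
    and DA_bound: "\<And>s t x. 0 \<le> s \<Longrightarrow> s \<le> t \<Longrightarrow> t \<le> T \<Longrightarrow> norm (incr DA s t x) \<le> C * (t - s) powr \<alpha>"
    and DA_hoelder: "\<And>s t x y. 0 \<le> s \<Longrightarrow> s \<le> t \<Longrightarrow> t \<le> T \<Longrightarrow>
          norm (incr DA s t x - incr DA s t y) \<le> C * (t - s) powr \<alpha> * norm (x - y) powr \<beta>"
begin

definition \<theta> :: real where "\<theta> = \<alpha> * (1 + \<beta>)"

text \<open>\<theta> \<le> 2\<alpha> comes from \<beta> < 1; it lets defects of order 2\<alpha>,
  produced by Lipschitz estimates, count as defects of order \<theta>.\<close>

lemma \<theta>: "1 < \<theta>" "\<theta> \<le> 2 * \<alpha>" "\<alpha> \<le> \<theta>" "\<theta> = \<alpha> + \<alpha> * \<beta>"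
proof -
  have "\<alpha> * \<beta> \<le> \<alpha> * 1" "0 \<le> \<alpha> * \<beta>" using \<alpha> \<beta> by (auto intro: mult_left_mono)
  then show "1 < \<theta>" "\<theta> \<le> 2 * \<alpha>" "\<alpha> \<le> \<theta>" "\<theta> = \<alpha> + \<alpha> * \<beta>"
    using \<alpha>\<beta> by (auto simp: \<theta>_def algebra_simps)
qed

lemma incr_deriv:
  assumes "0 \<le> s" "s \<le> t" "t \<le> T"
  shows "(incr A s t has_derivative blinfun_apply (incr DA s t x)) (at x)"
  unfolding incr_def using assms A_deriv[of t x] A_deriv[of s x]
  by (auto intro!: derivative_eq_intros simp: blinfun.diff_left)

lemma incr_lipschitz:
  assumes "0 \<le> s" "s \<le> t" "t \<le> T"
  shows "norm (incr A s t x - incr A s t y) \<le> C * (t - s) powr \<alpha> * norm (x - y)"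
  by (rule differentiable_bound[of UNIV _ "\<lambda>x. blinfun_apply (incr DA s t x)"])
    (use incr_deriv[OF assms] DA_bound[OF assms] in \<open>auto simp flip: norm_blinfun.rep_eq\<close>)

text \<open>Both segments are traversed with the same parameter and the mean value inequality is
  applied to the difference. The Hoelder continuity of the derivative enters through the distance of
  the two moving points, and the factor |c - d| keeps the estimate linear in the displacement of the
  two paths.\<close>

lemma incr_four_point:
  assumes "0 \<le> s" "s \<le> t" "t \<le> T"
  shows "norm ((incr A s t a - incr A s t b) - (incr A s t c - incr A s t d))
    \<le> C * (t - s) powr \<alpha> * (norm ((a - b) - (c - d)) + (norm (a - c) + norm (b - d)) powr \<beta> * norm (c - d))"
    (is "_ \<le> ?B")
proof -
  let ?f = "incr A s t" and ?D = "incr DA s t"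
  define g where "g = (\<lambda>r::real. ?f (b + r *\<^sub>R (a - b)) - ?f (d + r *\<^sub>R (c - d)))"
  define g' where "g' = (\<lambda>r h::real. ?D (b + r *\<^sub>R (a - b)) (h *\<^sub>R (a - b)) - ?D (d + r *\<^sub>R (c - d)) (h *\<^sub>R (c - d)))"
  have "norm (g 1 - g 0) \<le> ?B * norm (1 - 0 :: real)"
  proof (rule differentiable_bound[of "{0..1}" _ g'])
    fix r :: real assume r: "r \<in> {0..1}"
    show "(g has_derivative g' r) (at r within {0..1})"
      unfolding g_def g'_def
      by (rule has_derivative_at_withinI)
        (auto intro!: derivative_eq_intros has_derivative_compose[of _ _ _ _ ?f, OF _ incr_deriv[OF assms]])
    show "onorm (g' r) \<le> ?B"
    proof (rule onorm_le)
      fix h :: real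
      let ?p = "b + r *\<^sub>R (a - b)" and ?q = "d + r *\<^sub>R (c - d)"
      have "?p - ?q = (1 - r) *\<^sub>R (b - d) + r *\<^sub>R (a - c)" by (simp add: algebra_simps)
      then have "norm (?p - ?q) \<le> (1 - r) * norm (b - d) + r * norm (a - c)"
        using r norm_triangle_ineq[of "(1 - r) *\<^sub>R (b - d)" "r *\<^sub>R (a - c)"] by simp
      also have "\<dots> \<le> 1 * norm (b - d) + 1 * norm (a - c)"
        using r by (intro add_mono mult_right_mono) auto
      finally have pq: "norm (?p - ?q) \<le> norm (a - c) + norm (b - d)" by simp
      \<comment> \<open>The first summand carries the mismatch of the two chords, the second the
        change of the derivative between the two points.\<close>
      have eq: "g' r h = h *\<^sub>R (?D ?p ((a - b) - (c - d)) + (?D ?p - ?D ?q) (c - d))"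
      proof -
        have "P (h *\<^sub>R u) - Q (h *\<^sub>R v) = h *\<^sub>R (P (u - v) + (P - Q) v)" for P Q :: "'v \<Rightarrow>\<^sub>L 'v" and u v
          by (simp add: blinfun.scaleR_right blinfun.diff_left blinfun.diff_right algebra_simps)
        then show ?thesis unfolding g'_def .
      qed
      have "norm (?D ?p ((a - b) - (c - d))) \<le> C * (t - s) powr \<alpha> * norm ((a - b) - (c - d))"
        by (rule order_trans[OF norm_blinfun mult_right_mono[OF DA_bound[OF assms] norm_ge_zero]])
      moreover have "norm ((?D ?p - ?D ?q) (c - d)) \<le> C * (t - s) powr \<alpha> * (norm (a - c) + norm (b - d)) powr \<beta> * norm (c - d)"
        using order_trans[OF DA_hoelder[OF assms] mult_left_mono[OF powr_mono2[OF _ _ pq]]] C \<beta>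
        by (intro order_trans[OF norm_blinfun mult_right_mono]) auto
      ultimately have "norm (?D ?p ((a - b) - (c - d)) + (?D ?p - ?D ?q) (c - d)) \<le> ?B"
        unfolding distrib_left by (intro order_trans[OF norm_triangle_ineq add_mono]) (auto simp: mult.assoc)
      then show "norm (g' r h) \<le> ?B * norm h"
        unfolding eq by (simp add: mult_left_mono mult.commute)
    qed
  qed auto
  then show ?thesis by (simp add: g_def algebra_simps)
qed

lemma incr_taylor:
  assumes "0 \<le> s" "s \<le> t" "t \<le> T"
  shows "norm (incr A s t y - incr A s t x - incr DA s t x (y - x)) \<le> C * (t - s) powr \<alpha> * norm (y - x) powr (1 + \<beta>)"
proof -
  have "norm (incr A s t y - incr A s t x - incr DA s t x (y - x)) \<le> norm (y - x) * (C * (t - s) powr \<alpha> * norm (y - x) powr \<beta>)"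
  proof (rule differentiable_bound_linearization[where S = "cball x (norm (y - x))" and f' = "\<lambda>x. blinfun_apply (incr DA s t x)"])
    show "x + r *\<^sub>R (y - x) \<in> cball x (norm (y - x))" if "r \<in> {0..1}" for r
      using that by (simp add: dist_norm mult_left_le_one_le)
    show "(incr A s t has_derivative blinfun_apply (incr DA s t z)) (at z within cball x (norm (y - x)))" for z
      by (rule has_derivative_at_withinI[OF incr_deriv[OF assms]])
    show "onorm (blinfun_apply (incr DA s t z) - blinfun_apply (incr DA s t x)) \<le> C * (t - s) powr \<alpha> * norm (y - x) powr \<beta>"
      if z: "z \<in> cball x (norm (y - x))" for z
    proof -
      have "onorm (blinfun_apply (incr DA s t z) - blinfun_apply (incr DA s t x)) = norm (incr DA s t z - incr DA s t x)"
        by (simp add: norm_blinfun.rep_eq fun_diff_def minus_blinfun.rep_eq)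
      also have "\<dots> \<le> C * (t - s) powr \<alpha> * norm (z - x) powr \<beta>" by (rule DA_hoelder[OF assms])
      also have "\<dots> \<le> C * (t - s) powr \<alpha> * norm (y - x) powr \<beta>"
        using z C \<beta> by (intro mult_left_mono powr_mono2) (auto simp: dist_norm norm_minus_commute)
      finally show ?thesis .
    qed
  qed auto
  then show ?thesis by (simp add: powr_add ac_simps)
qed

lemma powr_\<theta>: "x powr \<alpha> * (x powr \<alpha>) powr \<beta> = x powr \<theta>"
  by (simp add: \<theta>(4) powr_add powr_powr)

text \<open>The origin of \<theta>: the field contributes \<alpha> in time, and a \<beta>-Hoelder
  dependence on an \<alpha>-Hoelder path contributes \<alpha>\<beta>.\<close>

lemma powr_hoelder_mult_le:
  assumes "s \<le> u" "u \<le> t" "0 \<le> H" "x \<le> H * (u - s) powr \<alpha>" "0 \<le> x"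
  shows "(t - u) powr \<alpha> * x powr \<beta> \<le> H powr \<beta> * (t - s) powr \<theta>"
proof -
  have "(t - u) powr \<alpha> * x powr \<beta> \<le> (t - s) powr \<alpha> * (H * (t - s) powr \<alpha>) powr \<beta>"
    using assms \<alpha> \<beta>
    by (intro mult_mono powr_mono2 order_trans[OF assms(4)] mult_left_mono) auto
  also have "\<dots> = H powr \<beta> * ((t - s) powr \<alpha> * ((t - s) powr \<alpha>) powr \<beta>)"
    using assms by (simp add: powr_mult ac_simps)
  finally show ?thesis by (simp only: powr_\<theta>)
qed

text \<open>This is the three-point defect of the germ attached to a difference of two paths; 2 H
  arises because the increments of both paths are added.\<close>

lemma incr_four_point_path:
  assumes o: "0 \<le> s" "s \<le> u" "u \<le> t" "t \<le> T" and H: "0 \<le> H"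
    and y1: "norm (y1 u - y1 s) \<le> H * (u - s) powr \<alpha>" and y: "norm (y u - y s) \<le> H * (u - s) powr \<alpha>"
  shows "norm ((incr A u t (y1 u) - incr A u t (y u)) - (incr A u t (y1 s) - incr A u t (y s)))
    \<le> C * (t - s) powr \<alpha> * norm ((y1 u - y u) - (y1 s - y s)) + C * (2 * H) powr \<beta> * (t - s) powr \<theta> * norm (y1 s - y s)"
proof -
  let ?z = "norm ((y1 u - y u) - (y1 s - y s))" and ?x = "norm (y1 u - y1 s) + norm (y u - y s)"
  have "norm ((incr A u t (y1 u) - incr A u t (y u)) - (incr A u t (y1 s) - incr A u t (y s)))
    \<le> C * (t - u) powr \<alpha> * (?z + ?x powr \<beta> * norm (y1 s - y s))"
    using incr_four_point[of u t "y1 u" "y u" "y1 s" "y s"] o by simp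
  also have "\<dots> = C * (t - u) powr \<alpha> * ?z + C * ((t - u) powr \<alpha> * ?x powr \<beta>) * norm (y1 s - y s)"
    by (simp add: algebra_simps)
  also have "\<dots> \<le> C * (t - s) powr \<alpha> * ?z + C * ((2 * H) powr \<beta> * (t - s) powr \<theta>) * norm (y1 s - y s)"
    using o H y y1 C \<alpha> powr_hoelder_mult_le[of s u t "2 * H" ?x]
    by (intro add_mono mult_right_mono mult_left_mono powr_mono2) auto
  finally show ?thesis by (simp add: mult.assoc)
qed

lemma DA_path:
  assumes o: "0 \<le> s" "s \<le> u" "u \<le> t" "t \<le> T" and H: "0 \<le> H"
    and y: "norm (y u - y s) \<le> H * (u - s) powr \<alpha>"
  shows "norm (incr DA u t (y u) - incr DA u t (y s)) \<le> C * H powr \<beta> * (t - s) powr \<theta>"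
proof -
  have "norm (incr DA u t (y u) - incr DA u t (y s)) \<le> C * ((t - u) powr \<alpha> * norm (y u - y s) powr \<beta>)"
    using DA_hoelder[of u t "y u" "y s"] o by (simp add: mult.assoc)
  also have "\<dots> \<le> C * (H powr \<beta> * (t - s) powr \<theta>)"
    using o H y C by (intro mult_left_mono powr_hoelder_mult_le) auto
  finally show ?thesis by (simp add: mult.assoc)
qed

section \<open>A priori bounds and stability of Davie solutions\<close>

definition davie :: "real \<Rightarrow> real \<Rightarrow> (real \<Rightarrow> 'v) \<Rightarrow> bool" where
  "davie a b y \<longleftrightarrow> (\<exists>M. \<forall>s t. a \<le> s \<and> s \<le> t \<and> t \<le> b \<longrightarrow>
     norm (y t - y s - incr A s t (y s)) \<le> M * (t - s) powr \<theta>)"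

lemma davie_subinterval: "davie a b y \<Longrightarrow> a \<le> a' \<Longrightarrow> b' \<le> b \<Longrightarrow> davie a' b' y"
  unfolding davie_def by (meson order_trans)

text \<open>The Gronwall lemma is applied to \<open>y t - y a\<close>, which vanishes at
  \<open>a\<close>, with inhomogeneity 1 because the field is bounded but need not vanish. The
  result no longer remembers the constant in \<open>davie\<close> and is the same for all
  solutions.\<close>

lemma davie_bound:
  "\<exists>H\<ge>0. \<forall>a b y s t. 0 \<le> a \<and> a \<le> s \<and> s \<le> t \<and> t \<le> b \<and> b \<le> T \<and> davie a b y \<longrightarrow>
     norm (y t - y s - incr A s t (y s)) \<le> H * (t - s) powr \<theta> \<and> norm (y t - y s) \<le> H * (t - s) powr \<alpha>"
proof -
  obtain K where K: "0 \<le> K" and gron: "\<And>a b (w :: real \<Rightarrow> 'v) \<Xi> \<epsilon> s t. 0 \<le> \<epsilon> \<Longrightarrow> a \<le> b \<Longrightarrow> b - a \<le> T \<Longrightarrow>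
      young_germ \<alpha> \<theta> C a b w \<Xi> \<epsilon> \<Longrightarrow> a \<le> s \<Longrightarrow> s \<le> t \<Longrightarrow> t \<le> b \<Longrightarrow>
        norm (w t - w s - \<Xi> s t) \<le> K * (norm (w a) + \<epsilon>) * (t - s) powr \<theta> \<and>
        norm (w t - w s) \<le> K * (norm (w a) + \<epsilon>) * (t - s) powr \<alpha>"
    using young_gronwall[where 'w = 'v, OF \<alpha>(1) \<theta>(1,2,3) C less_imp_le[OF T]] by metis
  show ?thesis
  proof (intro exI[of _ K] conjI[OF K] allI impI; elim conjE)
    fix a b y s t
    assume o: "0 \<le> a" "a \<le> s" "s \<le> t" "t \<le> b" "b \<le> T" and y: "davie a b y"
    have "young_germ \<alpha> \<theta> C a b (\<lambda>t. y t - y a) (\<lambda>s t. incr A s t (y s)) 1"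
      unfolding young_germ_def
    proof (intro conjI allI impI; (elim conjE)?)
      show "\<exists>M. \<forall>s t. a \<le> s \<and> s \<le> t \<and> t \<le> b \<longrightarrow>
           norm (y t - y a - (y s - y a) - incr A s t (y s)) \<le> M * (t - s) powr \<theta>"
        using y by (simp add: davie_def)
    next
      fix s t assume st: "a \<le> s" "s \<le> t" "t \<le> b"
      have "C * (t - s) powr \<alpha> * 1 \<le> C * (t - s) powr \<alpha> * (norm (y s - y a) + 1)"
        using C by (intro mult_left_mono) auto
      then show "norm (incr A s t (y s)) \<le> C * (t - s) powr \<alpha> * (norm (y s - y a) + 1)"
        using A_bound[of s t "y s"] st o by simp
    next
      fix s u t assume st: "a \<le> s" "s \<le> u" "u \<le> t" "t \<le> b"
      have "norm (incr A s t (y s) - incr A s u (y s) - incr A u t (y u)) = norm (incr A u t (y s) - incr A u t (y u))"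
        by (simp add: incr_def)
      also have "\<dots> \<le> C * (t - u) powr \<alpha> * norm (y s - y u)" using st o by (intro incr_lipschitz) auto
      also have "\<dots> \<le> C * (t - s) powr \<alpha> * norm (y s - y u)"
        using st C \<alpha> by (intro mult_right_mono mult_left_mono powr_mono2) auto
      also have "\<dots> \<le> C * (t - s) powr \<alpha> * norm (y u - y a - (y s - y a)) + C * (t - s) powr \<theta> * (norm (y s - y a) + 1)"
        using C by (simp add: norm_minus_commute)
      finally show "norm (incr A s t (y s) - incr A s u (y s) - incr A u t (y u)) \<le> \<dots>" .
    qed
    from gron[OF _ _ _ this, of s t] o
    show "norm (y t - y s - incr A s t (y s)) \<le> K * (t - s) powr \<theta> \<and> norm (y t - y s) \<le> K * (t - s) powr \<alpha>"
      by auto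
  qed
qed

text \<open>Inhomogeneity 0: the germ of a difference is Lipschitz in the difference. The four-point
  estimate needs the Hoelder constants of both paths, and \<open>davie_bound\<close> makes those
  uniform, so \<open>K\<close> depends on neither path.\<close>

lemma davie_diff:
  "\<exists>K\<ge>0. \<forall>a b y y1 s t. 0 \<le> a \<and> a \<le> s \<and> s \<le> t \<and> t \<le> b \<and> b \<le> T \<and> davie a b y \<and> davie a b y1 \<longrightarrow>
     norm (y1 t - y t) \<le> K * norm (y1 a - y a) \<and>
     norm ((y1 t - y t) - (y1 s - y s) - (incr A s t (y1 s) - incr A s t (y s))) \<le> K * norm (y1 a - y a) * (t - s) powr \<theta> \<and>
     norm ((y1 t - y t) - (y1 s - y s)) \<le> K * norm (y1 a - y a) * (t - s) powr \<alpha>"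
proof -
  obtain H where H: "0 \<le> H" and yH: "\<And>a b y s t. 0 \<le> a \<Longrightarrow> a \<le> s \<Longrightarrow> s \<le> t \<Longrightarrow> t \<le> b \<Longrightarrow> b \<le> T \<Longrightarrow> davie a b y \<Longrightarrow>
     norm (y t - y s - incr A s t (y s)) \<le> H * (t - s) powr \<theta> \<and> norm (y t - y s) \<le> H * (t - s) powr \<alpha>"
    using davie_bound by metis
  define C' where "C' = C + C * (2 * H) powr \<beta>"
  have C': "0 \<le> C'" "C \<le> C'" "C * (2 * H) powr \<beta> \<le> C'" using C by (auto simp: C'_def)
  obtain K where K: "0 \<le> K" and gron: "\<And>a b (w :: real \<Rightarrow> 'v) \<Xi> \<epsilon> s t. 0 \<le> \<epsilon> \<Longrightarrow> a \<le> b \<Longrightarrow> b - a \<le> T \<Longrightarrow>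
      young_germ \<alpha> \<theta> C' a b w \<Xi> \<epsilon> \<Longrightarrow> a \<le> s \<Longrightarrow> s \<le> t \<Longrightarrow> t \<le> b \<Longrightarrow>
        norm (w t) \<le> K * (norm (w a) + \<epsilon>) \<and>
        norm (w t - w s - \<Xi> s t) \<le> K * (norm (w a) + \<epsilon>) * (t - s) powr \<theta> \<and>
        norm (w t - w s) \<le> K * (norm (w a) + \<epsilon>) * (t - s) powr \<alpha>"
    using young_gronwall[where 'w = 'v, OF \<alpha>(1) \<theta>(1,2,3) C'(1) less_imp_le[OF T]] by metis
  show ?thesis
  proof (intro exI[of _ K] conjI[OF K] allI impI; elim conjE)
    fix a b y y1 s t
    assume o: "0 \<le> a" "a \<le> s" "s \<le> t" "t \<le> b" "b \<le> T" and y: "davie a b y" "davie a b y1"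
    have "young_germ \<alpha> \<theta> C' a b (\<lambda>t. y1 t - y t) (\<lambda>s t. incr A s t (y1 s) - incr A s t (y s)) 0"
      unfolding young_germ_def
    proof (intro conjI allI impI; (elim conjE)?)
      have "norm ((y1 t - y t) - (y1 s - y s) - (incr A s t (y1 s) - incr A s t (y s))) \<le> (H + H) * (t - s) powr \<theta>"
        if st: "a \<le> s" "s \<le> t" "t \<le> b" for s t
      proof -
        have "norm ((y1 t - y1 s - incr A s t (y1 s)) - (y t - y s - incr A s t (y s))) \<le> (H + H) * (t - s) powr \<theta>"
          using yH[OF o(1) st o(5) y(1)] yH[OF o(1) st o(5) y(2)]
          by (intro order_trans[OF norm_triangle_ineq4]) (simp add: distrib_right)
        then show ?thesis by (simp add: algebra_simps)
      qed
      then show "\<exists>M. \<forall>s t. a \<le> s \<and> s \<le> t \<and> t \<le> b \<longrightarrow>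
           norm (y1 t - y t - (y1 s - y s) - (incr A s t (y1 s) - incr A s t (y s))) \<le> M * (t - s) powr \<theta>" by blast
    next
      fix s t assume st: "a \<le> s" "s \<le> t" "t \<le> b"
      have "norm (incr A s t (y1 s) - incr A s t (y s)) \<le> C * (t - s) powr \<alpha> * norm (y1 s - y s)"
        using st o by (intro incr_lipschitz) auto
      also have "\<dots> \<le> C' * (t - s) powr \<alpha> * norm (y1 s - y s)" using C' by (intro mult_right_mono) auto
      finally show "norm (incr A s t (y1 s) - incr A s t (y s)) \<le> C' * (t - s) powr \<alpha> * (norm (y1 s - y s) + 0)" by simp
    next
      fix s u t assume st: "a \<le> s" "s \<le> u" "u \<le> t" "t \<le> b"
      have "norm (incr A s t (y1 s) - incr A s t (y s) - (incr A s u (y1 s) - incr A s u (y s)) - (incr A u t (y1 u) - incr A u t (y u)))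
        = norm ((incr A u t (y1 u) - incr A u t (y u)) - (incr A u t (y1 s) - incr A u t (y s)))"
        by (subst norm_minus_commute) (simp add: incr_def algebra_simps)
      also have "\<dots> \<le> C * (t - s) powr \<alpha> * norm ((y1 u - y u) - (y1 s - y s)) + C * (2 * H) powr \<beta> * (t - s) powr \<theta> * norm (y1 s - y s)"
        using st o y yH[of a s u b] by (intro incr_four_point_path) (auto simp: H)
      also have "\<dots> \<le> C' * (t - s) powr \<alpha> * norm ((y1 u - y u) - (y1 s - y s)) + C' * (t - s) powr \<theta> * norm (y1 s - y s)"
        using C' by (intro add_mono mult_right_mono) auto
      finally show "norm (incr A s t (y1 s) - incr A s t (y s) - (incr A s u (y1 s) - incr A s u (y s)) - (incr A u t (y1 u) - incr A u t (y u)))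
         \<le> C' * (t - s) powr \<alpha> * norm (y1 u - y u - (y1 s - y s)) + C' * (t - s) powr \<theta> * (norm (y1 s - y s) + 0)"
        by simp
    qed
    from gron[OF _ _ _ this, of s t] o
    show "norm (y1 t - y t) \<le> K * norm (y1 a - y a) \<and>
     norm ((y1 t - y t) - (y1 s - y s) - (incr A s t (y1 s) - incr A s t (y s))) \<le> K * norm (y1 a - y a) * (t - s) powr \<theta> \<and>
     norm ((y1 t - y t) - (y1 s - y s)) \<le> K * norm (y1 a - y a) * (t - s) powr \<alpha>"
      by auto
  qed
qed

lemma DA_apply_path:
  assumes o: "0 \<le> s" "s \<le> u" "u \<le> t" "t \<le> T" and H: "0 \<le> H"
    and y: "norm (y u - y s) \<le> H * (u - s) powr \<alpha>"
  shows "norm (incr DA u t (y u) v - incr DA u t (y s) w)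
    \<le> C * (t - s) powr \<alpha> * norm (v - w) + C * H powr \<beta> * (t - s) powr \<theta> * norm w"
proof -
  have "incr DA u t (y u) v - incr DA u t (y s) w
     = incr DA u t (y u) (v - w) + (incr DA u t (y u) - incr DA u t (y s)) w"
    by (simp add: blinfun.diff_left blinfun.diff_right)
  also have "norm \<dots> \<le> norm (incr DA u t (y u)) * norm (v - w) + norm (incr DA u t (y u) - incr DA u t (y s)) * norm w"
    by (intro order_trans[OF norm_triangle_ineq] add_mono norm_blinfun)
  also have "\<dots> \<le> C * (t - u) powr \<alpha> * norm (v - w) + C * H powr \<beta> * (t - s) powr \<theta> * norm w"
    using o H y by (intro add_mono mult_right_mono DA_bound DA_path) auto
  also have "\<dots> \<le> C * (t - s) powr \<alpha> * norm (v - w) + C * H powr \<beta> * (t - s) powr \<theta> * norm w"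
    using o C \<alpha> by (intro add_mono mult_right_mono mult_left_mono powr_mono2) auto
  finally show ?thesis .
qed

text \<open>The Taylor remainder along two paths is \<open>O(k powr (1 + \<beta>))\<close> but rough in time, and smooth
  enough in time but only \<open>O(k)\<close>; interpolation keeps a little of both.\<close>
lemma taylor_path:
  fixes y y1 :: "real \<Rightarrow> 'v"
  assumes o: "0 \<le> s" "s \<le> u" "u \<le> t" "t \<le> T" and H: "0 \<le> H" and K: "0 \<le> K" and k: "0 \<le> k"
    and y1: "norm (y1 u - y1 s) \<le> H * (u - s) powr \<alpha>" and y: "norm (y u - y s) \<le> H * (u - s) powr \<alpha>"
    and zu: "norm (y1 u - y u) \<le> K * k" and zs: "norm (y1 s - y s) \<le> K * k"
    and z: "norm ((y1 u - y u) - (y1 s - y s)) \<le> K * k * (u - s) powr \<alpha>" and \<mu>: "0 \<le> \<mu>" "\<mu> \<le> 1"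
  defines "e \<equiv> \<lambda>r. incr A u t (y1 r) - incr A u t (y r) - incr DA u t (y r) (y1 r - y r)"
  shows "norm (e u - e s) \<le> (2 * C * K powr (1 + \<beta>) + (2 * C * T powr (2 * \<alpha> - \<theta>) + C * (2 * H) powr \<beta> + C * H powr \<beta>) * K)
     * ((t - s) powr (\<alpha> + \<alpha> * \<beta> * \<mu>) * k powr (1 + \<beta> * (1 - \<mu>)))"
proof -
  define L where "L = t - s"
  have L: "0 \<le> L" "L \<le> T" using o by (auto simp: L_def)
  define G1 where "G1 = 2 * C * K powr (1 + \<beta>)"
  define G2 where "G2 = (2 * C * T powr (2 * \<alpha> - \<theta>) + C * (2 * H) powr \<beta> + C * H powr \<beta>) * K"
  have G: "0 \<le> G1" "0 \<le> G2" using C K by (auto simp: G1_def G2_def)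
  have size: "norm (e r) \<le> C * L powr \<alpha> * (K * k) powr (1 + \<beta>)" if "norm (y1 r - y r) \<le> K * k" for r
  proof -
    have "norm (e r) \<le> C * (t - u) powr \<alpha> * norm (y1 r - y r) powr (1 + \<beta>)"
      unfolding e_def using o by (intro incr_taylor) auto
    also have "\<dots> \<le> C * L powr \<alpha> * (K * k) powr (1 + \<beta>)"
      unfolding L_def using that o C \<alpha> \<beta> by (intro mult_mono mult_left_mono powr_mono2) auto
    finally show ?thesis .
  qed
  have "norm (e u - e s) \<le> C * L powr \<alpha> * (K * k) powr (1 + \<beta>) + C * L powr \<alpha> * (K * k) powr (1 + \<beta>)"
    by (intro order_trans[OF norm_triangle_ineq4] add_mono size zu zs)
  also have "\<dots> = G1 * (L powr \<alpha> * k powr (1 + \<beta>))" using K k by (simp add: G1_def powr_mult algebra_simps)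
  finally have 1: "norm (e u - e s) \<le> G1 * (L powr \<alpha> * k powr (1 + \<beta>))" .
  have zL: "norm ((y1 u - y u) - (y1 s - y s)) \<le> K * k * L powr \<alpha>"
    unfolding L_def using o \<alpha> K k by (intro order_trans[OF z] mult_left_mono powr_mono2) auto
  have L2: "L powr \<alpha> * L powr \<alpha> \<le> T powr (2 * \<alpha> - \<theta>) * L powr \<theta>"
    using powr_le_scaled[OF L, of \<theta> "2 * \<alpha>"] \<theta>(2) by (simp flip: powr_add)
  have a: "norm ((incr A u t (y1 u) - incr A u t (y u)) - (incr A u t (y1 s) - incr A u t (y s)))
    \<le> C * L powr \<alpha> * (K * k * L powr \<alpha>) + C * (2 * H) powr \<beta> * L powr \<theta> * (K * k)"
    using order_trans[OF incr_four_point_path[OF o H y1 y] add_mono[OF mult_left_mono[OF zL] mult_left_mono[OF zs]]] C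
    by (simp add: L_def)
  have b: "norm (incr DA u t (y u) (y1 u - y u) - incr DA u t (y s) (y1 s - y s))
    \<le> C * L powr \<alpha> * (K * k * L powr \<alpha>) + C * H powr \<beta> * L powr \<theta> * (K * k)"
    using order_trans[OF DA_apply_path[OF o H y] add_mono[OF mult_left_mono[OF zL] mult_left_mono[OF zs]]] C
    by (simp add: L_def)
  have "e u - e s = ((incr A u t (y1 u) - incr A u t (y u)) - (incr A u t (y1 s) - incr A u t (y s)))
     - (incr DA u t (y u) (y1 u - y u) - incr DA u t (y s) (y1 s - y s))"
    by (simp add: e_def algebra_simps)
  then have "norm (e u - e s) \<le> (C * L powr \<alpha> * (K * k * L powr \<alpha>) + C * (2 * H) powr \<beta> * L powr \<theta> * (K * k))
     + (C * L powr \<alpha> * (K * k * L powr \<alpha>) + C * H powr \<beta> * L powr \<theta> * (K * k))"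
    using order_trans[OF norm_triangle_ineq4 add_mono[OF a b]] by simp
  also have "\<dots> = 2 * C * K * k * (L powr \<alpha> * L powr \<alpha>) + (C * (2 * H) powr \<beta> + C * H powr \<beta>) * K * (L powr \<theta> * k)"
    by (simp add: algebra_simps)
  also have "\<dots> \<le> 2 * C * K * k * (T powr (2 * \<alpha> - \<theta>) * L powr \<theta>) + (C * (2 * H) powr \<beta> + C * H powr \<beta>) * K * (L powr \<theta> * k)"
    using L2 C K k by (intro add_right_mono mult_left_mono) auto
  also have "\<dots> = G2 * (L powr \<theta> * k)" by (simp add: G2_def algebra_simps)
  finally have 2: "norm (e u - e s) \<le> G2 * (L powr \<theta> * k)" .
  have "norm (e u - e s) \<le> (G1 + G2) * ((L powr \<alpha> * k powr (1 + \<beta>)) powr (1 - \<mu>) * (L powr \<theta> * k) powr \<mu>)"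
  proof (rule interpolate_bound)
    show "norm (e u - e s) \<le> (G1 + G2) * (L powr \<alpha> * k powr (1 + \<beta>))"
      using G by (intro order_trans[OF 1] mult_right_mono) auto
    show "norm (e u - e s) \<le> (G1 + G2) * (L powr \<theta> * k)"
      using G k by (intro order_trans[OF 2] mult_right_mono) auto
  qed (use G k \<mu> in auto)
  \<comment> \<open>The exponents are \<alpha>(1-\<mu>) + \<theta>\<mu> = \<alpha> +
    \<alpha>\<beta>\<mu> in time and (1+\<beta>)(1-\<mu>) + \<mu> = 1 + \<beta>(1-\<mu>) in the
    displacement.\<close>
  also have "(L powr \<alpha> * k powr (1 + \<beta>)) powr (1 - \<mu>) * (L powr \<theta> * k) powr \<mu>
     = (L powr (\<alpha> * (1 - \<mu>)) * L powr (\<theta> * \<mu>)) * (k powr ((1 + \<beta>) * (1 - \<mu>)) * k powr \<mu>)"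
    using k by (simp add: powr_mult powr_powr)
  also have "\<dots> = L powr (\<alpha> + \<alpha> * \<beta> * \<mu>) * k powr (1 + \<beta> * (1 - \<mu>))"
    unfolding powr_add[symmetric] by (simp add: \<theta>(4) algebra_simps)
  finally show ?thesis unfolding L_def G1_def G2_def .
qed

section \<open>Linear combinations of displacements\<close>

text \<open>\<mu> must be large enough for sewing, with time exponent above 1, and below 1 so that
  the power of the displacement stays above 1. The choice puts \<alpha>\<beta>\<mu> halfway between
  1 - \<alpha> and \<alpha>\<beta>.\<close>

lemma ex_interpolation_exponent: "\<exists>\<mu>. 0 < \<mu> \<and> \<mu> < 1 \<and> 1 < \<alpha> + \<alpha> * \<beta> * \<mu>"
proof -
  have p: "0 < \<alpha> * \<beta>" "1 - \<alpha> < \<alpha> * \<beta>" using \<alpha> \<beta> \<theta>(1,4) by auto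
  define x where "x = \<alpha> * \<beta>"
  define \<mu> where "\<mu> = (x + (1 - \<alpha>)) / (2 * x)"
  have "\<alpha> * \<beta> * \<mu> = (\<alpha> * \<beta> + (1 - \<alpha>)) / 2"
    unfolding \<mu>_def x_def[symmetric] using p(1) by (simp add: x_def[symmetric])
  moreover have "0 < \<mu>" "\<mu> < 1" unfolding \<mu>_def using p \<alpha> by (simp_all add: x_def[symmetric])
  ultimately show ?thesis using p by (intro exI[of _ \<mu>]) auto
qed

text \<open>Linearising the field along \<open>y\<close> gives the same operator for every index, so
  the combination solves a linear equation up to Taylor errors. These errors do not cancel and are
  summed in absolute value; they form the inhomogeneity of the Gronwall lemma.\<close>

lemma davie_combination:
  "\<exists>K\<ge>0. \<exists>\<eta>>0. \<forall>a b y (I :: nat set) c Y t.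
     finite I \<and> 0 \<le> a \<and> a \<le> t \<and> t \<le> b \<and> b \<le> T \<and> davie a b y \<and> (\<forall>i\<in>I. davie a b (Y i) \<and> norm (Y i a - y a) \<le> 1) \<longrightarrow>
     norm (\<Sum>i\<in>I. c i *\<^sub>R (Y i t - y t)) \<le> K * (norm (\<Sum>i\<in>I. c i *\<^sub>R (Y i a - y a)) +
        (\<Sum>i\<in>I. \<bar>c i\<bar> * norm (Y i a - y a) powr (1 + \<eta>)))"
proof -
  obtain H where H: "0 \<le> H" and yH: "\<And>a b y s t. 0 \<le> a \<Longrightarrow> a \<le> s \<Longrightarrow> s \<le> t \<Longrightarrow> t \<le> b \<Longrightarrow> b \<le> T \<Longrightarrow> davie a b y \<Longrightarrow>
     norm (y t - y s - incr A s t (y s)) \<le> H * (t - s) powr \<theta> \<and> norm (y t - y s) \<le> H * (t - s) powr \<alpha>"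
    using davie_bound by metis
  obtain K0 where K0: "0 \<le> K0" and dz: "\<And>a b y y1 s t. 0 \<le> a \<Longrightarrow> a \<le> s \<Longrightarrow> s \<le> t \<Longrightarrow> t \<le> b \<Longrightarrow> b \<le> T \<Longrightarrow> davie a b y \<Longrightarrow> davie a b y1 \<Longrightarrow>
     norm (y1 t - y t) \<le> K0 * norm (y1 a - y a) \<and>
     norm ((y1 t - y t) - (y1 s - y s) - (incr A s t (y1 s) - incr A s t (y s))) \<le> K0 * norm (y1 a - y a) * (t - s) powr \<theta> \<and>
     norm ((y1 t - y t) - (y1 s - y s)) \<le> K0 * norm (y1 a - y a) * (t - s) powr \<alpha>"
    using davie_diff by metis
  obtain \<mu> where \<mu>: "0 < \<mu>" "\<mu> < 1" "1 < \<alpha> + \<alpha> * \<beta> * \<mu>" using ex_interpolation_exponent by blast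
  define \<theta>' where "\<theta>' = \<alpha> + \<alpha> * \<beta> * \<mu>"
  define \<eta> where "\<eta> = \<beta> * (1 - \<mu>)"
  have \<eta>: "0 < \<eta>" "\<eta> \<le> \<beta>" using \<mu> \<beta> by (auto simp: \<eta>_def mult_le_cancel_left1)
  have \<theta>': "1 < \<theta>'" "\<theta>' \<le> \<theta>" "\<theta>' \<le> 2 * \<alpha>" "\<alpha> \<le> \<theta>'"
  proof -
    have "\<alpha> * \<beta> * \<mu> \<le> \<alpha> * \<beta> * 1" "0 \<le> \<alpha> * \<beta> * \<mu>" using \<alpha> \<beta> \<mu> by (auto intro: mult_left_mono)
    then show "1 < \<theta>'" "\<theta>' \<le> \<theta>" "\<theta>' \<le> 2 * \<alpha>" "\<alpha> \<le> \<theta>'"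
      unfolding \<theta>'_def using \<mu> \<theta> by linarith+
  qed
  define G where "G = 2 * C * K0 powr (1 + \<beta>) + (2 * C * T powr (2 * \<alpha> - \<theta>) + C * (2 * H) powr \<beta> + C * H powr \<beta>) * K0"
  \<comment> \<open>In order: the size of \<open>incr DA\<close>, the Taylor error at a fixed time,
    the variation of \<open>incr DA\<close> along \<open>y\<close>, and the variation of the Taylor
    error in time. The power of T pays for lowering \<theta> to \<theta>'.\<close>
  define C' where "C' = C + C * K0 powr (1 + \<beta>) + C * H powr \<beta> * T powr (\<theta> - \<theta>') + G"
  have G: "0 \<le> G" using C K0 by (auto simp: G_def)
  have C': "0 \<le> C'" "C \<le> C'" "C * K0 powr (1 + \<beta>) \<le> C'" "C * H powr \<beta> * T powr (\<theta> - \<theta>') \<le> C'" "G \<le> C'"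
    using C G by (auto simp: C'_def)
  obtain K where K: "0 \<le> K" and gron: "\<And>a b (w :: real \<Rightarrow> 'v) \<Xi> \<epsilon> s t. 0 \<le> \<epsilon> \<Longrightarrow> a \<le> b \<Longrightarrow> b - a \<le> T \<Longrightarrow>
      young_germ \<alpha> \<theta>' C' a b w \<Xi> \<epsilon> \<Longrightarrow> a \<le> s \<Longrightarrow> s \<le> t \<Longrightarrow> t \<le> b \<Longrightarrow> norm (w t) \<le> K * (norm (w a) + \<epsilon>)"
    using young_gronwall[where 'w = 'v, OF \<alpha>(1) \<theta>'(1,3,4) C'(1) less_imp_le[OF T]] by metis
  show ?thesis
  proof (intro exI[of _ K] conjI[OF K] exI[of _ \<eta>] conjI[OF \<eta>(1)] allI impI; elim conjE)
    fix a b y and I :: "nat set" and c :: "nat \<Rightarrow> real" and Y t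
    assume I: "finite I" and o: "0 \<le> a" "a \<le> t" "t \<le> b" "b \<le> T" and y: "davie a b y"
      and Y: "\<forall>i\<in>I. davie a b (Y i) \<and> norm (Y i a - y a) \<le> 1"
    define k where "k = (\<lambda>i. norm (Y i a - y a))"
    define \<epsilon> where "\<epsilon> = (\<Sum>i\<in>I. \<bar>c i\<bar> * k i powr (1 + \<eta>))"
    define w where "w = (\<lambda>t. \<Sum>i\<in>I. c i *\<^sub>R (Y i t - y t))"
    define e where "e = (\<lambda>s t r i. incr A s t (Y i r) - incr A s t (y r) - incr DA s t (y r) (Y i r - y r))"
    \<comment> \<open>The evaluation time \<open>r\<close> is separated from the increment: for
      fixed \<open>r\<close> this is additive in time, so the defect of the germ is just the effect
      of moving \<open>r\<close> from s to u.\<close>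
    define \<Xi> where "\<Xi> = (\<lambda>s t r. \<Sum>i\<in>I. c i *\<^sub>R (incr A s t (Y i r) - incr A s t (y r)))"
    have \<epsilon>: "0 \<le> \<epsilon>" by (auto simp: \<epsilon>_def intro!: sum_nonneg)
    have k: "0 \<le> k i" for i by (simp add: k_def)
    have k1: "k i \<le> 1" if "i \<in> I" for i using Y that by (auto simp: k_def)
    have \<Xi>_eq: "\<Xi> s t r = incr DA s t (y r) (w r) + (\<Sum>i\<in>I. c i *\<^sub>R e s t r i)" for s t r
      by (simp add: \<Xi>_def w_def e_def blinfun.sum_right blinfun.scaleR_right sum.distrib[symmetric] scaleR_right_distrib[symmetric])
    have sum_le: "norm (\<Sum>i\<in>I. c i *\<^sub>R x i) \<le> B * \<epsilon>" if "\<And>i. i \<in> I \<Longrightarrow> norm (x i) \<le> B * k i powr (1 + \<eta>)"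
      for x :: "nat \<Rightarrow> 'v" and B
      unfolding \<epsilon>_def sum_distrib_left
    proof (rule sum_norm_le)
      fix i assume "i \<in> I"
      then show "norm (c i *\<^sub>R x i) \<le> B * (\<bar>c i\<bar> * k i powr (1 + \<eta>))"
        using mult_left_mono[OF that, of i "\<bar>c i\<bar>"] by (simp add: ac_simps)
    qed
    have "young_germ \<alpha> \<theta>' C' a b w (\<lambda>s t. \<Xi> s t s) \<epsilon>"
      unfolding young_germ_def
    proof (intro conjI allI impI; (elim conjE)?)
      \<comment> \<open>This bound depends on the individual coefficients and not only on their
        combination; that is harmless, as the germ asks for finiteness alone.\<close>
      have "norm (w t - w s - \<Xi> s t s) \<le> (\<Sum>i\<in>I. \<bar>c i\<bar> * (K0 * k i * T powr (\<theta> - \<theta>'))) * (t - s) powr \<theta>'"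
        if st: "a \<le> s" "s \<le> t" "t \<le> b" for s t
      proof -
        have eq: "w t - w s - \<Xi> s t s = (\<Sum>i\<in>I. c i *\<^sub>R ((Y i t - y t) - (Y i s - y s) - (incr A s t (Y i s) - incr A s t (y s))))"
          by (simp add: w_def \<Xi>_def sum_subtractf scaleR_right_diff_distrib)
        have "norm (w t - w s - \<Xi> s t s) \<le> (\<Sum>i\<in>I. \<bar>c i\<bar> * (K0 * k i * T powr (\<theta> - \<theta>')) * (t - s) powr \<theta>')"
          unfolding eq
        proof (rule sum_norm_le)
          fix i assume i: "i \<in> I"
          have "norm ((Y i t - y t) - (Y i s - y s) - (incr A s t (Y i s) - incr A s t (y s))) \<le> K0 * k i * (t - s) powr \<theta>"
            using dz[OF o(1) st o(4) y] Y i by (simp add: k_def)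
          also have "\<dots> \<le> K0 * k i * (T powr (\<theta> - \<theta>') * (t - s) powr \<theta>')"
            using K0 k st o \<theta>' by (intro mult_left_mono powr_le_scaled) auto
          finally show "norm (c i *\<^sub>R ((Y i t - y t) - (Y i s - y s) - (incr A s t (Y i s) - incr A s t (y s))))
             \<le> \<bar>c i\<bar> * (K0 * k i * T powr (\<theta> - \<theta>')) * (t - s) powr \<theta>'"
            by (simp add: mult_left_mono mult.assoc)
        qed
        then show ?thesis by (simp add: sum_distrib_right)
      qed
      then show "\<exists>M. \<forall>s t. a \<le> s \<and> s \<le> t \<and> t \<le> b \<longrightarrow> norm (w t - w s - \<Xi> s t s) \<le> M * (t - s) powr \<theta>'" by blast
    next
      fix s t assume st: "a \<le> s" "s \<le> t" "t \<le> b"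
      have "norm (\<Sum>i\<in>I. c i *\<^sub>R e s t s i) \<le> C * K0 powr (1 + \<beta>) * (t - s) powr \<alpha> * \<epsilon>"
      proof (rule sum_le)
        fix i assume i: "i \<in> I"
        have "norm (e s t s i) \<le> C * (t - s) powr \<alpha> * norm (Y i s - y s) powr (1 + \<beta>)"
          unfolding e_def using st o by (intro incr_taylor) auto
        also have "\<dots> \<le> C * (t - s) powr \<alpha> * (K0 * k i) powr (1 + \<beta>)"
          using dz[OF o(1) order_refl, of s b y "Y i"] dz[OF o(1) st(1) order_refl _ o(4) y] Y i st o C \<beta>
          by (intro mult_left_mono powr_mono2) (auto simp: k_def)
        also have "\<dots> = C * K0 powr (1 + \<beta>) * (t - s) powr \<alpha> * k i powr (1 + \<beta>)"
          using K0 k by (simp add: powr_mult)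
        also have "\<dots> \<le> C * K0 powr (1 + \<beta>) * (t - s) powr \<alpha> * k i powr (1 + \<eta>)"
          using C k k1[OF i] \<eta> by (intro mult_left_mono powr_le_powr_exp_le_1) auto
        finally show "norm (e s t s i) \<le> C * K0 powr (1 + \<beta>) * (t - s) powr \<alpha> * k i powr (1 + \<eta>)" .
      qed
      also have "\<dots> \<le> C' * (t - s) powr \<alpha> * \<epsilon>" using C' \<epsilon> by (intro mult_right_mono) auto
      finally have E: "norm (\<Sum>i\<in>I. c i *\<^sub>R e s t s i) \<le> C' * (t - s) powr \<alpha> * \<epsilon>" .
      have "norm (incr DA s t (y s) (w s)) \<le> C * (t - s) powr \<alpha> * norm (w s)"
        using st o by (intro order_trans[OF norm_blinfun mult_right_mono[OF DA_bound]]) auto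
      also have "\<dots> \<le> C' * (t - s) powr \<alpha> * norm (w s)" using C' by (intro mult_right_mono) auto
      finally show "norm (\<Xi> s t s) \<le> C' * (t - s) powr \<alpha> * (norm (w s) + \<epsilon>)"
        unfolding \<Xi>_eq distrib_left using E by (intro order_trans[OF norm_triangle_ineq add_mono])
    next
      fix s u t assume st: "a \<le> s" "s \<le> u" "u \<le> t" "t \<le> b"
      have "\<Xi> s t s = \<Xi> s u s + \<Xi> u t s"
        unfolding \<Xi>_def sum.distrib[symmetric] scaleR_right_distrib[symmetric] by (simp add: incr_def algebra_simps)
      then have "\<Xi> s t s - \<Xi> s u s - \<Xi> u t u = - (\<Xi> u t u - \<Xi> u t s)" by simp
      also have "\<Xi> u t u - \<Xi> u t s = (incr DA u t (y u) (w u) - incr DA u t (y s) (w s)) + (\<Sum>i\<in>I. c i *\<^sub>R (e u t u i - e u t s i))"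
        unfolding \<Xi>_eq by (simp add: scaleR_right_diff_distrib sum_subtractf)
      finally have eq: "norm (\<Xi> s t s - \<Xi> s u s - \<Xi> u t u)
         = norm ((incr DA u t (y u) (w u) - incr DA u t (y s) (w s)) + (\<Sum>i\<in>I. c i *\<^sub>R (e u t u i - e u t s i)))"
        by (simp only: norm_minus_cancel)
      have 1: "norm (incr DA u t (y u) (w u) - incr DA u t (y s) (w s))
         \<le> C' * (t - s) powr \<alpha> * norm (w u - w s) + C' * (t - s) powr \<theta>' * norm (w s)"
      proof -
        have "norm (incr DA u t (y u) (w u) - incr DA u t (y s) (w s))
          \<le> C * (t - s) powr \<alpha> * norm (w u - w s) + C * H powr \<beta> * (t - s) powr \<theta> * norm (w s)"
          using st o H yH[of a s u b y] y by (intro DA_apply_path) auto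
        also have "\<dots> \<le> C * (t - s) powr \<alpha> * norm (w u - w s) + C * H powr \<beta> * (T powr (\<theta> - \<theta>') * (t - s) powr \<theta>') * norm (w s)"
          using st o \<theta>' C by (intro add_left_mono mult_right_mono mult_left_mono powr_le_scaled) auto
        also have "\<dots> = C * (t - s) powr \<alpha> * norm (w u - w s) + C * H powr \<beta> * T powr (\<theta> - \<theta>') * (t - s) powr \<theta>' * norm (w s)"
          by simp
        also have "\<dots> \<le> C' * (t - s) powr \<alpha> * norm (w u - w s) + C' * (t - s) powr \<theta>' * norm (w s)"
          using C' by (intro add_mono mult_right_mono) auto
        finally show ?thesis .
      qed
      have 2: "norm (\<Sum>i\<in>I. c i *\<^sub>R (e u t u i - e u t s i)) \<le> G * (t - s) powr \<theta>' * \<epsilon>"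
      proof (rule sum_le)
        fix i assume i: "i \<in> I"
        have "norm (e u t u i - e u t s i) \<le> G * ((t - s) powr \<theta>' * k i powr (1 + \<eta>))"
          unfolding e_def G_def \<theta>'_def \<eta>_def
          using st o H K0 k Y i y yH[of a s u b y] yH[of a s u b "Y i"] dz[of a s s b y "Y i"] dz[of a s u b y "Y i"] \<mu>
          by (intro taylor_path) (auto simp: k_def)
        then show "norm (e u t u i - e u t s i) \<le> G * (t - s) powr \<theta>' * k i powr (1 + \<eta>)" by (simp add: mult.assoc)
      qed
      also have "\<dots> \<le> C' * (t - s) powr \<theta>' * \<epsilon>" using C' \<epsilon> by (intro mult_right_mono) auto
      finally have 2: "norm (\<Sum>i\<in>I. c i *\<^sub>R (e u t u i - e u t s i)) \<le> C' * (t - s) powr \<theta>' * \<epsilon>" .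
      show "norm (\<Xi> s t s - \<Xi> s u s - \<Xi> u t u) \<le> C' * (t - s) powr \<alpha> * norm (w u - w s) + C' * (t - s) powr \<theta>' * (norm (w s) + \<epsilon>)"
        unfolding eq using order_trans[OF norm_triangle_ineq add_mono[OF 1 2]] by (simp add: algebra_simps)
    qed
    from gron[OF \<epsilon> _ _ this, of t t] o
    show "norm (\<Sum>i\<in>I. c i *\<^sub>R (Y i t - y t)) \<le> K * (norm (\<Sum>i\<in>I. c i *\<^sub>R (Y i a - y a)) +
        (\<Sum>i\<in>I. \<bar>c i\<bar> * norm (Y i a - y a) powr (1 + \<eta>)))"
      by (simp add: w_def \<epsilon>_def k_def)
  qed
qed

section \<open>Existence of Davie solutions\<close>

lemma powr_twice: "x powr (2 * a) = x powr a * x powr a" for x a :: real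
  by (simp only: mult_2 powr_add)

text \<open>One Picard iterate: sewing integrates the field along \<open>y\<close>, and a shift sets
  the initial value. With b - a \<le> 1, the defect of order 2\<alpha> is bounded by one of order
  \<theta>.\<close>

lemma ex_picard_step:
  assumes H: "0 \<le> H" and ab: "0 \<le> a" "a \<le> b" "b \<le> T" "b - a \<le> 1"
    and y: "\<And>s t. a \<le> s \<Longrightarrow> s \<le> t \<Longrightarrow> t \<le> b \<Longrightarrow> norm (y t - y s) \<le> H * (t - s) powr \<alpha>"
  shows "\<exists>y'. y' a = x \<and> (\<forall>s t. a \<le> s \<and> s \<le> t \<and> t \<le> b \<longrightarrow>
     norm (y' t - y' s - incr A s t (y s)) \<le> 2 * (C * H) * sew_const \<theta> * (t - s) powr \<theta>)"
proof -
  have "norm (incr A s t (y s) - incr A s u (y s) - incr A u t (y u)) \<le> C * H * (t - s) powr \<theta>"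
    if o: "a \<le> s" "s \<le> u" "u \<le> t" "t \<le> b" for s u t
  proof -
    have "norm (incr A s t (y s) - incr A s u (y s) - incr A u t (y u)) = norm (incr A u t (y s) - incr A u t (y u))"
      by (simp add: incr_def)
    also have "\<dots> \<le> C * (t - u) powr \<alpha> * norm (y s - y u)" using o ab by (intro incr_lipschitz) auto
    also have "\<dots> \<le> C * (t - s) powr \<alpha> * (H * (t - s) powr \<alpha>)"
    proof (intro mult_mono mult_left_mono powr_mono2)
      have "norm (y s - y u) \<le> H * (u - s) powr \<alpha>" using y[of s u] o by (simp add: norm_minus_commute)
      also have "\<dots> \<le> H * (t - s) powr \<alpha>" using o H \<alpha> by (intro mult_left_mono powr_mono2) auto
      finally show "norm (y s - y u) \<le> H * (t - s) powr \<alpha>" .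
    qed (use o C \<alpha> in auto)
    also have "\<dots> = C * H * (t - s) powr (2 * \<alpha>)" by (simp only: powr_twice) (simp only: ac_simps)
    also have "\<dots> \<le> C * H * (t - s) powr \<theta>"
      using o ab C H \<theta> by (intro mult_left_mono powr_le_powr_exp_le_1) auto
    finally show ?thesis .
  qed
  from sewing[where \<Xi> = "\<lambda>s t. incr A s t (y s)", OF \<theta>(1) mult_nonneg_nonneg[OF C H] ab(2) this]
  obtain I where I: "\<forall>s t. a \<le> s \<and> s \<le> t \<and> t \<le> b \<longrightarrow>
     norm (I t - I s - incr A s t (y s)) \<le> 2 * (C * H) * sew_const \<theta> * (t - s) powr \<theta>"
    by blast
  then show ?thesis by (intro exI[of _ "\<lambda>t. x + I t - I a"]) auto
qed

text \<open>Contraction in the \<alpha>-Hoelder seminorm. A common initial value turns the seminorm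
  into a small supremum, and the surplus \<theta> - \<alpha> = \<alpha>\<beta> gives the small
  factor in the sewn remainder. \<open>M\<close> only certifies finiteness for
  \<open>sewing_bound\<close>.\<close>

lemma picard_contraction:
  assumes H: "0 \<le> H" and ab: "0 \<le> a" "a \<le> b" "b \<le> T" "b - a \<le> h" "h \<le> 1" "0 < h" and G: "0 \<le> G"
    and yH: "\<And>s t. a \<le> s \<Longrightarrow> s \<le> t \<Longrightarrow> t \<le> b \<Longrightarrow> norm (y t - y s) \<le> H * (t - s) powr \<alpha>"
    and y1H: "\<And>s t. a \<le> s \<Longrightarrow> s \<le> t \<Longrightarrow> t \<le> b \<Longrightarrow> norm (y1 t - y1 s) \<le> H * (t - s) powr \<alpha>"
    and z: "\<And>s t. a \<le> s \<Longrightarrow> s \<le> t \<Longrightarrow> t \<le> b \<Longrightarrow> norm ((y1 t - y t) - (y1 s - y s)) \<le> G * (t - s) powr \<alpha>"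
    and za: "y1 a = y a"
    and M: "\<And>s t. a \<le> s \<Longrightarrow> s \<le> t \<Longrightarrow> t \<le> b \<Longrightarrow> norm (y' t - y' s - incr A s t (y s)) \<le> M * (t - s) powr \<theta>"
    and M1: "\<And>s t. a \<le> s \<Longrightarrow> s \<le> t \<Longrightarrow> t \<le> b \<Longrightarrow> norm (y1' t - y1' s - incr A s t (y1 s)) \<le> M * (t - s) powr \<theta>"
    and h: "(C + sew_const \<theta> * (C + C * (2 * H) powr \<beta>)) * h powr (\<alpha> * \<beta>) \<le> 1/2"
    and st: "a \<le> s" "s \<le> t" "t \<le> b"
  shows "norm ((y1' t - y' t) - (y1' s - y' s)) \<le> G / 2 * (t - s) powr \<alpha>"
proof -
  define \<Xi> where "\<Xi> = (\<lambda>s t. incr A s t (y1 s) - incr A s t (y s))"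
  define R where "R = (\<lambda>s t. (y1' t - y' t) - (y1' s - y' s) - \<Xi> s t)"
  define D where "D = (C + C * (2 * H) powr \<beta>) * G"
  have D: "0 \<le> D" using C G by (simp add: D_def)
  have zs: "norm (y1 s - y s) \<le> G * h powr \<alpha>" "norm (y1 s - y s) \<le> G" if "a \<le> s" "s \<le> b" for s
  proof -
    have "norm (y1 s - y s) \<le> G * (s - a) powr \<alpha>" using z[of a s] that za by simp
    also have "\<dots> \<le> G * h powr \<alpha>" using that ab G \<alpha> by (intro mult_left_mono powr_mono2) auto
    finally show 1: "norm (y1 s - y s) \<le> G * h powr \<alpha>" .
    also have "\<dots> \<le> G * 1" using ab G \<alpha> by (intro mult_left_mono powr_le1) auto
    finally show "norm (y1 s - y s) \<le> G" by simp
  qed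
  have "norm (R s t) \<le> sew_const \<theta> * D * (t - s) powr \<theta>"
  proof (rule sewing_bound[where a = a and b = b and M = "M + M"])
    fix s t assume st: "a \<le> s" "s \<le> t" "t \<le> b"
    have "R s t = (y1' t - y1' s - incr A s t (y1 s)) - (y' t - y' s - incr A s t (y s))"
      by (simp add: R_def \<Xi>_def)
    then show "norm (R s t) \<le> (M + M) * (t - s) powr \<theta>"
      using order_trans[OF norm_triangle_ineq4 add_mono[OF M1[OF st] M[OF st]]] by (simp add: distrib_right)
  next
    fix s u t assume o: "a \<le> s" "s \<le> u" "u \<le> t" "t \<le> b"
    have "R s t - R s u - R u t = (incr A u t (y1 u) - incr A u t (y u)) - (incr A u t (y1 s) - incr A u t (y s))"
      by (simp add: R_def \<Xi>_def incr_def)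
    then have "norm (R s t - R s u - R u t) \<le>
       C * (t - s) powr \<alpha> * norm ((y1 u - y u) - (y1 s - y s)) + C * (2 * H) powr \<beta> * (t - s) powr \<theta> * norm (y1 s - y s)"
      using incr_four_point_path[of s u t H y1 y] o ab H yH y1H by simp
    also have "\<dots> \<le> C * (t - s) powr \<alpha> * (G * (t - s) powr \<alpha>) + C * (2 * H) powr \<beta> * (t - s) powr \<theta> * G"
    proof (intro add_mono mult_left_mono)
      have "norm ((y1 u - y u) - (y1 s - y s)) \<le> G * (u - s) powr \<alpha>" using z[of s u] o by simp
      also have "\<dots> \<le> G * (t - s) powr \<alpha>" using o G \<alpha> by (intro mult_left_mono powr_mono2) auto
      finally show "norm ((y1 u - y u) - (y1 s - y s)) \<le> G * (t - s) powr \<alpha>" .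
      show "norm (y1 s - y s) \<le> G" using zs o by simp
    qed (use C in auto)
    also have "\<dots> = C * G * (t - s) powr (2 * \<alpha>) + C * (2 * H) powr \<beta> * (t - s) powr \<theta> * G"
      by (simp only: powr_twice) (simp only: ac_simps)
    also have "\<dots> \<le> C * G * (t - s) powr \<theta> + C * (2 * H) powr \<beta> * (t - s) powr \<theta> * G"
      using o ab C G \<theta> by (intro add_right_mono mult_left_mono powr_le_powr_exp_le_1) auto
    finally show "norm (R s t - R s u - R u t) \<le> D * (t - s) powr \<theta>" by (simp add: D_def algebra_simps)
  qed (use \<theta> D st in auto)
  also have "\<dots> \<le> sew_const \<theta> * D * (h powr (\<alpha> * \<beta>) * (t - s) powr \<alpha>)"
    using powr_le_scaled[of "t - s" h \<alpha> \<theta>] \<theta> st ab D sew_const_pos[OF \<theta>(1)] by (intro mult_left_mono) auto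
  finally have R: "norm (R s t) \<le> sew_const \<theta> * D * (h powr (\<alpha> * \<beta>) * (t - s) powr \<alpha>)" .
  have "\<alpha> * \<beta> \<le> \<alpha>" using \<alpha> \<beta> by (simp add: mult_le_cancel_left1)
  then have ha: "h powr \<alpha> \<le> h powr (\<alpha> * \<beta>)" using ab by (intro powr_le_powr_exp_le_1) auto
  have "norm (\<Xi> s t) \<le> C * (t - s) powr \<alpha> * norm (y1 s - y s)"
    unfolding \<Xi>_def using st ab by (intro incr_lipschitz) auto
  also have "\<dots> \<le> C * (t - s) powr \<alpha> * (G * h powr (\<alpha> * \<beta>))"
    using C zs(1)[of s] st mult_left_mono[OF ha G] by (intro mult_left_mono) auto
  finally have \<Xi>: "norm (\<Xi> s t) \<le> C * (t - s) powr \<alpha> * (G * h powr (\<alpha> * \<beta>))" .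
  have "norm ((y1' t - y' t) - (y1' s - y' s)) \<le> norm (\<Xi> s t) + norm (R s t)"
    using norm_triangle_ineq[of "\<Xi> s t" "R s t"] by (simp add: R_def)
  also have "\<dots> \<le> C * (t - s) powr \<alpha> * (G * h powr (\<alpha> * \<beta>)) + sew_const \<theta> * D * (h powr (\<alpha> * \<beta>) * (t - s) powr \<alpha>)"
    by (intro add_mono \<Xi> R)
  also have "\<dots> = ((C + sew_const \<theta> * (C + C * (2 * H) powr \<beta>)) * h powr (\<alpha> * \<beta>)) * (G * (t - s) powr \<alpha>)"
    by (simp add: D_def algebra_simps)
  also have "\<dots> \<le> 1/2 * (G * (t - s) powr \<alpha>)" using h G by (intro mult_right_mono) auto
  finally show ?thesis by simp
qed

text \<open>The length h does not depend on the interval or on the initial value, because the field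
  is globally bounded and Lipschitz; this lets local solutions be chained up to T.\<close>

lemma davie_exists_short:
  "\<exists>h>0. \<forall>a b x. 0 \<le> a \<and> a \<le> b \<and> b \<le> T \<and> b - a \<le> h \<longrightarrow> (\<exists>y. y a = x \<and> davie a b y)"
proof -
  \<comment> \<open>A Hoelder constant preserved by the iteration: C from the increment of the
    field, 1 from the remainder, whose contribution M h^(\<alpha>\<beta>) is made at most 1.\<close>
  define H where "H = C + 1"
  define M where "M = 2 * (C * H) * sew_const \<theta>"
  define E where "E = M + (C + sew_const \<theta> * (C + C * (2 * H) powr \<beta>))"
  have H: "0 \<le> H" using C by (simp add: H_def)
  have M: "0 \<le> M" using C H sew_const_pos[OF \<theta>(1)] by (simp add: M_def)
  have E': "0 \<le> C + sew_const \<theta> * (C + C * (2 * H) powr \<beta>)" using C sew_const_pos[OF \<theta>(1)] by simp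
  have E: "0 \<le> E" using M E' by (simp add: E_def)
  have p: "0 < \<alpha> * \<beta>" using \<alpha> \<beta> by simp
  obtain h where h: "0 < h" "h \<le> 1" and hE: "E * h powr (\<alpha> * \<beta>) \<le> 1/2" using ex_small_powr[OF p E] by blast
  have h1: "M * h powr (\<alpha> * \<beta>) \<le> 1"
   and h2: "(C + sew_const \<theta> * (C + C * (2 * H) powr \<beta>)) * h powr (\<alpha> * \<beta>) \<le> 1/2"
    using hE M E' mult_nonneg_nonneg[OF M powr_ge_zero, of h "\<alpha> * \<beta>"]
      mult_nonneg_nonneg[OF E' powr_ge_zero, of h "\<alpha> * \<beta>"] unfolding E_def distrib_right[of M] by linarith+
  show ?thesis
  proof (intro exI[of _ h] conjI h(1) allI impI; elim conjE)
    fix a b and x :: 'v assume ab: "0 \<le> a" "a \<le> b" "b \<le> T" "b - a \<le> h"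
    define good where "good = (\<lambda>y. y a = x \<and> (\<forall>s t. a \<le> s \<and> s \<le> t \<and> t \<le> b \<longrightarrow> norm (y t - y s) \<le> H * (t - s) powr \<alpha>))"
    define step where "step = (\<lambda>y y'. y' a = x \<and> (\<forall>s t. a \<le> s \<and> s \<le> t \<and> t \<le> b \<longrightarrow>
       norm (y' t - y' s - incr A s t (y s)) \<le> M * (t - s) powr \<theta>))"
    \<comment> \<open>With the implication inside the existential, choice yields an iteration map
      defined on all paths.\<close>
    have "\<exists>y'. good y \<longrightarrow> step y y'" for y
      using ex_picard_step[of H a b y x] H ab h unfolding good_def step_def M_def by (cases "good y") auto
    then obtain F where F: "\<And>y. good y \<Longrightarrow> step y (F y)" by metis
    have step_good: "good y'" if "step y y'" for y y'
      unfolding good_def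
    proof (intro conjI allI impI; (elim conjE)?)
      show "y' a = x" using that by (simp add: step_def)
      fix s t assume st: "a \<le> s" "s \<le> t" "t \<le> b"
      have "norm (y' t - y' s) \<le> norm (incr A s t (y s)) + norm (y' t - y' s - incr A s t (y s))"
        by (rule norm_triangle_sub)
      also have "\<dots> \<le> C * (t - s) powr \<alpha> + M * (t - s) powr \<theta>"
        using st ab that by (intro add_mono A_bound) (auto simp: step_def)
      also have "\<dots> \<le> C * (t - s) powr \<alpha> + M * (h powr (\<alpha> * \<beta>) * (t - s) powr \<alpha>)"
        using powr_le_scaled[of "t - s" h \<alpha> \<theta>] \<theta> st ab M by (intro add_left_mono mult_left_mono) auto
      also have "\<dots> = (C + M * h powr (\<alpha> * \<beta>)) * (t - s) powr \<alpha>" by (simp add: algebra_simps)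
      also have "\<dots> \<le> H * (t - s) powr \<alpha>" using h1 unfolding H_def by (intro mult_right_mono) auto
      finally show "norm (y' t - y' s) \<le> H * (t - s) powr \<alpha>" .
    qed
    define Y where "Y = (\<lambda>n. (F ^^ n) (\<lambda>_. x))"
    have "good (\<lambda>_. x)" using H by (simp add: good_def)
    then have good: "good (Y n)" for n
      unfolding Y_def by (induction n) (auto intro: step_good[OF F])
    have step: "step (Y n) (Y (Suc n))" for n using F[OF good[of n]] by (simp add: Y_def)
    have goodD: "norm (Y n t - Y n s) \<le> H * (t - s) powr \<alpha>" if "a \<le> s" "s \<le> t" "t \<le> b" for n s t
      using good[of n] that by (simp add: good_def)
    have Ya: "Y n a = x" for n using good[of n] by (simp add: good_def)
    have stepD: "norm (Y (Suc n) t - Y (Suc n) s - incr A s t (Y n s)) \<le> M * (t - s) powr \<theta>"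
      if "a \<le> s" "s \<le> t" "t \<le> b" for n s t using step[of n] that by (simp add: step_def)
    have contr: "norm ((Y (Suc n) t - Y n t) - (Y (Suc n) s - Y n s)) \<le> 2 * H * (1/2) ^ n * (t - s) powr \<alpha>"
      if "a \<le> s" "s \<le> t" "t \<le> b" for n s t
      using that
    proof (induction n arbitrary: s t)
      case 0
      have "(Y (Suc 0) t - Y 0 t) - (Y (Suc 0) s - Y 0 s) = (Y (Suc 0) t - Y (Suc 0) s) - (Y 0 t - Y 0 s)" by simp
      then have "norm ((Y (Suc 0) t - Y 0 t) - (Y (Suc 0) s - Y 0 s)) \<le> H * (t - s) powr \<alpha> + H * (t - s) powr \<alpha>"
        using order_trans[OF norm_triangle_ineq4 add_mono[OF goodD[OF 0, of "Suc 0"] goodD[OF 0, of 0]]] by metis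
      then show ?case by simp
    next
      case (Suc n)
      have "norm ((Y (Suc (Suc n)) t - Y (Suc n) t) - (Y (Suc (Suc n)) s - Y (Suc n) s)) \<le> (2 * H * (1/2) ^ n) / 2 * (t - s) powr \<alpha>"
        by (rule picard_contraction[OF H ab h(2,1) _ goodD[of _ _ n] goodD[of _ _ "Suc n"] Suc.IH _ stepD stepD h2 Suc.prems])
          (use H Ya in auto)
      then show ?case by simp
    qed
    have conv: "\<exists>l. (\<lambda>n. Y n t) \<longlonglongrightarrow> l" if t: "a \<le> t" "t \<le> b" for t
    proof -
      have "convergent (\<lambda>n. Y n t)"
      proof (rule convergent_if_geometric_increments[where c = "2 * H" and q = "1/2"])
        fix n
        have "norm (Y (Suc n) t - Y n t) \<le> 2 * H * (1/2) ^ n * (t - a) powr \<alpha>"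
          using contr[of a t n] t Ya by simp
        also have "\<dots> \<le> 2 * H * (1/2) ^ n * 1"
          using t ab h H \<alpha> by (intro mult_left_mono powr_le1) auto
        finally show "norm (Y (Suc n) t - Y n t) \<le> 2 * H * (1/2) ^ n" by simp
      qed auto
      then show ?thesis by (simp add: convergent_def)
    qed
    define y where "y = (\<lambda>t. lim (\<lambda>n. Y n t))"
    have lim: "(\<lambda>n. Y n t) \<longlonglongrightarrow> y t" if "a \<le> t" "t \<le> b" for t
      unfolding y_def using conv[OF that] by (simp add: convergent_LIMSEQ_iff[symmetric] convergent_def)
    \<comment> \<open>The limit is taken directly in the one-step expansion: its constant does not
      depend on n, so pointwise convergence and continuity of the field are enough.\<close>
    have "norm (y t - y s - incr A s t (y s)) \<le> M * (t - s) powr \<theta>" if st: "a \<le> s" "s \<le> t" "t \<le> b" for s t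
    proof (rule LIMSEQ_le_const2)
      have "isCont (incr A s t) (y s)"
        by (rule has_derivative_continuous[OF incr_deriv]) (use st ab in auto)
      then have "(\<lambda>n. incr A s t (Y n s)) \<longlonglongrightarrow> incr A s t (y s)"
        by (rule isCont_tendsto_compose) (use lim st in auto)
      moreover have "(\<lambda>n. Y (Suc n) t) \<longlonglongrightarrow> y t" "(\<lambda>n. Y (Suc n) s) \<longlonglongrightarrow> y s"
        using lim st by (auto intro!: LIMSEQ_Suc)
      ultimately show "(\<lambda>n. norm (Y (Suc n) t - Y (Suc n) s - incr A s t (Y n s))) \<longlonglongrightarrow> norm (y t - y s - incr A s t (y s))"
        by (intro tendsto_norm tendsto_diff)
      show "\<exists>N. \<forall>n\<ge>N. norm (Y (Suc n) t - Y (Suc n) s - incr A s t (Y n s)) \<le> M * (t - s) powr \<theta>"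
        using stepD st by blast
    qed
    moreover have "y a = x" by (simp add: y_def Ya)
    ultimately show "\<exists>y. y a = x \<and> davie a b y" unfolding davie_def by blast
  qed
qed

lemma davie_cong:
  assumes "davie a b y" "\<And>t. a \<le> t \<Longrightarrow> t \<le> b \<Longrightarrow> y' t = y t"
  shows "davie a b y'"
proof -
  obtain M where M: "\<And>s t. a \<le> s \<Longrightarrow> s \<le> t \<Longrightarrow> t \<le> b \<Longrightarrow> norm (y t - y s - incr A s t (y s)) \<le> M * (t - s) powr \<theta>"
    using assms(1) unfolding davie_def by blast
  have "norm (y' t - y' s - incr A s t (y' s)) \<le> M * (t - s) powr \<theta>" if "a \<le> s" "s \<le> t" "t \<le> b" for s t
    using M[of s t] assms(2)[of s] assms(2)[of t] that by simp
  then show ?thesis unfolding davie_def by blast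
qed

text \<open>Across the joint, the expansions on the two sides differ from the full one only by
  evaluating the field over [b, t] at \<open>y b\<close> and not at \<open>y s\<close>, which costs
  order 2\<alpha> \<ge> \<theta>.\<close>

lemma davie_concat:
  assumes o: "0 \<le> a" "a \<le> b" "b \<le> c" "c \<le> T" and y: "davie a b y" "davie b c y"
  shows "davie a c y"
proof -
  obtain H where H: "0 \<le> H" and yH: "\<And>a b y s t. 0 \<le> a \<Longrightarrow> a \<le> s \<Longrightarrow> s \<le> t \<Longrightarrow> t \<le> b \<Longrightarrow> b \<le> T \<Longrightarrow> davie a b y \<Longrightarrow>
     norm (y t - y s - incr A s t (y s)) \<le> H * (t - s) powr \<theta> \<and> norm (y t - y s) \<le> H * (t - s) powr \<alpha>"
    using davie_bound by metis
  define M where "M = 2 * H + C * H * T powr (2 * \<alpha> - \<theta>)"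
  have HM: "H \<le> M" using H C by (simp add: M_def)
  have "norm (y t - y s - incr A s t (y s)) \<le> M * (t - s) powr \<theta>" if st: "a \<le> s" "s \<le> t" "t \<le> c" for s t
  proof -
    have HM': "H * (t - s) powr \<theta> \<le> M * (t - s) powr \<theta>" using HM by (intro mult_right_mono) auto
    consider "t \<le> b" | "b \<le> s" | "s \<le> b" "b \<le> t" by linarith
    then show ?thesis
    proof cases
      case 1
      then show ?thesis using yH[of a s t b y] o st y HM' by auto
    next
      case 2
      then show ?thesis using yH[of b s t c y] o st y HM' by auto
    next
      case 3
      have mono: "(b - s) powr p \<le> (t - s) powr p" "(t - b) powr p \<le> (t - s) powr p" if "0 \<le> p" for p
        using 3 that by (auto intro!: powr_mono2)
      have 1: "norm (y b - y s - incr A s b (y s)) \<le> H * (t - s) powr \<theta>"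
        using yH[of a s b b y] o st y 3 mono(1)[of \<theta>] \<theta> H by (auto intro: order_trans mult_left_mono)
      have 2: "norm (y t - y b - incr A b t (y b)) \<le> H * (t - s) powr \<theta>"
        using yH[of b b t c y] o st y 3 mono(2)[of \<theta>] \<theta> H by (auto intro: order_trans mult_left_mono)
      have "norm (incr A b t (y b) - incr A b t (y s)) \<le> C * (t - b) powr \<alpha> * norm (y b - y s)"
        using o st 3 by (intro incr_lipschitz) auto
      also have "\<dots> \<le> C * (t - s) powr \<alpha> * (H * (t - s) powr \<alpha>)"
        using yH[of a s b b y] o st y 3 mono[of \<alpha>] \<alpha> H C by (intro mult_mono) (auto intro: order_trans mult_left_mono)
      also have "\<dots> = C * H * (t - s) powr (2 * \<alpha>)" by (simp only: powr_twice) (simp only: ac_simps)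
      also have "\<dots> \<le> C * H * (T powr (2 * \<alpha> - \<theta>) * (t - s) powr \<theta>)"
        using C H st o \<theta> by (intro mult_left_mono powr_le_scaled) auto
      finally have 3: "norm (incr A b t (y b) - incr A b t (y s)) \<le> C * H * (T powr (2 * \<alpha> - \<theta>) * (t - s) powr \<theta>)" .
      have eq: "y t - y s - incr A s t (y s) = (y b - y s - incr A s b (y s)) + (y t - y b - incr A b t (y b)) + (incr A b t (y b) - incr A b t (y s))"
        by (simp add: incr_def)
      have "norm (y t - y s - incr A s t (y s)) \<le> H * (t - s) powr \<theta> + H * (t - s) powr \<theta> + C * H * (T powr (2 * \<alpha> - \<theta>) * (t - s) powr \<theta>)"
        unfolding eq by (rule order_trans[OF norm_triangle_ineq add_mono[OF order_trans[OF norm_triangle_ineq add_mono[OF 1 2]] 3]])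
      then show ?thesis by (simp add: M_def algebra_simps)
    qed
  qed
  then show ?thesis unfolding davie_def by blast
qed

lemma davie_exists:
  assumes "0 \<le> s" "s \<le> T"
  shows "\<exists>y. y s = x \<and> davie s T y"
proof -
  obtain h where h: "0 < h" and ex: "\<And>a b x. 0 \<le> a \<Longrightarrow> a \<le> b \<Longrightarrow> b \<le> T \<Longrightarrow> b - a \<le> h \<Longrightarrow> \<exists>y. y a = x \<and> davie a b y"
    using davie_exists_short by metis
  have "\<exists>y. y s = x \<and> davie s T y" if "0 \<le> s" "s \<le> T" "T - s \<le> real n * h" for n s x
    using that
  proof (induction n arbitrary: s x)
    case 0
    then show ?case using ex[of s T x] h by simp
  next
    case (Suc n)
    \<comment> \<open>One short step forward; the induction hypothesis, general in the starting time
      and point, continues from u.\<close>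
    define u where "u = min T (s + h)"
    have u: "0 \<le> u" "s \<le> u" "u \<le> T" "u - s \<le> h" "T - u \<le> real n * h"
      using Suc.prems h by (auto simp: u_def min_def algebra_simps)
    obtain y1 where y1: "y1 s = x" "davie s u y1" using ex[of s u x] u Suc.prems by blast
    obtain y2 where y2: "y2 u = y1 u" "davie u T y2" using Suc.IH[of u "y1 u"] u by blast
    define y where "y = (\<lambda>t. if t \<le> u then y1 t else y2 t)"
    have "davie s u y" by (rule davie_cong[OF y1(2)]) (simp add: y_def)
    moreover have "davie u T y" by (rule davie_cong[OF y2(2)]) (use y2(1) in \<open>auto simp: y_def\<close>)
    ultimately have "davie s T y" using davie_concat Suc.prems u by blast
    moreover have "y s = x" using u y1 by (simp add: y_def)
    ultimately show ?case by blast
  qed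
  moreover obtain n where "T - s \<le> real n * h"
    using reals_Archimedean3[OF h] less_imp_le by blast
  ultimately show ?thesis using assms by blast
qed

lemma davie_unique:
  assumes "0 \<le> a" "a \<le> t" "t \<le> b" "b \<le> T" "davie a b y" "davie a b y1" "y1 a = y a"
  shows "y1 t = y t"
proof -
  obtain K where "0 \<le> K" and dz: "\<And>a b y y1 s t. 0 \<le> a \<Longrightarrow> a \<le> s \<Longrightarrow> s \<le> t \<Longrightarrow> t \<le> b \<Longrightarrow> b \<le> T \<Longrightarrow> davie a b y \<Longrightarrow> davie a b y1 \<Longrightarrow>
     norm (y1 t - y t) \<le> K * norm (y1 a - y a)"
    using davie_diff by metis
  then have "norm (y1 t - y t) \<le> K * norm (y1 a - y a)" using assms by blast
  then show ?thesis using assms by simp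
qed

end

section \<open>The flow\<close>

lemma homeomorphism_UNIV_inv: "homeomorphism UNIV UNIV f g \<Longrightarrow> inv f = g"
  by (rule inv_equality) (auto simp: homeomorphism_def)

lemma hoelder_pathI:
  assumes "\<And>u v. a \<le> u \<Longrightarrow> u < v \<Longrightarrow> v \<le> b \<Longrightarrow> norm (y v - y u) \<le> M * (v - u) powr \<alpha>"
  shows "hoelder_path \<alpha> a b y"
  unfolding hoelder_path_def using assms by (intro bdd_aboveI[of _ M]) (auto simp: divide_le_eq)

lemma hoelder_pathD:
  assumes "hoelder_path \<alpha> a b y"
  shows "\<exists>M\<ge>0. \<forall>u v. a \<le> u \<and> u \<le> v \<and> v \<le> b \<longrightarrow> norm (y v - y u) \<le> M * (v - u) powr \<alpha>"
proof -
  obtain M where M: "\<And>u v. a \<le> u \<Longrightarrow> u < v \<Longrightarrow> v \<le> b \<Longrightarrow> norm (y v - y u) / \<bar>v - u\<bar> powr \<alpha> \<le> M"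
    using assms unfolding hoelder_path_def bdd_above_def by blast
  have "norm (y v - y u) \<le> max 0 M * (v - u) powr \<alpha>" if "a \<le> u" "u \<le> v" "v \<le> b" for u v
  proof (cases "u = v")
    case False
    then have "norm (y v - y u) \<le> M * (v - u) powr \<alpha>" using M[of u v] that by (simp add: divide_le_eq)
    also have "\<dots> \<le> max 0 M * (v - u) powr \<alpha>" by (intro mult_right_mono) auto
    finally show ?thesis .
  qed simp
  then show ?thesis by (intro exI[of _ "max 0 M"]) auto
qed

context young_field
begin

text \<open>The choice is of a whole path, made before evaluation at \<open>t\<close>. By
  \<open>davie_unique\<close> its values on [s, T] do not depend on the choice.\<close>

definition flow :: "real \<Rightarrow> real \<Rightarrow> 'v \<Rightarrow> 'v" where
  "flow s t x = (SOME y. y s = x \<and> davie s T y) t"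

lemma flow_davie:
  assumes "0 \<le> s" "s \<le> T"
  shows "davie s T (\<lambda>t. flow s t x)" "flow s s x = x"
  using someI_ex[OF davie_exists[OF assms, of x]] unfolding flow_def by auto

text \<open>Restarting at time u and continuing the old path are two Davie solutions on [u, T] with
  the same value at u.\<close>

lemma flow_semigroup:
  assumes "0 \<le> s" "s \<le> u" "u \<le> t" "t \<le> T"
  shows "flow u t (flow s u x) = flow s t x"
  by (rule davie_unique[of u t T "\<lambda>t. flow s t x"])
    (use assms flow_davie[of s x] flow_davie[of u "flow s u x"] davie_subinterval[of s T "\<lambda>t. flow s t x" u T] in auto)

lemma flow_nl_young_integral:
  assumes "0 \<le> s" "s \<le> t" "t \<le> T"
  shows "nl_young_integral A (\<lambda>r. flow s r x) s t (flow s t x - x)"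
proof -
  obtain M where M: "\<And>u v. s \<le> u \<Longrightarrow> u \<le> v \<Longrightarrow> v \<le> T \<Longrightarrow>
      norm (flow s v x - flow s u x - incr A u v (flow s u x)) \<le> M * (v - u) powr \<theta>"
    using flow_davie(1)[of s x] assms unfolding davie_def by auto
  have "riemann_lim (\<lambda>u v. incr A u v (flow s u x)) s t (flow s t x - flow s s x)"
    by (rule riemann_limI[OF \<theta>(1) assms(2), where M = M]) (use M assms in auto)
  then show ?thesis unfolding nl_young_integral_def incr_def using flow_davie(2) assms by simp
qed

lemma flow_bounds:
  "\<exists>K\<ge>0. \<forall>s u t x z. 0 \<le> s \<and> s \<le> u \<and> u \<le> t \<and> t \<le> T \<longrightarrow>
     norm (flow s t x - flow s u x) \<le> K * (t - u) powr \<alpha> \<and>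
     norm (flow s t z - flow s t x) \<le> K * norm (z - x) \<and>
     norm ((flow s t z - flow s t x) - (flow s u z - flow s u x) - (incr A u t (flow s u z) - incr A u t (flow s u x)))
        \<le> K * norm (z - x) * (t - u) powr \<theta> \<and>
     norm ((flow s t z - flow s t x) - (flow s u z - flow s u x)) \<le> K * norm (z - x) * (t - u) powr \<alpha>"
proof -
  obtain H where H: "0 \<le> H" and yH: "\<And>a b y s t. 0 \<le> a \<Longrightarrow> a \<le> s \<Longrightarrow> s \<le> t \<Longrightarrow> t \<le> b \<Longrightarrow> b \<le> T \<Longrightarrow> davie a b y \<Longrightarrow>
     norm (y t - y s) \<le> H * (t - s) powr \<alpha>"
    using davie_bound by metis
  obtain K where K: "0 \<le> K" and dz: "\<And>a b y y1 s t. 0 \<le> a \<Longrightarrow> a \<le> s \<Longrightarrow> s \<le> t \<Longrightarrow> t \<le> b \<Longrightarrow> b \<le> T \<Longrightarrow> davie a b y \<Longrightarrow> davie a b y1 \<Longrightarrow>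
     norm (y1 t - y t) \<le> K * norm (y1 a - y a) \<and>
     norm ((y1 t - y t) - (y1 s - y s) - (incr A s t (y1 s) - incr A s t (y s))) \<le> K * norm (y1 a - y a) * (t - s) powr \<theta> \<and>
     norm ((y1 t - y t) - (y1 s - y s)) \<le> K * norm (y1 a - y a) * (t - s) powr \<alpha>"
    using davie_diff by metis
  show ?thesis
  proof (intro exI[of _ "H + K"] conjI allI impI add_nonneg_nonneg H K; elim conjE)
    fix s u t x z assume o: "0 \<le> s" "s \<le> u" "u \<le> t" "t \<le> T"
    have sT: "s \<le> T" using o by simp
    have mono: "X * b \<le> (H + K) * b" if "X \<le> H + K" "0 \<le> b" for X b using that by (intro mult_right_mono)
    show "norm (flow s t x - flow s u x) \<le> (H + K) * (t - u) powr \<alpha>"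
      by (rule order_trans[OF yH[OF o order_refl flow_davie(1)[OF o(1) sT]] mono]) (use K in auto)
    note d = dz[OF o order_refl flow_davie(1)[OF o(1) sT, of x] flow_davie(1)[OF o(1) sT, of z], unfolded flow_davie(2)[OF o(1) sT]]
    show "norm (flow s t z - flow s t x) \<le> (H + K) * norm (z - x)"
      by (rule order_trans[OF conjunct1[OF d] mono]) (use H in auto)
    show "norm ((flow s t z - flow s t x) - (flow s u z - flow s u x) - (incr A u t (flow s u z) - incr A u t (flow s u x)))
        \<le> (H + K) * norm (z - x) * (t - u) powr \<theta>"
      by (rule order_trans[OF conjunct1[OF conjunct2[OF d]]], unfold mult.assoc, rule mono) (use H in auto)
    show "norm ((flow s t z - flow s t x) - (flow s u z - flow s u x)) \<le> (H + K) * norm (z - x) * (t - u) powr \<alpha>"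
      by (rule order_trans[OF conjunct2[OF conjunct2[OF d]]], unfold mult.assoc, rule mono) (use H in auto)
  qed
qed

lemma flow_C1:
  assumes st: "0 \<le> s" "s \<le> t" "t \<le> T"
  shows "C1_map (flow s t)"
proof -
  have sT: "s \<le> T" using st by simp
  from davie_combination obtain K \<eta> where K: "0 \<le> K" "0 < \<eta>" and comb: "\<forall>a b y (I :: nat set) c Y t.
     finite I \<and> 0 \<le> a \<and> a \<le> t \<and> t \<le> b \<and> b \<le> T \<and> davie a b y \<and> (\<forall>i\<in>I. davie a b (Y i) \<and> norm (Y i a - y a) \<le> 1) \<longrightarrow>
     norm (\<Sum>i\<in>I. c i *\<^sub>R (Y i t - y t)) \<le> K * (norm (\<Sum>i\<in>I. c i *\<^sub>R (Y i a - y a)) +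
        (\<Sum>i\<in>I. \<bar>c i\<bar> * norm (Y i a - y a) powr (1 + \<eta>)))"
    by (elim exE conjE)
  have "\<exists>D. \<forall>k. norm k \<le> 1 \<longrightarrow> norm (flow s t (x + k) - flow s t x - blinfun_apply D k) \<le> K * norm k powr (1 + \<eta>)" for x
  proof (rule derivative_from_combinations[OF K])
    fix c1 c2 c3 :: real and k1 k2 k3 :: 'v
    assume k: "norm k1 \<le> 1" "norm k2 \<le> 1" "norm k3 \<le> 1"
    \<comment> \<open>The three terms are encoded as a family over {0, 1, 2} to match the indexed
      form of \<open>davie_combination\<close>.\<close>
    define c where "c = (\<lambda>i::nat. if i = 0 then c1 else if i = 1 then c2 else c3)"
    define p where "p = (\<lambda>i::nat. if i = 0 then k1 else if i = 1 then k2 else k3)"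
    have sum3: "(\<Sum>i\<in>{0,1,2::nat}. g i) = g 0 + g 1 + g 2" for g :: "nat \<Rightarrow> 'b::comm_monoid_add"
      by (simp add: add.assoc)
    have "norm (\<Sum>i\<in>{0,1,2}. c i *\<^sub>R (flow s t (x + p i) - flow s t x))
       \<le> K * (norm (\<Sum>i\<in>{0,1,2}. c i *\<^sub>R (flow s s (x + p i) - flow s s x)) +
        (\<Sum>i\<in>{0,1,2}. \<bar>c i\<bar> * norm (flow s s (x + p i) - flow s s x) powr (1 + \<eta>)))"
      by (rule comb[rule_format, where y = "\<lambda>t. flow s t x" and Y = "\<lambda>i t. flow s t (x + p i)" and b = T])
        (use st sT flow_davie k in \<open>auto simp: p_def\<close>)
    then show "norm (c1 *\<^sub>R (flow s t (x + k1) - flow s t x) + c2 *\<^sub>R (flow s t (x + k2) - flow s t x) + c3 *\<^sub>R (flow s t (x + k3) - flow s t x))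
      \<le> K * (norm (c1 *\<^sub>R k1 + c2 *\<^sub>R k2 + c3 *\<^sub>R k3) +
            (\<bar>c1\<bar> * norm k1 powr (1 + \<eta>) + \<bar>c2\<bar> * norm k2 powr (1 + \<eta>) + \<bar>c3\<bar> * norm k3 powr (1 + \<eta>)))"
      unfolding sum3 flow_davie(2)[OF st(1) sT] by (simp add: c_def p_def)
  qed
  then obtain D where D: "\<And>x k. norm k \<le> 1 \<Longrightarrow> norm (flow s t (x + k) - flow s t x - blinfun_apply (D x) k) \<le> K * norm k powr (1 + \<eta>)"
    by metis
  show ?thesis
    unfolding C1_map_def using C1_from_uniform_taylor[OF K D] by blast
qed

text \<open>Over a time h with K h^\<alpha> \<le> 1/2, the displacement of the flow is a
  half-contraction. Longer times follow from the semigroup law by composition, since no smallness is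
  left to use there.\<close>

lemma flow_diffeomorphism:
  assumes "0 \<le> s" "s \<le> t" "t \<le> T"
  shows "homeomorphism UNIV UNIV (flow s t) (inv (flow s t)) \<and> C1_map (inv (flow s t))"
proof -
  obtain K where K: "0 \<le> K" and fb: "\<And>s u t x z. 0 \<le> s \<Longrightarrow> s \<le> u \<Longrightarrow> u \<le> t \<Longrightarrow> t \<le> T \<Longrightarrow>
     norm ((flow s t z - flow s t x) - (flow s u z - flow s u x)) \<le> K * norm (z - x) * (t - u) powr \<alpha>"
    using flow_bounds by metis
  obtain h where h: "0 < h" "h \<le> 1" "K * h powr \<alpha> \<le> 1/2" using ex_small_powr[OF \<alpha>(1) K] by blast
  have short: "homeomorphism UNIV UNIV (flow s t) (inv (flow s t)) \<and> C1_map (inv (flow s t))"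
    if st: "0 \<le> s" "s \<le> t" "t \<le> T" "t - s \<le> h" for s t
  proof -
    have lip: "norm ((flow s t x - x) - (flow s t y - y)) \<le> 1/2 * norm (x - y)" for x y
    proof -
      \<comment> \<open>At time s the flow is the identity, so the perturbation is a time increment
        of a difference of two flow lines.\<close>
      have eq: "(flow s t x - x) - (flow s t y - y) = (flow s t x - flow s t y) - (flow s s x - flow s s y)"
        using flow_davie(2) st by simp
      have "norm ((flow s t x - x) - (flow s t y - y)) \<le> K * norm (x - y) * (t - s) powr \<alpha>"
        unfolding eq by (rule fb) (use st in auto)
      also have "\<dots> \<le> K * norm (x - y) * h powr \<alpha>" using st K \<alpha> by (intro mult_left_mono powr_mono2) auto
      also have "\<dots> = (K * h powr \<alpha>) * norm (x - y)" by simp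
      also have "\<dots> \<le> 1/2 * norm (x - y)" using h by (intro mult_right_mono) auto
      finally show ?thesis .
    qed
    from near_identity_diffeo[OF lip flow_C1[OF st(1,2,3)]] show ?thesis by blast
  qed
  have "homeomorphism UNIV UNIV (flow s t) (inv (flow s t)) \<and> C1_map (inv (flow s t))"
    if "0 \<le> s" "s \<le> t" "t \<le> T" "t - s \<le> real n * h" for n s
    using that
  proof (induction n arbitrary: s)
    case 0
    then show ?case using short[of s t] h by simp
  next
    case (Suc n)
    define u where "u = min t (s + h)"
    have u: "0 \<le> u" "s \<le> u" "u \<le> t" "u - s \<le> h" "t - u \<le> real n * h" "u \<le> T"
      using Suc.prems h by (auto simp: u_def min_def algebra_simps)
    have eq: "flow s t = flow u t \<circ> flow s u" using flow_semigroup[of s u t] u Suc.prems by auto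
    note 1 = short[OF Suc.prems(1) u(2,6,4)] and 2 = Suc.IH[OF u(1,3) Suc.prems(3) u(5)]
    have hom: "homeomorphism UNIV UNIV (flow s t) (inv (flow s u) \<circ> inv (flow u t))"
      unfolding eq by (rule homeomorphism_compose) (use 1 2 in auto)
    have "C1_map (inv (flow s u) \<circ> inv (flow u t))" by (rule C1_map_compose) (use 1 2 in auto)
    with hom show ?case unfolding homeomorphism_UNIV_inv[OF hom] by blast
  qed
  moreover obtain n where "t - s \<le> real n * h"
    using reals_Archimedean3[OF h(1)] less_imp_le by blast
  ultimately show ?thesis using assms by blast
qed

lemma flow_diffeo_flow: "flow_diffeo T \<alpha> A flow"
proof -
  obtain K where "0 \<le> K" and fb: "\<And>s u t x z. 0 \<le> s \<Longrightarrow> s \<le> u \<Longrightarrow> u \<le> t \<Longrightarrow> t \<le> T \<Longrightarrow>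
     norm (flow s t x - flow s u x) \<le> K * (t - u) powr \<alpha>"
    using flow_bounds by metis
  have "hoelder_path \<alpha> s T (\<lambda>t. flow s t x)" if "0 \<le> s" for s x
    by (rule hoelder_pathI[where M = K]) (use fb[of s] that in auto)
  then show ?thesis
    unfolding flow_diffeo_def flow_homeo_def
  proof (intro conjI allI ballI impI; (elim conjE)?)
    fix s t assume st: "0 \<le> s" "s \<le> t" "t \<le> T"
    show "C1_map (flow s t)" by (rule flow_C1[OF st])
    show "C1_map (inv (flow s t))" using flow_diffeomorphism[OF st] by blast
    show "\<exists>g. homeomorphism UNIV UNIV (flow s t) g" using flow_diffeomorphism[OF st] by blast
    show "nl_young_integral A (\<lambda>r. flow s r x) s t (flow s t x - x)" for x by (rule flow_nl_young_integral[OF st])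
  qed (simp_all add: flow_davie flow_semigroup)
qed

section \<open>The variational equation\<close>

lemma DA_compose_path:
  assumes o: "0 \<le> s" "s \<le> u" "u \<le> t" "t \<le> T" and H: "0 \<le> H"
    and y: "norm (y u - y s) \<le> H * (u - s) powr \<alpha>"
  shows "norm ((incr DA u t (y u) o\<^sub>L V) - (incr DA u t (y s) o\<^sub>L W))
    \<le> C * (t - s) powr \<alpha> * norm (V - W) + C * H powr \<beta> * (t - s) powr \<theta> * norm W"
proof (rule norm_blinfun_bound)
  fix v
  have "norm (((incr DA u t (y u) o\<^sub>L V) - (incr DA u t (y s) o\<^sub>L W)) v)
     \<le> C * (t - s) powr \<alpha> * norm ((V - W) v) + C * H powr \<beta> * (t - s) powr \<theta> * norm (W v)"
    using DA_apply_path[OF o H y, of "V v" "W v"] by (simp add: blinfun.diff_left)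
  also have "\<dots> \<le> C * (t - s) powr \<alpha> * (norm (V - W) * norm v) + C * H powr \<beta> * (t - s) powr \<theta> * (norm W * norm v)"
    using C by (intro add_mono mult_left_mono norm_blinfun) auto
  finally show "norm (((incr DA u t (y u) o\<^sub>L V) - (incr DA u t (y s) o\<^sub>L W)) v)
     \<le> (C * (t - s) powr \<alpha> * norm (V - W) + C * H powr \<beta> * (t - s) powr \<theta> * norm W) * norm v"
    by (simp add: algebra_simps)
qed (use C in auto)

lemma incr_DA_chasles: "incr DA s t x = incr DA s u x + incr DA u t x"
  by (simp add: incr_def)

lemma ex_flow_derivative_solution:
  assumes s: "0 \<le> s" "s \<le> T"
  shows "\<exists>J. var_solution T \<alpha> DA flow s x J \<and> (\<forall>t\<in>{s..T}. (flow s t has_derivative blinfun_apply (J t)) (at x))"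
proof -
  define y where "y = (\<lambda>t. flow s t x)"
  obtain K where K: "0 \<le> K" and fb: "\<And>u t z. s \<le> u \<Longrightarrow> u \<le> t \<Longrightarrow> t \<le> T \<Longrightarrow>
     norm (flow s t z - flow s t x) \<le> K * norm (z - x) \<and>
     norm ((flow s t z - flow s t x) - (flow s u z - flow s u x) - (incr A u t (flow s u z) - incr A u t (flow s u x)))
        \<le> K * norm (z - x) * (t - u) powr \<theta>"
    using flow_bounds s by metis
  have "\<exists>D. (flow s t has_derivative blinfun_apply D) (at x)" if "s \<le> t" "t \<le> T" for t
    using flow_C1[OF s(1) that] unfolding C1_map_def by blast
  then obtain J where J: "\<And>t. s \<le> t \<Longrightarrow> t \<le> T \<Longrightarrow> (flow s t has_derivative blinfun_apply (J t)) (at x)" by metis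
  have Jbound: "norm (J t) \<le> K" if "s \<le> t" "t \<le> T" for t
    by (rule norm_derivative_le_lipschitz[OF J[OF that] K]) (use fb that in blast)
  have R: "norm (J t - J u - (incr DA u t (y u) o\<^sub>L J u)) \<le> K * (t - u) powr \<theta>" if o: "s \<le> u" "u \<le> t" "t \<le> T" for u t
  proof (rule norm_derivative_le_lipschitz)
    have "((\<lambda>z. incr A u t (flow s u z)) has_derivative (\<lambda>k. incr DA u t (y u) (J u k))) (at x)"
      unfolding y_def by (rule has_derivative_compose[OF J incr_deriv]) (use o s in auto)
    then show "((\<lambda>z. flow s t z - flow s u z - incr A u t (flow s u z)) has_derivative blinfun_apply (J t - J u - (incr DA u t (y u) o\<^sub>L J u))) (at x)"
      using J[of t] J[of u] o by (auto intro!: derivative_eq_intros simp: blinfun.diff_left)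
    show "norm ((flow s t z - flow s u z - incr A u t (flow s u z)) - (flow s t x - flow s u x - incr A u t (flow s u x)))
        \<le> K * (t - u) powr \<theta> * norm (z - x)" for z
      using fb[OF o, of z] by (simp add: algebra_simps)
  qed (use K in simp)
  have Js: "J s = id_blinfun"
  proof -
    have "flow s s = (\<lambda>x. x)" using flow_davie(2) s by auto
    then have "((\<lambda>x. x) has_derivative blinfun_apply (J s)) (at x)" using J[of s] s by simp
    from has_derivative_unique[OF this has_derivative_ident] show ?thesis by (auto intro: blinfun_eqI)
  qed
  have "hoelder_path \<alpha> s T J"
  proof (rule hoelder_pathI)
    fix u t assume o: "s \<le> u" "u < t" "t \<le> T"
    have "norm (J t - J u) \<le> norm (incr DA u t (y u) o\<^sub>L J u) + norm (J t - J u - (incr DA u t (y u) o\<^sub>L J u))"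
      by (rule norm_triangle_sub)
    also have "\<dots> \<le> norm (incr DA u t (y u)) * norm (J u) + K * (t - u) powr \<theta>"
      using R[of u t] o by (intro add_mono norm_blinfun_compose) auto
    also have "\<dots> \<le> C * (t - u) powr \<alpha> * K + K * (T powr (\<theta> - \<alpha>) * (t - u) powr \<alpha>)"
      using o s K C \<theta> by (intro add_mono mult_mono mult_left_mono DA_bound Jbound powr_le_scaled) auto
    also have "\<dots> = (C * K + K * T powr (\<theta> - \<alpha>)) * (t - u) powr \<alpha>" by (simp add: algebra_simps)
    finally show "norm (J t - J u) \<le> (C * K + K * T powr (\<theta> - \<alpha>)) * (t - u) powr \<alpha>" .
  qed
  moreover have "var_young_integral DA (\<lambda>r. flow s r x) J s t (J t - id_blinfun)" if t: "s \<le> t" "t \<le> T" for t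
    unfolding var_young_integral_def Js[symmetric]
    by (rule riemann_limI[OF \<theta>(1) t(1), where M = K]) (use R t in \<open>auto simp: y_def incr_def\<close>)
  ultimately show ?thesis using J unfolding var_solution_def by (intro exI[of _ J]) auto
qed

text \<open>An arbitrary solution is first shown to satisfy the local expansion of order \<theta>,
  which its definition does not provide. Then the difference of two solutions is a germ with
  inhomogeneity 0 that vanishes at s.\<close>

lemma var_solution_unique:
  assumes s: "0 \<le> s" "s \<le> T" and sol: "var_solution T \<alpha> DA flow s x J1" "var_solution T \<alpha> DA flow s x J2"
    and t: "s \<le> t" "t \<le> T"
  shows "J1 t = J2 t"
proof -
  define y where "y = (\<lambda>t. flow s t x)"
  obtain H where H: "0 \<le> H" and yH: "\<And>u t. s \<le> u \<Longrightarrow> u \<le> t \<Longrightarrow> t \<le> T \<Longrightarrow> norm (y t - y u) \<le> H * (t - u) powr \<alpha>"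
    unfolding y_def using flow_bounds s by metis
  have davieJ: "\<exists>M. (\<forall>u t. s \<le> u \<and> u \<le> t \<and> t \<le> T \<longrightarrow> norm (J t - J u - (incr DA u t (y u) o\<^sub>L J u)) \<le> M * (t - u) powr \<theta>) \<and> J s = id_blinfun"
    if J: "var_solution T \<alpha> DA flow s x J" for J
  proof -
    define \<Xi> where "\<Xi> = (\<lambda>u t. incr DA u t (y u) o\<^sub>L J u)"
    obtain M where M: "0 \<le> M" "\<And>u v. s \<le> u \<Longrightarrow> u \<le> v \<Longrightarrow> v \<le> T \<Longrightarrow> norm (J v - J u) \<le> M * (v - u) powr \<alpha>"
      using hoelder_pathD[of \<alpha> s T J] J unfolding var_solution_def by blast
    have rl: "riemann_lim \<Xi> s t (J t - id_blinfun)" if "s \<le> t" "t \<le> T" for t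
      using J that unfolding var_solution_def var_young_integral_def \<Xi>_def y_def incr_def by auto
    define B where "B = norm (J s) + M * T powr \<alpha>"
    have B: "norm (J u) \<le> B" if "s \<le> u" "u \<le> T" for u
    proof -
      have "norm (J u) \<le> norm (J s) + norm (J u - J s)" by (rule norm_triangle_sub)
      also have "norm (J u - J s) \<le> M * (u - s) powr \<alpha>" using M(2)[of s u] that by simp
      also have "\<dots> \<le> M * T powr \<alpha>" using that s M \<alpha> by (intro mult_left_mono powr_mono2) auto
      finally show ?thesis by (simp add: B_def)
    qed
    have B0: "0 \<le> B" using M by (simp add: B_def)
    define E where "E = C * M * T powr (2 * \<alpha> - \<theta>) + C * H powr \<beta> * B"
    have E: "0 \<le> E" using C M B0 by (simp add: E_def)
    have "norm (\<Xi> u t - \<Xi> u r - \<Xi> r t) \<le> E * (t - u) powr \<theta>" if o: "s \<le> u" "u \<le> r" "r \<le> t" "t \<le> T" for u r t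
    proof -
      have "\<Xi> u t - \<Xi> u r - \<Xi> r t = - ((incr DA r t (y r) o\<^sub>L J r) - (incr DA r t (y u) o\<^sub>L J u))"
        unfolding \<Xi>_def incr_DA_chasles[of u t "y u" r]
        by (simp add: bounded_bilinear.add_left[OF bounded_bilinear_blinfun_compose])
      then have "norm (\<Xi> u t - \<Xi> u r - \<Xi> r t) = norm ((incr DA r t (y r) o\<^sub>L J r) - (incr DA r t (y u) o\<^sub>L J u))"
        by (simp only: norm_minus_cancel)
      also have "\<dots> \<le> C * (t - u) powr \<alpha> * norm (J r - J u) + C * H powr \<beta> * (t - u) powr \<theta> * norm (J u)"
        using o s H yH[of u r] by (intro DA_compose_path) auto
      also have "\<dots> \<le> C * (t - u) powr \<alpha> * (M * (t - u) powr \<alpha>) + C * H powr \<beta> * (t - u) powr \<theta> * B"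
      proof (intro add_mono mult_left_mono B)
        have "norm (J r - J u) \<le> M * (r - u) powr \<alpha>" using M(2)[of u r] o by simp
        also have "\<dots> \<le> M * (t - u) powr \<alpha>" using o M \<alpha> by (intro mult_left_mono powr_mono2) auto
        finally show "norm (J r - J u) \<le> M * (t - u) powr \<alpha>" .
      qed (use C o in auto)
      also have "\<dots> = C * M * (t - u) powr (2 * \<alpha>) + C * H powr \<beta> * (t - u) powr \<theta> * B"
        by (simp only: powr_twice) (simp only: ac_simps)
      also have "\<dots> \<le> C * M * (T powr (2 * \<alpha> - \<theta>) * (t - u) powr \<theta>) + C * H powr \<beta> * (t - u) powr \<theta> * B"
        using o s C M \<theta> by (intro add_right_mono mult_left_mono powr_le_scaled) auto
      finally show ?thesis by (simp add: E_def algebra_simps)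
    qed
    from sewing[where \<Xi> = \<Xi>, OF \<theta>(1) E s(2) this]
    obtain I where I: "\<And>u t. s \<le> u \<Longrightarrow> u \<le> t \<Longrightarrow> t \<le> T \<Longrightarrow> norm (I t - I u - \<Xi> u t) \<le> 2 * E * sew_const \<theta> * (t - u) powr \<theta>"
      by blast
    have JI: "J t - id_blinfun = I t - I s" if "s \<le> t" "t \<le> T" for t
    \<comment> \<open>The sewn primitive and the solution are limits of the same Riemann sums, so
      the expansion of the first passes to the second.\<close>
    proof (rule riemann_lim_unique[OF rl[OF that] _ that(1)])
      show "riemann_lim \<Xi> s t (I t - I s)" 
        by (rule riemann_limI[OF \<theta>(1) that(1), where M = "2 * E * sew_const \<theta>"]) (use I that in auto)
    qed
    have "J t - J u = I t - I u" if "s \<le> u" "u \<le> t" "t \<le> T" for u t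
    proof -
      have "J t - J u = (J t - id_blinfun) - (J u - id_blinfun)" by simp
      then show ?thesis using JI[of u] JI[of t] that by simp
    qed
    then show ?thesis using I JI[of s] s unfolding \<Xi>_def by (intro exI[of _ "2 * E * sew_const \<theta>"]) auto
  qed
  obtain M1 where M1: "\<And>u t. s \<le> u \<Longrightarrow> u \<le> t \<Longrightarrow> t \<le> T \<Longrightarrow> norm (J1 t - J1 u - (incr DA u t (y u) o\<^sub>L J1 u)) \<le> M1 * (t - u) powr \<theta>"
    and J1s: "J1 s = id_blinfun" using davieJ[OF sol(1)] by blast
  obtain M2 where M2: "\<And>u t. s \<le> u \<Longrightarrow> u \<le> t \<Longrightarrow> t \<le> T \<Longrightarrow> norm (J2 t - J2 u - (incr DA u t (y u) o\<^sub>L J2 u)) \<le> M2 * (t - u) powr \<theta>"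
    and J2s: "J2 s = id_blinfun" using davieJ[OF sol(2)] by blast
  define w where "w = (\<lambda>t. J1 t - J2 t)"
  define C' where "C' = C + C * H powr \<beta>"
  have C': "0 \<le> C'" "C \<le> C'" "C * H powr \<beta> \<le> C'" using C by (auto simp: C'_def)
  obtain K where gron: "\<And>a b (w :: real \<Rightarrow> 'v \<Rightarrow>\<^sub>L 'v) \<Xi> \<epsilon> s t. 0 \<le> \<epsilon> \<Longrightarrow> a \<le> b \<Longrightarrow> b - a \<le> T \<Longrightarrow>
      young_germ \<alpha> \<theta> C' a b w \<Xi> \<epsilon> \<Longrightarrow> a \<le> s \<Longrightarrow> s \<le> t \<Longrightarrow> t \<le> b \<Longrightarrow> norm (w t) \<le> K * (norm (w a) + \<epsilon>)"
    using young_gronwall[where 'w = "'v \<Rightarrow>\<^sub>L 'v", OF \<alpha>(1) \<theta>(1,2,3) C'(1) less_imp_le[OF T]] by metis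
  have "young_germ \<alpha> \<theta> C' s T w (\<lambda>u t. incr DA u t (y u) o\<^sub>L w u) 0"
    unfolding young_germ_def
  proof (intro conjI allI impI; (elim conjE)?)
    have "norm (w t - w u - (incr DA u t (y u) o\<^sub>L w u)) \<le> (M1 + M2) * (t - u) powr \<theta>" if o: "s \<le> u" "u \<le> t" "t \<le> T" for u t
    proof -
      have eq: "w t - w u - (incr DA u t (y u) o\<^sub>L w u)
        = (J1 t - J1 u - (incr DA u t (y u) o\<^sub>L J1 u)) - (J2 t - J2 u - (incr DA u t (y u) o\<^sub>L J2 u))"
        by (simp add: w_def bounded_bilinear.diff_right[OF bounded_bilinear_blinfun_compose])
      show ?thesis unfolding eq distrib_right
        by (rule order_trans[OF norm_triangle_ineq4 add_mono[OF M1[OF o] M2[OF o]]])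
    qed
    then show "\<exists>M. \<forall>u t. s \<le> u \<and> u \<le> t \<and> t \<le> T \<longrightarrow> norm (w t - w u - (incr DA u t (y u) o\<^sub>L w u)) \<le> M * (t - u) powr \<theta>"
      by blast
  next
    fix u t assume o: "s \<le> u" "u \<le> t" "t \<le> T"
    have "norm (incr DA u t (y u) o\<^sub>L w u) \<le> norm (incr DA u t (y u)) * norm (w u)" by (rule norm_blinfun_compose)
    also have "\<dots> \<le> C * (t - u) powr \<alpha> * norm (w u)" using o s by (intro mult_right_mono DA_bound) auto
    also have "\<dots> \<le> C' * (t - u) powr \<alpha> * norm (w u)" using C' by (intro mult_right_mono) auto
    finally show "norm (incr DA u t (y u) o\<^sub>L w u) \<le> C' * (t - u) powr \<alpha> * (norm (w u) + 0)" by simp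
  next
    fix u r t assume o: "s \<le> u" "u \<le> r" "r \<le> t" "t \<le> T"
    have "(incr DA u t (y u) o\<^sub>L w u) - (incr DA u r (y u) o\<^sub>L w u) - (incr DA r t (y r) o\<^sub>L w r)
       = - ((incr DA r t (y r) o\<^sub>L w r) - (incr DA r t (y u) o\<^sub>L w u))"
      unfolding incr_DA_chasles[of u t "y u" r]
      by (simp add: bounded_bilinear.add_left[OF bounded_bilinear_blinfun_compose])
    then have "norm ((incr DA u t (y u) o\<^sub>L w u) - (incr DA u r (y u) o\<^sub>L w u) - (incr DA r t (y r) o\<^sub>L w r))
       = norm ((incr DA r t (y r) o\<^sub>L w r) - (incr DA r t (y u) o\<^sub>L w u))"
      by (simp only: norm_minus_cancel)
    also have "\<dots> \<le> C * (t - u) powr \<alpha> * norm (w r - w u) + C * H powr \<beta> * (t - u) powr \<theta> * norm (w u)"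
      using o s H yH[of u r] by (intro DA_compose_path) auto
    also have "\<dots> \<le> C' * (t - u) powr \<alpha> * norm (w r - w u) + C' * (t - u) powr \<theta> * norm (w u)"
      using C' by (intro add_mono mult_right_mono) auto
    finally show "norm ((incr DA u t (y u) o\<^sub>L w u) - (incr DA u r (y u) o\<^sub>L w u) - (incr DA r t (y r) o\<^sub>L w r))
       \<le> C' * (t - u) powr \<alpha> * norm (w r - w u) + C' * (t - u) powr \<theta> * (norm (w u) + 0)" by simp
  qed
  from gron[OF order_refl s(2) _ this order_refl t] have "norm (w t) \<le> K * norm (w s)" using s by simp
  then show ?thesis by (simp add: w_def J1s J2s)
qed

end

section \<open>Pointwise bounds from the norm conditions\<close>

text \<open>On a space with one point, \<open>hoelder_ratios\<close> is empty and its real supremum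
  carries no information; \<open>triv\<close> settles that case by making the target trivial too.
  Otherwise both suprema in \<open>hoelder_norm\<close> are nonnegative, so each is bounded by their
  sum.\<close>

lemma field_finite_bounds:
  fixes F :: "real \<Rightarrow> 'v::real_normed_vector \<Rightarrow> 'w::real_normed_vector"
  assumes fin: "field_finite T \<alpha> \<beta> F" and triv: "(\<forall>x y :: 'v. x = y) \<longrightarrow> (\<forall>w :: 'w. w = 0)"
  shows "\<exists>C\<ge>0. \<forall>s t x z. 0 \<le> s \<and> s \<le> t \<and> t \<le> T \<longrightarrow> norm (incr F s t x) \<le> C * (t - s) powr \<alpha> \<and>
     norm (incr F s t x - incr F s t z) \<le> C * (t - s) powr \<alpha> * norm (x - z) powr \<beta>"
proof (cases "\<forall>x y :: 'v. x = y")
  case True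
  then have "w = 0" for w :: 'w using triv by blast
  then have "norm w \<le> 0" for w :: 'w by (metis norm_zero order_refl)
  then show ?thesis by (intro exI[of _ 0]) auto
next
  case False
  then obtain p q :: 'v where pq: "p \<noteq> q" by blast
  obtain B where B: "\<And>s t. 0 \<le> s \<Longrightarrow> s < t \<Longrightarrow> t \<le> T \<Longrightarrow> hoelder_norm \<beta> (incr F s t) / \<bar>t - s\<bar> powr \<alpha> \<le> B"
    using fin unfolding field_finite_def bdd_above_def by blast
  define C where "C = max 0 B"
  have "norm (incr F s t x) \<le> C * (t - s) powr \<alpha> \<and>
     norm (incr F s t x - incr F s t z) \<le> C * (t - s) powr \<alpha> * norm (x - z) powr \<beta>"
    if st: "0 \<le> s" "s \<le> t" "t \<le> T" for s t x z
  proof (cases "s = t")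
    case False
    let ?g = "incr F s t"
    have bdd: "bdd_above (hoelder_ratios \<beta> ?g)" "bdd_above (range (\<lambda>x. norm (?g x)))"
      using fin False st unfolding field_finite_def hoelder_finite_def by auto
    have "hoelder_norm \<beta> ?g \<le> B * (t - s) powr \<alpha>" using B[of s t] False st by (simp add: divide_le_eq)
    also have "\<dots> \<le> C * (t - s) powr \<alpha>" unfolding C_def by (intro mult_right_mono) auto
    finally have hn: "hoelder_norm \<beta> ?g \<le> C * (t - s) powr \<alpha>" .
    have ratio: "norm (?g x - ?g z) / norm (x - z) powr \<beta> \<le> Sup (hoelder_ratios \<beta> ?g)" if "x \<noteq> z" for x z
      using that by (intro cSup_upper bdd) (auto simp: hoelder_ratios_def)
    have "0 \<le> norm (?g p - ?g q) / norm (p - q) powr \<beta>" by simp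
    \<comment> \<open>Two distinct points exhibit an element of the set of ratios, without which the
      supremum would have no known sign.\<close>
    then have R0: "0 \<le> Sup (hoelder_ratios \<beta> ?g)" using ratio[OF pq] by (rule order_trans)
    have N: "norm (?g x) \<le> Sup (range (\<lambda>x. norm (?g x)))" for x
      by (rule cSup_upper[OF _ bdd(2)]) auto
    have N0: "0 \<le> Sup (range (\<lambda>x. norm (?g x)))" using N[of x] norm_ge_zero order_trans by blast
    have "norm (?g x) \<le> C * (t - s) powr \<alpha>" using N[of x] R0 hn unfolding hoelder_norm_def by linarith
    moreover have "norm (?g x - ?g z) \<le> C * (t - s) powr \<alpha> * norm (x - z) powr \<beta>"
    proof (cases "x = z")
      case False
      have "norm (?g x - ?g z) / norm (x - z) powr \<beta> \<le> C * (t - s) powr \<alpha>"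
        using ratio[OF False] N0 hn unfolding hoelder_norm_def by linarith
      then show ?thesis using False by (simp add: divide_le_eq)
    qed simp
    ultimately show ?thesis by blast
  qed (simp add: incr_def)
  then show ?thesis by (intro exI[of _ C]) (auto simp: C_def)
qed

lemma field_C1beta_imp_young_field:
  fixes A :: "real \<Rightarrow> 'v::banach \<Rightarrow> 'v"
  assumes "T > 0" "0 < \<alpha>" "\<alpha> < 1" "0 < \<beta>" "\<beta> < 1" "\<alpha> * (1 + \<beta>) > 1" and fC: "field_C1beta T \<alpha> \<beta> A DA"
  shows "\<exists>C. young_field T \<alpha> \<beta> C A DA"
proof -
  have fin: "field_finite T \<alpha> \<beta> A" "field_finite T \<alpha> \<beta> DA" using fC by (simp_all add: field_C1beta_def)
  have triv: "(\<forall>x y :: 'v. x = y) \<longrightarrow> (\<forall>w :: 'v. w = 0)" by simp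
  have triv': "(\<forall>x y :: 'v. x = y) \<longrightarrow> (\<forall>w :: 'v \<Rightarrow>\<^sub>L 'v. w = 0)"
    by (intro impI allI blinfun_eqI) simp
  from field_finite_bounds[OF fin(1) triv]
  obtain C1 where C1: "0 \<le> C1" "\<forall>s t x z. 0 \<le> s \<and> s \<le> t \<and> t \<le> T \<longrightarrow> norm (incr A s t x) \<le> C1 * (t - s) powr \<alpha> \<and>
     norm (incr A s t x - incr A s t z) \<le> C1 * (t - s) powr \<alpha> * norm (x - z) powr \<beta>"
    by (elim exE conjE)
  from field_finite_bounds[OF fin(2) triv']
  obtain C2 where C2: "0 \<le> C2" "\<forall>s t x z. 0 \<le> s \<and> s \<le> t \<and> t \<le> T \<longrightarrow> norm (incr DA s t x) \<le> C2 * (t - s) powr \<alpha> \<and>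
     norm (incr DA s t x - incr DA s t z) \<le> C2 * (t - s) powr \<alpha> * norm (x - z) powr \<beta>"
    by (elim exE conjE)
  have le: "C1 * X \<le> (C1 + C2) * X" "C2 * X \<le> (C1 + C2) * X" if "0 \<le> X" for X :: real
    using that C1 C2 by (auto intro: mult_right_mono)
  have "young_field T \<alpha> \<beta> (C1 + C2) A DA"
  proof
    fix s t :: real and x z :: 'v assume st: "0 \<le> s" "s \<le> t" "t \<le> T"
    show "norm (incr A s t x) \<le> (C1 + C2) * (t - s) powr \<alpha>"
      by (rule order_trans[OF _ le(1)]) (use C1(2) st in auto)
    show "norm (incr DA s t x) \<le> (C1 + C2) * (t - s) powr \<alpha>"
      by (rule order_trans[OF _ le(2)]) (use C2(2) st in auto)
    show "norm (incr DA s t x - incr DA s t z) \<le> (C1 + C2) * (t - s) powr \<alpha> * norm (x - z) powr \<beta>"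
      unfolding mult.assoc by (rule order_trans[OF _ le(2)]) (use C2(2) st in \<open>auto simp: mult.assoc\<close>)
  next
    fix t x assume "0 \<le> t" "t \<le> T"
    then show "(A t has_derivative blinfun_apply (DA t x)) (at x)"
      using fC unfolding field_C1beta_def by simp
  qed (use assms C1 C2 in auto)
  then show ?thesis by blast
qed

theorem mainTheorem9:
  fixes T \<alpha> \<beta> :: real
    and A :: "real \<Rightarrow> 'v::banach \<Rightarrow> 'v"
    and DA :: "real \<Rightarrow> 'v \<Rightarrow> ('v \<Rightarrow>\<^sub>L 'v)"
  assumes "separable_space (euclidean :: 'v topology)"
    and "T > 0"
    and "0 < \<alpha>" "\<alpha> < 1" "0 < \<beta>" "\<beta> < 1" "\<alpha> * (1 + \<beta>) > 1"
    and "\<forall>x. A 0 x = 0"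
    and "field_C1beta T \<alpha> \<beta> A DA"
  shows "\<exists>\<Phi>. flow_diffeo T \<alpha> A \<Phi> \<and>
           (\<forall>s\<in>{0..T}. \<forall>x. \<exists>J. var_solution T \<alpha> DA \<Phi> s x J \<and>
               (\<forall>J'. var_solution T \<alpha> DA \<Phi> s x J' \<longrightarrow> (\<forall>t\<in>{s..T}. J' t = J t)) \<and>
               (\<forall>t\<in>{s..T}. (\<Phi> s t has_derivative blinfun_apply (J t)) (at x)))"
proof -
  obtain C where "young_field T \<alpha> \<beta> C A DA"
    using field_C1beta_imp_young_field assms by blast
  then interpret young_field T \<alpha> \<beta> C A DA .
  show ?thesis
  proof (intro exI[of _ flow] conjI flow_diffeo_flow ballI allI)
    fix s x assume "s \<in> {0..T}"
    then have s: "0 \<le> s" "s \<le> T" by auto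
    obtain J where J: "var_solution T \<alpha> DA flow s x J" "\<forall>t\<in>{s..T}. (flow s t has_derivative blinfun_apply (J t)) (at x)"
      using ex_flow_derivative_solution[OF s] by blast
    moreover have "J' t = J t" if "var_solution T \<alpha> DA flow s x J'" "t \<in> {s..T}" for J' t
      using var_solution_unique[OF s that(1) J(1)] that(2) by simp
    ultimately show "\<exists>J. var_solution T \<alpha> DA flow s x J \<and>
               (\<forall>J'. var_solution T \<alpha> DA flow s x J' \<longrightarrow> (\<forall>t\<in>{s..T}. J' t = J t)) \<and>
               (\<forall>t\<in>{s..T}. (flow s t has_derivative blinfun_apply (J t)) (at x))"
      by blast
  qed
qed

end
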